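(* Let $n$ be a nonnegative integer and let $\lambda,\mu,\nu$ be partitions of $n$. Then $$g_{\mu\nu}^{\lambda}=\sum_{i=1}^{\ell(\mu)\ell(\nu)}(-1)^{i+1}\,\overline{g}_{\bar\mu\,\bar\nu}^{\,\lambda^{\dagger i}}.$$
   Context: A partition is a finite weakly decreasing sequence of positive integers, identified with an infinite sequence by appending zeros; $\ell(\lambda)$ is its number of nonzero parts and $|\lambda|$ the sum of its parts. For partitions $\lambda,\mu,\nu$ of the same weight $n$, the Kronecker coefficient $g_{\mu\nu}^{\lambda}$ is the multiplicity of the irreducible $\mathfrak{S}_n$-representation $V_\lambda$ in $V_\mu\otimes V_\nu$ (over $\mathbb{C}$). For a partition $\lambda=(\lambda_1,\lambda_2,\ldots)$, $\bar\lambda=(\lambda_2,\lambda_3,\ldots)$. For a partition $\alpha=(\alpha_1,\ldots,\alpha_k)$ and an integer $n$, $\alpha[n]=(n-|\alpha|,\alpha_1,\ldots,\alpha_k)$; it is a partition when $n\ge|\alpha|+\alpha_1$. For partitions $\alpha,\beta,\gamma$, the sequence $g_{\alpha[n],\beta[n]}^{\gamma[n]}$ is eventually constant as $n\to\infty$ (Murnaghan); the reduced Kronecker coefficient $\overline{g}_{\alpha\beta}^{\gamma}$ (also written $\overline{g}_{\alpha,\beta}^{\gamma}$) is its stable value. For an infinite sequence $u=(u_1,u_2,\ldots)$ and a positive integer $i$, $u^{\dagger i}$ is the sequence obtained from $u$ by adding $1$ to its first $i-1$ terms and erasing its $i$-th term: $$u^{\dagger i}=(1+u_1,1+u_2,\ldots,1+u_{i-1},u_{i+1},u_{i+2},\ldots).$$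 If $\lambda$ is a partition then so is $\lambda^{\dagger i}$ for all positive integers $i$.
   Formalization: The formal theorem assumes n is positive; for n = 0 the printed identity fails, since all three partitions are empty, the Kronecker coefficient is 1, and the right-hand side is an empty sum equal to 0. *)

theory Defs
  imports Complex_Main "HOL-Algebra.Sym_Groups" "HOL-Library.Function_Algebras"
begin

section \<open>Partitions\<close>

text \<open>A partition is a weakly decreasing, eventually zero sequence. Sequences are indexed
  from 0, so the part usually written with subscript \<open>i + 1\<close> is \<open>lam i\<close>.\<close>

definition is_partition :: "(nat \<Rightarrow> nat) \<Rightarrow> bool" where
  "is_partition lam \<longleftrightarrow> antimono lam \<and> finite {i. lam i \<noteq> 0}"

definition psize :: "(nat \<Rightarrow> nat) \<Rightarrow> nat" where
  "psize lam = (\<Sum>i | lam i \<noteq> 0. lam i)"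

definition plength :: "(nat \<Rightarrow> nat) \<Rightarrow> nat" where
  "plength lam = card {i. lam i \<noteq> 0}"

definition partition_of :: "nat \<Rightarrow> (nat \<Rightarrow> nat) \<Rightarrow> bool" where
  "partition_of n lam \<longleftrightarrow> is_partition lam \<and> psize lam = n"

definition bar :: "(nat \<Rightarrow> nat) \<Rightarrow> nat \<Rightarrow> nat" where
  "bar lam = (\<lambda>i. lam (Suc i))"

text \<open>\<open>pad \<alpha> n\<close> is \<open>\<alpha>[n]\<close>. It is only meaningful for \<open>n \<ge> psize \<alpha> + \<alpha> 0\<close>; it is only used for
  all sufficiently large \<open>n\<close>, where the subtraction does not truncate.\<close>

definition pad :: "(nat \<Rightarrow> nat) \<Rightarrow> nat \<Rightarrow> nat \<Rightarrow> nat" where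
  "pad \<alpha> n = case_nat (n - psize \<alpha>) \<alpha>"

text \<open>The position \<open>i \<ge> 1\<close> of the erased term is counted from 1, unlike the index \<open>j\<close>.\<close>

definition dagger :: "(nat \<Rightarrow> nat) \<Rightarrow> nat \<Rightarrow> nat \<Rightarrow> nat" where
  "dagger u i = (\<lambda>j. if j + 1 < i then 1 + u j else u (j + 1))"


section \<open>Complex representations\<close>

text \<open>All representation spaces below are subspaces of the complex functions on some type.\<close>

definition cscale :: "complex \<Rightarrow> ('x \<Rightarrow> complex) \<Rightarrow> 'x \<Rightarrow> complex" where
  "cscale c f = (\<lambda>x. c * f x)"

global_interpretation cfun: vector_space cscale
  by unfold_locales (auto simp: cscale_def fun_eq_iff algebra_simps)

locale representation = group G for G (structure) +
  fixes V :: "('x \<Rightarrow> complex) set" and \<rho> :: "'g \<Rightarrow> ('x \<Rightarrow> complex) \<Rightarrow> 'x \<Rightarrow> complex"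
  assumes subspace: "cfun.subspace V"
    and closed: "g \<in> carrier G \<Longrightarrow> v \<in> V \<Longrightarrow> \<rho> g v \<in> V"
    and add: "g \<in> carrier G \<Longrightarrow> v \<in> V \<Longrightarrow> w \<in> V \<Longrightarrow> \<rho> g (v + w) = \<rho> g v + \<rho> g w"
    and scale: "g \<in> carrier G \<Longrightarrow> v \<in> V \<Longrightarrow> \<rho> g (cscale c v) = cscale c (\<rho> g v)"
    and act_one: "v \<in> V \<Longrightarrow> \<rho> \<one> v = v"
    and act_mult: "g \<in> carrier G \<Longrightarrow> h \<in> carrier G \<Longrightarrow> v \<in> V \<Longrightarrow> \<rho> (g \<otimes> h) v = \<rho> g (\<rho> h v)"

definition irreducible_representation ::
  "('g, 'm) monoid_scheme \<Rightarrow> ('x \<Rightarrow> complex) set \<Rightarrow> ('g \<Rightarrow> ('x \<Rightarrow> complex) \<Rightarrow> 'x \<Rightarrow> complex) \<Rightarrow> bool"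
where
  "irreducible_representation G V \<rho> \<longleftrightarrow>
     representation G V \<rho> \<and> V \<noteq> {0} \<and>
     (\<forall>U. U \<subseteq> V \<and> representation G U \<rho> \<longrightarrow> U = {0} \<or> U = V)"

definition isomorphic_representations ::
  "('g, 'm) monoid_scheme
   \<Rightarrow> ('x \<Rightarrow> complex) set \<Rightarrow> ('g \<Rightarrow> ('x \<Rightarrow> complex) \<Rightarrow> 'x \<Rightarrow> complex)
   \<Rightarrow> ('y \<Rightarrow> complex) set \<Rightarrow> ('g \<Rightarrow> ('y \<Rightarrow> complex) \<Rightarrow> 'y \<Rightarrow> complex) \<Rightarrow> bool"
where
  "isomorphic_representations G V \<rho> W \<sigma> \<longleftrightarrow>
     (\<exists>\<phi>. bij_betw \<phi> V W \<and>
        (\<forall>v\<in>V. \<forall>w\<in>V. \<phi> (v + w) = \<phi> v + \<phi> w) \<and>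
        (\<forall>c. \<forall>v\<in>V. \<phi> (cscale c v) = cscale c (\<phi> v)) \<and>
        (\<forall>g\<in>carrier G. \<forall>v\<in>V. \<phi> (\<rho> g v) = \<sigma> g (\<phi> v)))"

text \<open>The last conjunct says that \<open>W\<close> is the internal direct sum of the members of \<open>\<U>\<close>: every
  element of \<open>W\<close> is a sum of elements \<open>u U \<in> U\<close> for exactly one choice function \<open>u\<close>.\<close>

definition irreducible_decomposition ::
  "('g, 'm) monoid_scheme \<Rightarrow> ('x \<Rightarrow> complex) set \<Rightarrow> ('g \<Rightarrow> ('x \<Rightarrow> complex) \<Rightarrow> 'x \<Rightarrow> complex)
   \<Rightarrow> ('x \<Rightarrow> complex) set set \<Rightarrow> bool"
where
  "irreducible_decomposition G W \<sigma> \<U> \<longleftrightarrow>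
     finite \<U> \<and> (\<forall>U\<in>\<U>. irreducible_representation G U \<sigma>) \<and>
     bij_betw (\<lambda>u. \<Sum>U\<in>\<U>. u U) (\<Pi>\<^sub>E U\<in>\<U>. U) W"

text \<open>The multiplicity of an irreducible \<open>V\<close> in \<open>W\<close>. By Maschke and Krull--Schmidt it is well
  defined for finite-dimensional complex representations of a finite group.\<close>

definition rep_multiplicity ::
  "('g, 'm) monoid_scheme
   \<Rightarrow> ('x \<Rightarrow> complex) set \<Rightarrow> ('g \<Rightarrow> ('x \<Rightarrow> complex) \<Rightarrow> 'x \<Rightarrow> complex)
   \<Rightarrow> ('y \<Rightarrow> complex) set \<Rightarrow> ('g \<Rightarrow> ('y \<Rightarrow> complex) \<Rightarrow> 'y \<Rightarrow> complex) \<Rightarrow> nat"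
where
  "rep_multiplicity G V \<rho> W \<sigma> =
     (THE m. \<exists>\<U>. irreducible_decomposition G W \<sigma> \<U> \<and>
        m = card {U \<in> \<U>. isomorphic_representations G V \<rho> U \<sigma>})"


section \<open>The irreducible representations of the symmetric group\<close>

text \<open>The group algebra of \<open>sym_group n\<close>, as functions supported on the permutations of
  \<open>{1..n}\<close>, with convolution as its product.\<close>

definition group_algebra :: "nat \<Rightarrow> ((nat \<Rightarrow> nat) \<Rightarrow> complex) set" where
  "group_algebra n = {f. \<forall>p. p \<notin> carrier (sym_group n) \<longrightarrow> f p = 0}"

definition conv ::
  "nat \<Rightarrow> ((nat \<Rightarrow> nat) \<Rightarrow> complex) \<Rightarrow> ((nat \<Rightarrow> nat) \<Rightarrow> complex) \<Rightarrow> (nat \<Rightarrow> nat) \<Rightarrow> complex" where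
  "conv n f h = (\<lambda>p. \<Sum>q\<in>carrier (sym_group n). f q * h (inv' q \<circ> p))"

text \<open>Row and column of the entry \<open>k\<close> in the tableau of shape \<open>lam\<close> filled with
  \<open>1, \<dots>, psize lam\<close> row by row.\<close>

definition tab_row :: "(nat \<Rightarrow> nat) \<Rightarrow> nat \<Rightarrow> nat" where
  "tab_row lam k = (LEAST i. k \<le> (\<Sum>j\<le>i. lam j))"

definition tab_col :: "(nat \<Rightarrow> nat) \<Rightarrow> nat \<Rightarrow> nat" where
  "tab_col lam k = k - (\<Sum>j<tab_row lam k. lam j)"

definition row_group :: "(nat \<Rightarrow> nat) \<Rightarrow> (nat \<Rightarrow> nat) set" where
  "row_group lam = {p \<in> carrier (sym_group (psize lam)).
     \<forall>k\<in>{1..psize lam}. tab_row lam (p k) = tab_row lam k}"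

definition col_group :: "(nat \<Rightarrow> nat) \<Rightarrow> (nat \<Rightarrow> nat) set" where
  "col_group lam = {p \<in> carrier (sym_group (psize lam)).
     \<forall>k\<in>{1..psize lam}. tab_col lam (p k) = tab_col lam k}"

definition young_symmetrizer :: "(nat \<Rightarrow> nat) \<Rightarrow> (nat \<Rightarrow> nat) \<Rightarrow> complex" where
  "young_symmetrizer lam = conv (psize lam)
     (\<lambda>p. if p \<in> row_group lam then 1 else 0)
     (\<lambda>p. if p \<in> col_group lam then of_int (sign p) else 0)"

text \<open>\<open>specht lam\<close> is the left ideal of the group algebra generated by the Young symmetrizer,
  with the group acting by left multiplication. In this convention \<open>(n)\<close> labels the trivial and
  \<open>(1, \<dots>, 1)\<close> the sign representation.\<close>

definition specht :: "(nat \<Rightarrow> nat) \<Rightarrow> ((nat \<Rightarrow> nat) \<Rightarrow> complex) set" where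
  "specht lam = (\<lambda>f. conv (psize lam) f (young_symmetrizer lam)) ` group_algebra (psize lam)"

definition left_mult ::
  "(nat \<Rightarrow> nat) \<Rightarrow> ((nat \<Rightarrow> nat) \<Rightarrow> complex) \<Rightarrow> (nat \<Rightarrow> nat) \<Rightarrow> complex" where
  "left_mult p f = (\<lambda>x. f (inv' p \<circ> x))"

lemma sym_group_inv_comp:
  assumes "p \<in> carrier (sym_group n)" "q \<in> carrier (sym_group n)"
  shows "inv' (p \<circ> q) = inv' q \<circ> inv' p"
  using assms by (intro o_inv_distrib) (auto simp: sym_group_carrier permutes_bij)

lemma left_mult_conv:
  assumes p: "p \<in> carrier (sym_group n)"
  shows "left_mult p (conv n f h) = conv n (left_mult p f) h"
proof
  fix x
  have P: "p permutes {1..n}" using p by (simp add: sym_group_carrier)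
  have "(\<Sum>q\<in>carrier (sym_group n). f q * h (inv' q \<circ> (inv' p \<circ> x))) =
        (\<Sum>q\<in>carrier (sym_group n). f (inv' p \<circ> q) * h (inv' q \<circ> x))"
  proof (rule sum.reindex_bij_witness[of _ "\<lambda>q. inv' p \<circ> q" "\<lambda>q. p \<circ> q"])
    fix q assume q: "q \<in> carrier (sym_group n)"
    show "inv' p \<circ> (p \<circ> q) = q" "p \<circ> (inv' p \<circ> q) = q"
      using permutes_inv_o[OF P] by (simp_all add: o_assoc[symmetric] flip: comp_assoc)
    show "p \<circ> q \<in> carrier (sym_group n)" "inv' p \<circ> q \<in> carrier (sym_group n)"
      using q P by (auto simp: sym_group_carrier intro: permutes_compose permutes_inv)
    show "f (inv' p \<circ> (p \<circ> q)) * h (inv' (p \<circ> q) \<circ> x) = f q * h (inv' q \<circ> (inv' p \<circ> x))"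
      using sym_group_inv_comp[OF p q] permutes_inv_o[OF P]
      by (simp add: comp_assoc flip: comp_assoc[of "inv' p" p q])
  qed
  then show "left_mult p (conv n f h) x = conv n (left_mult p f) h x"
    by (simp add: left_mult_def conv_def)
qed

lemma left_mult_group_algebra:
  assumes "p \<in> carrier (sym_group n)" "f \<in> group_algebra n"
  shows "left_mult p f \<in> group_algebra n"
proof -
  have P: "p permutes {1..n}" using assms by (simp add: sym_group_carrier)
  have "inv' p \<circ> x \<notin> carrier (sym_group n)" if "x \<notin> carrier (sym_group n)" for x
  proof
    assume "inv' p \<circ> x \<in> carrier (sym_group n)"
    then have "p \<circ> (inv' p \<circ> x) permutes {1..n}"
      using P by (auto simp: sym_group_carrier intro: permutes_compose)
    then show False using that permutes_inv_o[OF P]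
      by (simp add: sym_group_carrier flip: comp_assoc)
  qed
  then show ?thesis using assms(2) by (auto simp: group_algebra_def left_mult_def)
qed

theorem specht_representation:
  "representation (sym_group (psize lam)) (specht lam) left_mult"
proof -
  let ?n = "psize lam"
  let ?C = "\<lambda>f. conv ?n f (young_symmetrizer lam)"
  have add: "?C f + ?C g = ?C (f + g)" for f g
    by (simp add: conv_def fun_eq_iff algebra_simps sum.distrib)
  have sc: "cscale c (?C f) = ?C (cscale c f)" for c f
    by (simp add: conv_def cscale_def fun_eq_iff sum_distrib_left mult.assoc)
  have zero: "?C 0 = 0" by (simp add: conv_def fun_eq_iff)
  have "cfun.subspace (specht lam)"
    unfolding cfun.subspace_def
  proof (intro conjI ballI allI)
    show "0 \<in> specht lam"
      unfolding specht_def by (rule image_eqI[of _ _ 0]) (auto simp: zero group_algebra_def)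
    show "x + y \<in> specht lam" if x: "x \<in> specht lam" and y: "y \<in> specht lam" for x y
    proof -
      from x y obtain f g where "x = ?C f" "y = ?C g" "f \<in> group_algebra ?n" "g \<in> group_algebra ?n"
        by (auto simp: specht_def)
      then show ?thesis unfolding specht_def
        by (intro image_eqI[of _ _ "f + g"]) (auto simp: add group_algebra_def)
    qed
    show "cscale c x \<in> specht lam" if "x \<in> specht lam" for c x
    proof -
      from that obtain f where "x = ?C f" "f \<in> group_algebra ?n"
        by (auto simp: specht_def)
      then show ?thesis unfolding specht_def
        by (intro image_eqI[of _ _ "cscale c f"]) (simp_all only: sc, simp add: group_algebra_def cscale_def)
    qed
  qed
  moreover have "left_mult g v \<in> specht lam" if "g \<in> carrier (sym_group ?n)" "v \<in> specht lam" for g v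
    using that left_mult_group_algebra by (auto simp: specht_def left_mult_conv intro!: imageI)
  moreover have "left_mult (g \<circ> h) v = left_mult g (left_mult h v)"
    if "g \<in> carrier (sym_group ?n)" "h \<in> carrier (sym_group ?n)" for g h v
    using sym_group_inv_comp[OF that] by (simp add: left_mult_def comp_assoc)
  ultimately show ?thesis
    by (intro representation.intro representation_axioms.intro sym_group_is_group)
      (simp_all add: sym_group_mult sym_group_one, simp_all add: left_mult_def cscale_def fun_eq_iff)
qed


section \<open>Kronecker coefficients\<close>

text \<open>The tensor product of two spaces of functions, realised as a space of functions of two
  variables, with the diagonal action of the symmetric group.\<close>

definition tensor :: "('x \<Rightarrow> complex) \<Rightarrow> ('y \<Rightarrow> complex) \<Rightarrow> 'x \<times> 'y \<Rightarrow> complex" where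
  "tensor v w = (\<lambda>(x, y). v x * w y)"

definition tensor_space ::
  "('x \<Rightarrow> complex) set \<Rightarrow> ('y \<Rightarrow> complex) set \<Rightarrow> ('x \<times> 'y \<Rightarrow> complex) set" where
  "tensor_space V W = cfun.span {tensor v w | v w. v \<in> V \<and> w \<in> W}"

definition diag_mult ::
  "(nat \<Rightarrow> nat) \<Rightarrow> ((nat \<Rightarrow> nat) \<times> (nat \<Rightarrow> nat) \<Rightarrow> complex)
   \<Rightarrow> (nat \<Rightarrow> nat) \<times> (nat \<Rightarrow> nat) \<Rightarrow> complex" where
  "diag_mult p F = (\<lambda>(x, y). F (inv' p \<circ> x, inv' p \<circ> y))"

lemma diag_mult_tensor: "diag_mult p (tensor v w) = tensor (left_mult p v) (left_mult p w)"
  by (simp add: diag_mult_def tensor_def left_mult_def)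

theorem tensor_representation:
  assumes V: "representation (sym_group n) V left_mult" and W: "representation (sym_group n) W left_mult"
  shows "representation (sym_group n) (tensor_space V W) diag_mult"
proof -
  have add: "diag_mult p (F + F') = diag_mult p F + diag_mult p F'" for p F F'
    by (simp add: diag_mult_def fun_eq_iff)
  have sc: "diag_mult p (cscale c F) = cscale c (diag_mult p F)" for p c F
    by (simp add: diag_mult_def cscale_def fun_eq_iff)
  have zero: "diag_mult p 0 = 0" for p
    by (simp add: diag_mult_def fun_eq_iff)
  have "diag_mult p F \<in> tensor_space V W"
    if p: "p \<in> carrier (sym_group n)" and F: "F \<in> tensor_space V W" for p F
    using F unfolding tensor_space_def
  proof (induction rule: cfun.span_induct_alt)
    case base
    show ?case unfolding zero by (rule cfun.span_zero)
  next
    case (step c F F')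
    then obtain v w where "F = tensor v w" "v \<in> V" "w \<in> W" by blast
    then have "diag_mult p F \<in> cfun.span {tensor v w | v w. v \<in> V \<and> w \<in> W}"
      using representation.closed[OF V p] representation.closed[OF W p]
      by (intro cfun.span_base) (auto simp: diag_mult_tensor)
    with step show ?case unfolding add sc by (intro cfun.span_add cfun.span_scale)
  qed
  moreover have "diag_mult (g \<circ> h) F = diag_mult g (diag_mult h F)"
    if "g \<in> carrier (sym_group n)" "h \<in> carrier (sym_group n)" for g h F
    using sym_group_inv_comp[OF that] by (simp add: diag_mult_def comp_assoc)
  moreover have "diag_mult id F = F" for F
    by (simp add: diag_mult_def fun_eq_iff)
  moreover have "cfun.subspace (tensor_space V W)"
    by (simp add: tensor_space_def cfun.subspace_span)
  ultimately show ?thesis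
    by (intro representation.intro representation_axioms.intro sym_group_is_group)
      (simp_all add: sym_group_mult sym_group_one add sc)
qed

text \<open>\<open>kronecker \<mu> \<nu> lam\<close> is the multiplicity of the representation of \<open>lam\<close> in the tensor product
  of those of \<open>\<mu>\<close> and \<open>\<nu>\<close>; it is meant for partitions of the same size. In
  \<open>reduced_kronecker \<alpha> \<beta> \<gamma>\<close>, likewise, \<open>\<gamma>\<close> is the upper index.\<close>

definition kronecker :: "(nat \<Rightarrow> nat) \<Rightarrow> (nat \<Rightarrow> nat) \<Rightarrow> (nat \<Rightarrow> nat) \<Rightarrow> nat" where
  "kronecker \<mu> \<nu> lam =
     rep_multiplicity (sym_group (psize lam)) (specht lam) left_mult
       (tensor_space (specht \<mu>) (specht \<nu>)) diag_mult"

definition reduced_kronecker :: "(nat \<Rightarrow> nat) \<Rightarrow> (nat \<Rightarrow> nat) \<Rightarrow> (nat \<Rightarrow> nat) \<Rightarrow> nat" where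
  "reduced_kronecker \<alpha> \<beta> \<gamma> =
     (THE c. \<forall>\<^sub>F n in sequentially. kronecker (pad \<alpha> n) (pad \<beta> n) (pad \<gamma> n) = c)"

end

theory Submission
  imports Defs "HOL-Library.Nat_Bijection"
begin

text \<open>
  Write \<open>\<omega>(\<gamma>, n)\<close> for the Jacobi--Trudi determinant of the sequence \<open>(n - |\<gamma>|, \<gamma>\<^sub>1, \<gamma>\<^sub>2, \<dots>)\<close>,
  read as a virtual character of the symmetric group of degree \<open>n\<close> (\<open>stable_char\<close>). The first term
  of the sequence may be too small for a partition, or negative. If it is large enough,
  \<open>\<omega>(\<gamma>, n)\<close> is the irreducible character of \<open>\<gamma>[n]\<close>. In general the rows of the determinant can be
  sorted, so that \<open>\<omega>(\<gamma>, n)\<close> is zero or, up to sign, the character of a partition \<open>\<lambda>\<close> of \<open>n\<close>; moving the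
  first row to position \<open>i\<close> shows that \<open>\<omega>(\<gamma>, n)\<close> is \<open>\<plusminus>\<close> the character of \<open>\<lambda>\<close> exactly when \<open>\<gamma>\<close> is
  \<open>\<lambda>\<close> daggered at some \<open>i\<close>, with the sign \<open>(-1)\<close> to the power \<open>i + 1\<close> (\<open>stable_char_dagger\<close>,
  \<open>stable_char_straighten\<close>).

  The theorem follows because \<open>\<omega>(\<alpha>, n) \<omega>(\<beta>, n)\<close> is a combination of the \<open>\<omega>(\<gamma>, n)\<close> whose
  coefficients are the same for all \<open>n\<close> (\<open>stable_char_mult_in_span\<close>). Expanding the determinants
  reduces this to permutation characters that count families of disjoint invariant sets of
  given sizes. A product of two such counts is a sum over the common refinements of two families,
  and the tables of sizes of the intersections do not involve \<open>n\<close>. Taking \<open>n\<close> large identifies the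
  coefficients as the reduced Kronecker coefficients (\<open>reduced_kronecker_coefficient\<close>).
  Pairing with the character of \<open>\<lambda>\<close> at the given \<open>n\<close> then yields the alternating sum. It ends at
  \<open>\<ell>(\<mu>) \<ell>(\<nu>)\<close>, because a constituent of a product of two characters has at most as many rows
  as the product of the numbers of rows of the factors (\<open>ip_schur_product_length\<close>).

  The link to representations is \<open>kronecker_ip\<close>. By Maschke's theorem the tensor product splits into
  irreducible subspaces, and the idempotent multiple of the Young symmetrizer acts on an irreducible
  subspace as an operator of rank one or as zero, according to whether the subspace is the Specht module
  or not. Hence the multiplicity is the trace of that idempotent (\<open>rep_multiplicity_trace\<close>). The same
  idempotent gives the character \<open>\<chi>\<close> of the Specht module as a sum over conjugates. To see that
  \<open>\<chi>\<close> equals the Jacobi--Trudi determinant \<open>\<omega>\<close> (\<open>ychar_eq_schur\<close>), three inner products are computed: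
  \<open>\<langle>\<chi>, \<chi>\<rangle>\<close>, \<open>\<langle>\<chi>, \<omega>\<rangle>\<close> and \<open>\<langle>\<omega>, \<omega>\<rangle>\<close> are all 1, so the real function \<open>\<chi> - \<omega>\<close> has norm zero.
  The last two use that \<open>\<omega>\<close> is the permutation character of content \<open>\<lambda>\<close> plus signed permutation characters
  whose contents have a larger sum of squares than \<open>\<lambda>\<close>, while \<open>\<chi>\<close> and \<open>\<omega>\<close> are orthogonal to all of the
  latter; for \<open>\<omega>\<close> this is a consequence of the Pieri rule (\<open>pieri_rule\<close>), for \<open>\<chi>\<close> of a sign cancellation in the
  columns of the tableau (\<open>col_sum_eq_0\<close>).
\<close>

text \<open>Throughout, \<open>1 :: nat\<close> is kept as it stands, so that the interval \<open>{1..n}\<close> of the symmetric group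
  keeps one form.\<close>

declare One_nat_def [simp del]

section \<open>Truncated sums and rearrangements\<close>

text \<open>The truncations of a number determine its square, which links dominance to sums of squares.\<close>

lemma sum_trunc_eq:
  fixes a :: int
  assumes "0 \<le> a" "a \<le> int J"
  shows "2 * (\<Sum>j = 1..J. min a (int j)) = (2 * int J + 1) * a - a\<^sup>2"
proof -
  define b where "b = nat a"
  have b: "a = int b" "b \<le> J" using assms by (auto simp: b_def)
  have "2 * (\<Sum>j = 1..J. min (int b) (int j)) = (2 * int J + 1) * int b - (int b)\<^sup>2"
    using b(2)
  proof (induction J rule: dec_induct)
    case base
    have "2 * (\<Sum>j = 1..m. min (int b) (int j)) = (2 * int m + 1) * int m - (int m)\<^sup>2"
      if "m \<le> b" for m
      using that
    proof (induction m)
      case (Suc m)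
      then show ?case by (simp add: algebra_simps power2_eq_square)
    qed simp
    then show ?case by simp
  next
    case (step m)
    then show ?case by (simp add: algebra_simps)
  qed
  then show ?thesis by (simp add: b)
qed

text \<open>The dominance order is used in the following form: \<open>a\<close> is at least as dominant as \<open>b\<close> if, for each \<open>j\<close>, the first
  \<open>j\<close> columns of the diagram of \<open>a\<close> hold no more boxes than those of \<open>b\<close>. In this form \<open>b\<close> may be an
  unordered composition. Summing over \<open>j\<close> compares the sums of squares.\<close>

lemma sum_squares_antimono_dominance:
  fixes a b :: "nat \<Rightarrow> int"
  assumes a: "\<And>i. i < k \<Longrightarrow> 0 \<le> a i" and b: "\<And>i. i < l \<Longrightarrow> 0 \<le> b i"
    and total: "(\<Sum>i<k. a i) = (\<Sum>i<l. b i)"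
    and le: "\<And>j. (\<Sum>i<k. min (a i) (int j)) \<le> (\<Sum>i<l. min (b i) (int j))"
  shows "(\<Sum>i<l. (b i)\<^sup>2) \<le> (\<Sum>i<k. (a i)\<^sup>2)"
proof -
  \<comment> \<open>no entry exceeds \<open>J\<close>, so truncation at \<open>j = 1, \<dots>, J\<close> sees every entry completely\<close>
  define J where "J = nat (\<Sum>i<k. a i)"
  have "2 * (\<Sum>j = 1..J. \<Sum>i<m. min (c i) (int j)) = (2 * int J + 1) * (\<Sum>i<m. c i) - (\<Sum>i<m. (c i)\<^sup>2)"
    if c: "\<And>i. i < m \<Longrightarrow> 0 \<le> c i" "(\<Sum>i<m. c i) = (\<Sum>i<k. a i)" for m and c :: "nat \<Rightarrow> int"
  proof -
    have "c i \<le> int J" if "i < m" for i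
      using member_le_sum[of i "{..<m}" c] c that by (simp add: J_def)
    then have "2 * (\<Sum>j = 1..J. min (c i) (int j)) = (2 * int J + 1) * c i - (c i)\<^sup>2" if "i < m" for i
      using that c by (intro sum_trunc_eq) auto
    then have "(\<Sum>i<m. 2 * (\<Sum>j = 1..J. min (c i) (int j))) = (\<Sum>i<m. (2 * int J + 1) * c i - (c i)\<^sup>2)"
      by (intro sum.cong) auto
    then show ?thesis
      by (subst sum.swap) (simp add: sum_distrib_left sum_subtractf)
  qed
  from this[of k a] this[of l b] a b total
  have "2 * (\<Sum>j = 1..J. \<Sum>i<k. min (a i) (int j)) + (\<Sum>i<k. (a i)\<^sup>2) =
    2 * (\<Sum>j = 1..J. \<Sum>i<l. min (b i) (int j)) + (\<Sum>i<l. (b i)\<^sup>2)" by simp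
  moreover have "(\<Sum>j = 1..J. \<Sum>i<k. min (a i) (int j)) \<le> (\<Sum>j = 1..J. \<Sum>i<l. min (b i) (int j))"
    by (intro sum_mono le)
  ultimately show ?thesis by linarith
qed

text \<open>Two consecutive truncated sums differ by the length of a column, so they determine the diagram.\<close>

lemma decreasing_eqI_trunc_sums:
  fixes a b :: "nat \<Rightarrow> int"
  assumes a: "\<And>i j. i \<le> j \<Longrightarrow> j < k \<Longrightarrow> a j \<le> a i" "\<And>i. i < k \<Longrightarrow> 0 \<le> a i"
    and b: "\<And>i j. i \<le> j \<Longrightarrow> j < k \<Longrightarrow> b j \<le> b i" "\<And>i. i < k \<Longrightarrow> 0 \<le> b i"
    and eq: "\<And>j. (\<Sum>i<k. min (a i) (int j)) = (\<Sum>i<k. min (b i) (int j))"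
    and i: "i < k"
  shows "a i = b i"
proof -
  have diff: "(\<Sum>i<k. min (c i) (int (Suc j))) - (\<Sum>i<k. min (c i) (int j)) = int (card {i. i < k \<and> int j < c i})"
    for c :: "nat \<Rightarrow> int" and j
  proof -
    have "(\<Sum>i<k. min (c i) (int (Suc j))) - (\<Sum>i<k. min (c i) (int j)) = (\<Sum>i<k. if int j < c i then 1 else 0)"
      by (auto simp flip: sum_subtractf intro!: sum.cong)
    also have "\<dots> = int (card {i. i < k \<and> int j < c i})"
      by (simp add: sum.If_cases lessThan_def Collect_conj_eq)
    finally show ?thesis .
  qed
  have ini: "i < card {i. i < k \<and> int j < c i} \<longleftrightarrow> int j < c i"
    if c: "\<And>i j. i \<le> j \<Longrightarrow> j < k \<Longrightarrow> c j \<le> c i" for c :: "nat \<Rightarrow> int" and j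
  proof
    assume "int j < c i"
    then have "int j < c i'" if "i' \<le> i" for i' using c[OF that i] by simp
    with i have "{..i} \<subseteq> {i. i < k \<and> int j < c i}" by auto
    from card_mono[OF _ this] show "i < card {i. i < k \<and> int j < c i}" by simp
  next
    assume l: "i < card {i. i < k \<and> int j < c i}"
    show "int j < c i"
    proof (rule ccontr)
      assume "\<not> int j < c i"
      then have "i' < i" if "i' < k" "int j < c i'" for i'
        using c[of i i'] that by (cases "i \<le> i'") auto
      then have "{i. i < k \<and> int j < c i} \<subseteq> {..<i}" by auto
      from card_mono[OF _ this] l show False by simp
    qed
  qed
  have "card {i. i < k \<and> int j < a i} = card {i. i < k \<and> int j < b i}" for j
    using diff[of a j] diff[of b j] eq[of j] eq[of "Suc j"] by linarith
  then have "int j < a i \<longleftrightarrow> int j < b i" for j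
    using ini[of a j, OF a(1)] ini[of b j, OF b(1)] by simp
  moreover have "0 \<le> a i" "0 \<le> b i" using a b i by auto
  ultimately show ?thesis
    using \<open>int (nat (a i)) < a i \<longleftrightarrow> int (nat (a i)) < b i\<close> \<open>int (nat (b i)) < a i \<longleftrightarrow> int (nat (b i)) < b i\<close>
    by simp
qed

text \<open>Every permutation other than the identity strictly increases the sum of squares. The mixed term is
  nonnegative because the partial sums \<open>P\<close> of a decreasing sequence are concave: \<open>a i\<close> is a supergradient
  of \<open>P\<close> at \<open>i\<close>, and the increments \<open>P (w i) - P i\<close> add up to zero. Strictness comes from the squares
  of \<open>w i - i\<close>.\<close>

lemma permuted_staircase_squares:
  fixes a :: "nat \<Rightarrow> int"
  assumes a: "antimono a" and w: "w permutes {..<k}" and "w \<noteq> id"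
  shows "(\<Sum>i<k. (a i)\<^sup>2) < (\<Sum>i<k. (a i + int (w i) - int i)\<^sup>2)"
proof -
  define P where "P m = (\<Sum>j<m. a j)" for m :: nat
  have up: "P (i + d) - P i \<le> a i * int d" for i d
  proof (induction d)
    case (Suc d)
    have "a (i + d) \<le> a i" using a by (simp add: antimono_def)
    with Suc show ?case by (simp add: P_def algebra_simps)
  qed simp
  have down: "P (i + d) - P i \<ge> a (i + d) * int d" for i d
  proof (induction d)
    case (Suc d)
    have "a (i + Suc d) \<le> a (i + d)" using a by (simp add: antimono_def)
    moreover from this have "a (i + Suc d) * int d \<le> a (i + d) * int d" by (intro mult_right_mono) auto
    moreover have "P (i + Suc d) = P (i + d) + a (i + d)" by (simp add: P_def)
    moreover have "a (i + Suc d) * int (Suc d) = a (i + Suc d) * int d + a (i + Suc d)"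
      by (simp add: algebra_simps)
    ultimately show ?case using Suc by linarith
  qed simp
  have concave: "P m - P i \<le> a i * (int m - int i)" for i m
  proof (cases "i \<le> m")
    case True
    then show ?thesis using up[of i "m - i"] by (simp add: of_nat_diff)
  next
    case False
    then show ?thesis using down[of m "i - m"] by (simp add: of_nat_diff algebra_simps)
  qed
  have "0 = (\<Sum>i<k. P (w i)) - (\<Sum>i<k. P i)"
    using sum.permute[OF w, of P] by (simp add: comp_def)
  also have "\<dots> \<le> (\<Sum>i<k. a i * (int (w i) - int i))"
    unfolding sum_subtractf[symmetric] by (intro sum_mono concave)
  finally have *: "0 \<le> (\<Sum>i<k. a i * (int (w i) - int i))" .
  from \<open>w \<noteq> id\<close> obtain i0 where i0: "w i0 \<noteq> i0" by (auto simp: fun_eq_iff)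
  with w have "i0 < k" by (auto simp: permutes_def)
  with i0 have "0 < (\<Sum>i<k. (int (w i) - int i)\<^sup>2)"
    by (intro sum_pos2[of _ i0]) auto
  moreover have "(\<Sum>i<k. (a i + int (w i) - int i)\<^sup>2) =
      (\<Sum>i<k. (a i)\<^sup>2) + 2 * (\<Sum>i<k. a i * (int (w i) - int i)) + (\<Sum>i<k. (int (w i) - int i)\<^sup>2)"
    by (simp add: sum_distrib_left power2_eq_square algebra_simps flip: sum.distrib)
  ultimately show ?thesis using * by linarith
qed

section \<open>Permutation characters as numbers of invariant colorings\<close>

abbreviation perms :: "nat \<Rightarrow> (nat \<Rightarrow> nat) set" where
  "perms n \<equiv> {p. p permutes {1..n}}"

text \<open>Colors are of any type and their multiplicities are integers, so that a negative entry in a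
  determinant simply admits no coloring. Functions are restricted to \<open>{1..n}\<close> to make them finite in number.\<close>

definition colorings :: "nat \<Rightarrow> ('c \<Rightarrow> int) \<Rightarrow> (nat \<Rightarrow> 'c) set" where
  "colorings n u = {f \<in> extensional {1..n}. \<forall>c. int (card {k \<in> {1..n}. f k = c}) = u c}"

text \<open>The character of the permutation representation on the colorings with content \<open>u\<close>.\<close>

definition perm_char :: "nat \<Rightarrow> ('c \<Rightarrow> int) \<Rightarrow> (nat \<Rightarrow> nat) \<Rightarrow> complex" where
  "perm_char n u p = of_nat (card {f \<in> colorings n u. f \<circ> p = f})"

text \<open>The inner product of class functions, taken bilinear because the characters of the symmetric
  group are real.\<close>

definition ip :: "nat \<Rightarrow> ((nat \<Rightarrow> nat) \<Rightarrow> complex) \<Rightarrow> ((nat \<Rightarrow> nat) \<Rightarrow> complex) \<Rightarrow> complex" where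
  "ip n \<phi> \<psi> = (\<Sum>p\<in>perms n. \<phi> p * \<psi> p) / fact n"

lemma finite_perms [simp]: "finite (perms n)"
  by (simp add: finite_permutations)

lemma card_perms: "card (perms n) = fact n"
  by (rule card_permutations) auto

lemma coloring_color_nonzero:
  assumes "f \<in> colorings n u" "k \<in> {1..n}"
  shows "u (f k) \<noteq> 0"
proof -
  have "card {k' \<in> {1..n}. f k' = f k} \<noteq> 0" using assms(2) by auto
  moreover have "int (card {k' \<in> {1..n}. f k' = f k}) = u (f k)" using assms by (simp add: colorings_def)
  ultimately show ?thesis by linarith
qed

lemma finite_colorings [simp]: "finite (colorings n u)"
proof (cases "colorings n u = {}")
  case False
  then obtain g where g: "g \<in> colorings n u" by blast
  have "{c. u c \<noteq> 0} \<subseteq> g ` {1..n}"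
  proof
    fix c assume "c \<in> {c. u c \<noteq> 0}"
    then have c: "u c \<noteq> 0" by simp
    have eq: "int (card {k \<in> {1..n}. g k = c}) = u c" using g by (simp add: colorings_def)
    have "{k \<in> {1..n}. g k = c} \<noteq> {}"
    proof
      assume "{k \<in> {1..n}. g k = c} = {}"
      with eq have "int (card ({} :: nat set)) = u c" by (simp only:)
      with c show False by simp
    qed
    then show "c \<in> g ` {1..n}" by (simp only: image_def) blast
  qed
  then have "finite {c. u c \<noteq> 0}" by (rule finite_subset) simp
  moreover have "colorings n u \<subseteq> {1..n} \<rightarrow>\<^sub>E {c. u c \<noteq> 0}"
  proof
    fix f assume f: "f \<in> colorings n u"
    then have "f \<in> extensional {1..n}" by (simp add: colorings_def)
    moreover have "f \<in> {1..n} \<rightarrow> {c. u c \<noteq> 0}" using coloring_color_nonzero[OF f] by blast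
    ultimately show "f \<in> {1..n} \<rightarrow>\<^sub>E {c. u c \<noteq> 0}" by (simp add: PiE_def)
  qed
  ultimately show ?thesis by (meson finite_PiE finite_atLeastAtMost finite_subset)
qed simp

lemma colorings_permute:
  assumes f: "f \<in> colorings n u" and p: "p permutes {1..n}"
  shows "f \<circ> p \<in> colorings n u"
proof -
  have "card {k \<in> {1..n}. f (p k) = c} = card {k \<in> {1..n}. f k = c}" for c
  proof (rule bij_betw_same_card[of p])
    have "inj_on p {k \<in> {1..n}. f (p k) = c}" using p by (meson inj_on_subset permutes_inj subset_UNIV)
    moreover have "p ` {k \<in> {1..n}. f (p k) = c} = {k \<in> {1..n}. f k = c}"
    proof (intro equalityI subsetI)
      fix x assume x: "x \<in> {k \<in> {1..n}. f k = c}"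
      then have "inv' p x \<in> {k \<in> {1..n}. f (p k) = c}"
        using p permutes_in_image[OF permutes_inv[OF p], of x] by (auto simp: permutes_inverses[OF p])
      then show "x \<in> p ` {k \<in> {1..n}. f (p k) = c}"
        using permutes_inverses(1)[OF p, of x] by force
    qed (use p permutes_in_image[OF p] in auto)
    ultimately show "bij_betw p {k \<in> {1..n}. f (p k) = c} {k \<in> {1..n}. f k = c}"
      by (simp add: bij_betw_def)
  qed
  then show ?thesis
    using f p by (auto simp: colorings_def extensional_def permutes_def)
qed

text \<open>List the elements of the multiset in which color \<open>c\<close> occurs \<open>u c\<close> times.\<close>

lemma exists_coloring:
  assumes S: "finite S" "\<And>c. c \<notin> S \<Longrightarrow> u c = 0" and "\<And>c. 0 \<le> u c" and "sum u S = int n"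
  obtains f where "f \<in> colorings n u"
proof -
  define M where "M = (\<Sum>c\<in>S. replicate_mset (nat (u c)) c)"
  have count: "count M c = nat (u c)" for c
    using S by (cases "c \<in> S") (simp_all add: M_def count_sum)
  have "int (size M) = sum u S"
    using assms(3) by (simp add: M_def size_multiset_sum)
  with assms have size: "size M = n" by simp
  obtain xs where xs: "mset xs = M" using ex_mset by blast
  with size have len: "length xs = n" by auto
  define f where "f = restrict (\<lambda>k. xs ! (k - 1)) {1..n}"
  have "card {k \<in> {1..n}. f k = c} = count M c" for c
  proof -
    have "card {k \<in> {1..n}. f k = c} = card {i. i < n \<and> xs ! i = c}"
      by (rule bij_betw_same_card[of "\<lambda>k. k - 1"], rule bij_betw_byWitness[of _ Suc]) (auto simp: f_def)
    also have "\<dots> = count M c"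
      by (simp add: xs[symmetric] count_mset count_list_eq_length_filter length_filter_conv_card len eq_commute)
    finally show ?thesis .
  qed
  then have "f \<in> colorings n u"
    using count assms(3) by (simp add: colorings_def f_def)
  then show thesis by (rule that)
qed

lemma colorings_conjugate:
  assumes f: "f \<in> colorings n u" and g: "g \<in> colorings n u"
  obtains p where "p permutes {1..n}" "f = g \<circ> p"
proof -
  have *: "count (image_mset h (mset_set {1..n})) c = card {k \<in> {1..n}. h k = c}" for h :: "nat \<Rightarrow> 'a" and c
  proof -
    have "count (image_mset h (mset_set {1..n})) c = (\<Sum>k\<in>h -` {c} \<inter> {1..n}. 1)"
      unfolding count_image_mset by (intro sum.cong) auto
    also have "h -` {c} \<inter> {1..n} = {k \<in> {1..n}. h k = c}" by auto
    finally show ?thesis by simp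
  qed
  then have "image_mset f (mset_set {1..n}) = image_mset g (mset_set {1..n})"
  proof (intro multiset_eqI)
    fix c
    have "int (card {k \<in> {1..n}. f k = c}) = u c" "int (card {k \<in> {1..n}. g k = c}) = u c"
      using f g by (simp_all add: colorings_def)
    then have "card {k \<in> {1..n}. f k = c} = card {k \<in> {1..n}. g k = c}" by linarith
    then show "count (image_mset f (mset_set {1..n})) c = count (image_mset g (mset_set {1..n})) c"
      unfolding * .
  qed
  then obtain p where p: "p permutes {1..n}" "\<forall>x\<in>{1..n}. f x = g (p x)"
    by (rule image_mset_eq_implies_permutes[rotated]) auto
  have "f = g \<circ> p"
  proof
    fix x show "f x = (g \<circ> p) x"
      using p f g by (cases "x \<in> {1..n}") (auto simp: colorings_def extensional_def permutes_def)
  qed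
  with p show thesis using that by blast
qed

text \<open>The group acts transitively on the colorings of a given content. All their stabilizers therefore have the size of the set
  of permutations that carry a fixed coloring \<open>g\<close> to \<open>f\<close>, and these sets partition the group as \<open>f\<close> varies.\<close>

lemma sum_perm_char:
  assumes S: "finite S" "\<And>c. c \<notin> S \<Longrightarrow> u c = 0" and pos: "\<And>c. 0 \<le> u c" and "sum u S = int n"
  shows "(\<Sum>p\<in>perms n. perm_char n u p) = fact n"
proof -
  obtain g where g: "g \<in> colorings n u" using exists_coloring assms by blast
  have fiber: "card {p \<in> perms n. f \<circ> p = f} = card {p \<in> perms n. g \<circ> p = f}" if f: "f \<in> colorings n u" for f
  proof -
    obtain x where x: "x permutes {1..n}" "f = g \<circ> x" by (rule colorings_conjugate[OF f g])
    have gx: "g \<circ> x \<circ> (inv' x \<circ> p) = g \<circ> p" for p :: "nat \<Rightarrow> nat"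
    proof -
      have "g \<circ> x \<circ> (inv' x \<circ> p) = g \<circ> (x \<circ> inv' x) \<circ> p" by (simp only: comp_assoc)
      then show ?thesis by (simp add: permutes_inv_o[OF x(1)])
    qed
    have "bij_betw (\<lambda>p. x \<circ> p) {p \<in> perms n. f \<circ> p = f} {p \<in> perms n. g \<circ> p = f}"
    proof (intro bij_betw_byWitness[of _ "\<lambda>p. inv' x \<circ> p"] ballI subsetI)
      fix p assume "p \<in> (\<lambda>p. x \<circ> p) ` {p \<in> perms n. f \<circ> p = f}"
      then show "p \<in> {p \<in> perms n. g \<circ> p = f}"
        using x by (auto intro: permutes_compose simp flip: comp_assoc)
    next
      fix p assume "p \<in> (\<lambda>p. inv' x \<circ> p) ` {p \<in> perms n. g \<circ> p = f}"
      then show "p \<in> {p \<in> perms n. f \<circ> p = f}"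
        using x gx by (auto intro: permutes_compose permutes_inv)
    next
      fix p show "inv' x \<circ> (x \<circ> p) = p" "x \<circ> (inv' x \<circ> p) = p"
        by (simp_all add: permutes_inv_o[OF x(1)] flip: comp_assoc)
    qed
    then show ?thesis by (rule bij_betw_same_card)
  qed
  have card_sum: "of_nat (card {a \<in> A. P a}) = (\<Sum>a\<in>A. if P a then 1 else 0 :: complex)"
    if "finite A" for A :: "'b set" and P
    using that by (simp add: sum.If_cases Int_def)
  have "(\<Sum>p\<in>perms n. perm_char n u p) = (\<Sum>f\<in>colorings n u. of_nat (card {p \<in> perms n. f \<circ> p = f}))"
    unfolding perm_char_def card_sum[OF finite_colorings] card_sum[OF finite_perms] by (rule sum.swap)
  also have "\<dots> = (\<Sum>f\<in>colorings n u. of_nat (card {p \<in> perms n. g \<circ> p = f}))"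
    by (intro sum.cong refl) (simp only: fiber)
  also have "\<dots> = (\<Sum>p\<in>perms n. \<Sum>f\<in>colorings n u. if g \<circ> p = f then 1 else 0)"
    unfolding card_sum[OF finite_perms] by (rule sum.swap)
  also have "\<dots> = (\<Sum>p\<in>perms n. 1)"
    using colorings_permute[OF g] by (intro sum.cong refl) (simp add: sum.delta)
  finally show ?thesis by (simp add: card_perms)
qed

lemma perm_char_neg:
  assumes "u c < 0"
  shows "perm_char n u p = 0"
proof -
  have "f \<notin> colorings n u" for f
  proof
    assume "f \<in> colorings n u"
    then have "int (card {k \<in> {1..n}. f k = c}) = u c" by (simp add: colorings_def)
    with assms show False by linarith
  qed
  then have "colorings n u = {}" by blast
  then show ?thesis by (simp add: perm_char_def)
qed

lemma perm_char_reindex: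
  assumes \<pi>: "bij \<pi>" and p: "p permutes {1..n}"
  shows "perm_char n (\<lambda>c. u (\<pi> c)) p = perm_char n u p"
proof -
  have rinv: "restrict (inv' \<pi> \<circ> f) {1..n} \<in> {f \<in> colorings n (\<lambda>c. u (\<pi> c)). f \<circ> p = f}"
    if "f \<in> {f \<in> colorings n u. f \<circ> p = f}" for f
  proof -
    have "inv' \<pi> (f k) = c \<longleftrightarrow> f k = \<pi> c" for k c using \<pi> by (metis bij_inv_eq_iff)
    then show ?thesis using that permutes_in_image[OF p]
      by (auto simp: colorings_def fun_eq_iff cong: conj_cong)
  qed
  have r: "restrict (\<pi> \<circ> f) {1..n} \<in> {f \<in> colorings n u. f \<circ> p = f}"
    if "f \<in> {f \<in> colorings n (\<lambda>c. u (\<pi> c)). f \<circ> p = f}" for f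
  proof -
    have e: "\<pi> (f k) = c \<longleftrightarrow> f k = inv' \<pi> c" for k c using \<pi> by (metis bij_inv_eq_iff)
    have "\<pi> (inv' \<pi> c) = c" for c using \<pi> by (simp add: bij_is_surj surj_f_inv_f)
    then show ?thesis using that permutes_in_image[OF p]
      by (auto simp: colorings_def fun_eq_iff e cong: conj_cong)
  qed
  have "bij_betw (\<lambda>f. restrict (\<pi> \<circ> f) {1..n}) {f \<in> colorings n (\<lambda>c. u (\<pi> c)). f \<circ> p = f}
      {f \<in> colorings n u. f \<circ> p = f}"
  proof (rule bij_betw_byWitness[of _ "\<lambda>f. restrict (inv' \<pi> \<circ> f) {1..n}"])
    show "\<forall>f\<in>{f \<in> colorings n (\<lambda>c. u (\<pi> c)). f \<circ> p = f}. restrict (inv' \<pi> \<circ> restrict (\<pi> \<circ> f) {1..n}) {1..n} = f"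
      using \<pi> by (auto simp: colorings_def fun_eq_iff extensional_def bij_is_inj)
    show "\<forall>f\<in>{f \<in> colorings n u. f \<circ> p = f}. restrict (\<pi> \<circ> restrict (inv' \<pi> \<circ> f) {1..n}) {1..n} = f"
      using \<pi> by (auto simp: colorings_def fun_eq_iff extensional_def bij_is_surj surj_f_inv_f)
  qed (use r rinv in blast)+
  then show ?thesis unfolding perm_char_def by (simp add: bij_betw_same_card)
qed

text \<open>If \<open>p\<close> fixes \<open>f\<close>, then its conjugate by \<open>x\<close> fixes \<open>f \<circ> x\<close>.\<close>

lemma perm_char_conj:
  assumes p: "p permutes {1..n}" and x: "x permutes {1..n}"
  shows "perm_char n u (inv' x \<circ> p \<circ> x) = perm_char n u p"
proof -
  note x' = permutes_inv_o[OF x] 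
  have "bij_betw (\<lambda>f. f \<circ> x) {f \<in> colorings n u. f \<circ> p = f} {f \<in> colorings n u. f \<circ> (inv' x \<circ> p \<circ> x) = f}"
  proof (rule bij_betw_byWitness[of _ "\<lambda>f. f \<circ> inv' x"])
    show "(\<lambda>f. f \<circ> x) ` {f \<in> colorings n u. f \<circ> p = f} \<subseteq> {f \<in> colorings n u. f \<circ> (inv' x \<circ> p \<circ> x) = f}"
    proof safe
      fix f :: "nat \<Rightarrow> 'a" assume f: "f \<in> colorings n u" "f \<circ> p = f"
      show "f \<circ> x \<in> colorings n u" using f x by (simp add: colorings_permute)
      have "f \<circ> x \<circ> (inv' x \<circ> p \<circ> x) = f \<circ> (x \<circ> inv' x) \<circ> p \<circ> x" by (simp add: comp_assoc)
      also have "\<dots> = f \<circ> x" using f x' by simp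
      finally show "f \<circ> x \<circ> (inv' x \<circ> p \<circ> x) = f \<circ> x" .
    qed
    show "(\<lambda>f. f \<circ> inv' x) ` {f \<in> colorings n u. f \<circ> (inv' x \<circ> p \<circ> x) = f} \<subseteq> {f \<in> colorings n u. f \<circ> p = f}"
    proof safe
      fix f :: "nat \<Rightarrow> 'a" assume f: "f \<in> colorings n u" "f \<circ> (inv' x \<circ> p \<circ> x) = f"
      show "f \<circ> inv' x \<in> colorings n u" using f x by (simp add: colorings_permute permutes_inv)
      have "f \<circ> inv' x \<circ> p = f \<circ> (inv' x \<circ> p \<circ> x) \<circ> inv' x"
        using x' by (simp add: comp_assoc)
      then show "f \<circ> inv' x \<circ> p = f \<circ> inv' x" using f by simp
    qed
  qed (auto simp: comp_assoc x')
  then show ?thesis by (simp add: perm_char_def bij_betw_same_card)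
qed

definition mats :: "nat \<Rightarrow> nat \<Rightarrow> (nat \<Rightarrow> int) \<Rightarrow> (nat \<Rightarrow> int) \<Rightarrow> (nat \<times> nat \<Rightarrow> int) set" where
  "mats k l u v = {w. (\<forall>x. 0 \<le> w x) \<and> (\<forall>x. x \<notin> {..<k} \<times> {..<l} \<longrightarrow> w x = 0) \<and>
     (\<forall>a<k. (\<Sum>b<l. w (a, b)) = u a) \<and> (\<forall>b<l. (\<Sum>a<k. w (a, b)) = v b)}"

lemma finite_mats [simp]: "finite (mats k l u v)"
proof (rule finite_subset)
  show "mats k l u v \<subseteq> {w. \<forall>x. (x \<in> {..<k} \<times> {..<l} \<longrightarrow> w x \<in> {0..(\<Sum>a<k. u a)}) \<and>
      (x \<notin> {..<k} \<times> {..<l} \<longrightarrow> w x = 0)}"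
  proof (intro subsetI CollectI allI conjI impI)
    fix w x assume w: "w \<in> mats k l u v" and x: "x \<in> {..<k} \<times> {..<l}"
    obtain a b where ab: "x = (a, b)" "a < k" "b < l" using x by auto
    have pos: "0 \<le> w y" for y using w unfolding mats_def by blast
    have row: "(\<Sum>b<l. w (a, b)) = u a" if "a < k" for a using w that by (simp add: mats_def)
    have "w (a, b) \<le> (\<Sum>b<l. w (a, b))" using ab pos by (intro member_le_sum) auto
    also have "\<dots> = u a" using row ab by simp
    also have "\<dots> \<le> (\<Sum>a<k. u a)"
    proof (rule member_le_sum)
      fix a' assume "a' \<in> {..<k} - {a}"
      then have "u a' = (\<Sum>b<l. w (a', b))" using row by simp
      then show "0 \<le> u a'" using pos by (simp add: sum_nonneg)
    qed (use ab in auto)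
    finally show "w x \<in> {0..(\<Sum>a<k. u a)}" using pos ab by simp
  qed (auto simp: mats_def)
qed (intro finite_set_of_finite_funs finite_cartesian_product finite_lessThan finite_atLeastAtMost_int)

lemma card_fst_color:
  assumes "\<And>i. i \<in> A \<Longrightarrow> snd (h i) < (l :: nat)" "finite A"
  shows "card {i \<in> A. fst (h i) = a} = (\<Sum>b<l. card {i \<in> A. h i = (a, b)})"
proof -
  have "{i \<in> A. fst (h i) = a} = (\<Union>b<l. {i \<in> A. h i = (a, b)})"
    using assms(1) by (auto simp: prod_eq_iff)
  then show ?thesis using assms(2) by (simp only:) (rule card_UN_disjoint; auto)
qed

lemma card_snd_color:
  assumes "\<And>i. i \<in> A \<Longrightarrow> fst (h i) < (k :: nat)" "finite A"
  shows "card {i \<in> A. snd (h i) = b} = (\<Sum>a<k. card {i \<in> A. h i = (a, b)})"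
proof -
  have "{i \<in> A. snd (h i) = b} = (\<Union>a<k. {i \<in> A. h i = (a, b)})"
    using assms(1) by (auto simp: prod_eq_iff)
  then show ?thesis using assms(2) by (simp only:) (rule card_UN_disjoint; auto)
qed

lemma coloring_content: "f \<in> colorings n u \<Longrightarrow> int (card {i \<in> {1..n}. f i = c}) = u c"
  by (simp add: colorings_def)

lemma pair_coloring_in_mats:
  assumes f: "f \<in> colorings n u" and g: "g \<in> colorings n v"
    and u: "\<And>a. k \<le> a \<Longrightarrow> u a = 0" and v: "\<And>b. l \<le> b \<Longrightarrow> v b = 0"
  shows "(\<lambda>c. int (card {i \<in> {1..n}. (f i, g i) = c})) \<in> mats k l u v"
proof -
  have fk: "f i < k" and gl: "g i < l" if "i \<in> {1..n}" for i
    using coloring_color_nonzero[OF f that] coloring_color_nonzero[OF g that] u v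
    by (meson not_less)+
  have "card {i \<in> {1..n}. f i = a} = (\<Sum>b<l. card {i \<in> {1..n}. (f i, g i) = (a, b)})" for a
    using card_fst_color[of "{1..n}" "\<lambda>i. (f i, g i)" l a] gl by simp
  then have row: "(\<Sum>b<l. int (card {i \<in> {1..n}. (f i, g i) = (a, b)})) = u a" for a
    using coloring_content[OF f, of a] by (simp only: of_nat_sum)
  have "card {i \<in> {1..n}. g i = b} = (\<Sum>a<k. card {i \<in> {1..n}. (f i, g i) = (a, b)})" for b
    using card_snd_color[of "{1..n}" "\<lambda>i. (f i, g i)" k b] fk by simp
  then have col: "(\<Sum>a<k. int (card {i \<in> {1..n}. (f i, g i) = (a, b)})) = v b" for b
    using coloring_content[OF g, of b] by (simp only: of_nat_sum)
  have zero: "int (card {i \<in> {1..n}. (f i, g i) = x}) = 0" if "x \<notin> {..<k} \<times> {..<l}" for x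
  proof -
    have "{i \<in> {1..n}. (f i, g i) = x} = {}" using fk gl that by blast
    then show ?thesis by (simp only: card.empty of_nat_0)
  qed
  show ?thesis unfolding mats_def using row col zero by (intro CollectI conjI allI impI) auto
qed

lemma coloring_components:
  assumes h: "h \<in> colorings n w" and w: "w \<in> mats k l u v"
    and u: "\<And>a. k \<le> a \<Longrightarrow> u a = 0" and v: "\<And>b. l \<le> b \<Longrightarrow> v b = 0"
  shows "restrict (fst \<circ> h) {1..n} \<in> colorings n u" "restrict (snd \<circ> h) {1..n} \<in> colorings n v"
proof -
  have supp: "h i \<in> {..<k} \<times> {..<l}" if "i \<in> {1..n}" for i
    using coloring_color_nonzero[OF h that] w unfolding mats_def by blast
  then have fk: "fst (h i) < k" and gl: "snd (h i) < l" if "i \<in> {1..n}" for i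
    using that by (auto simp: mem_Times_iff)
  have z: "w (a, b) = 0" if "k \<le> a \<or> l \<le> b" for a b using w that by (auto simp: mats_def)
  have "int (card {i \<in> {1..n}. fst (h i) = a}) = (\<Sum>b<l. w (a, b))" for a
    using card_fst_color[of "{1..n}" h l a] gl coloring_content[OF h] by (simp only: of_nat_sum) simp
  moreover have "(\<Sum>b<l. w (a, b)) = u a" for a
    using w u z by (cases "a < k") (auto simp: mats_def)
  ultimately show "restrict (fst \<circ> h) {1..n} \<in> colorings n u"
    by (simp add: colorings_def cong: conj_cong)
  have "int (card {i \<in> {1..n}. snd (h i) = b}) = (\<Sum>a<k. w (a, b))" for b
    using card_snd_color[of "{1..n}" h k b] fk coloring_content[OF h] by (simp only: of_nat_sum) simp
  moreover have "(\<Sum>a<k. w (a, b)) = v b" for b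
    using w v z by (cases "b < l") (auto simp: mats_def)
  ultimately show "restrict (snd \<circ> h) {1..n} \<in> colorings n v"
    by (simp add: colorings_def cong: conj_cong)
qed

text \<open>A pair of colorings is a single coloring by pairs; its content is a matrix whose margins are the contents
  of the two colorings. Invariance of the pair means invariance of both.\<close>

lemma perm_char_mult:
  assumes p: "p permutes {1..n}"
    and u: "\<And>a. k \<le> a \<Longrightarrow> u a = 0" and v: "\<And>b. l \<le> b \<Longrightarrow> v b = 0"
  shows "perm_char n u p * perm_char n v p = (\<Sum>w\<in>mats k l u v. perm_char n w p)"
proof -
  let ?F = "\<lambda>f g. restrict (\<lambda>i. (f i, g i)) {1..n}"
  let ?H = "\<lambda>h. (restrict (fst \<circ> h) {1..n}, restrict (snd \<circ> h) {1..n})"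
  have pn: "p i \<in> {1..n} \<longleftrightarrow> i \<in> {1..n}" for i using permutes_in_image[OF p] .
  have "bij_betw (\<lambda>(f, g). ?F f g)
      ({f \<in> colorings n u. f \<circ> p = f} \<times> {g \<in> colorings n v. g \<circ> p = g})
      (\<Union>w\<in>mats k l u v. {h \<in> colorings n w. h \<circ> p = h})"
  proof (rule bij_betw_byWitness[of _ ?H])
    show "\<forall>x\<in>{f \<in> colorings n u. f \<circ> p = f} \<times> {g \<in> colorings n v. g \<circ> p = g}.
        ?H (case x of (f, g) \<Rightarrow> ?F f g) = x"
      by (auto simp: colorings_def fun_eq_iff extensional_def)
    show "\<forall>h\<in>(\<Union>w\<in>mats k l u v. {h \<in> colorings n w. h \<circ> p = h}). (case ?H h of (f, g) \<Rightarrow> ?F f g) = h"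
      by (auto simp: colorings_def fun_eq_iff extensional_def)
    show "(\<lambda>(f, g). ?F f g) ` ({f \<in> colorings n u. f \<circ> p = f} \<times> {g \<in> colorings n v. g \<circ> p = g})
        \<subseteq> (\<Union>w\<in>mats k l u v. {h \<in> colorings n w. h \<circ> p = h})"
    proof clarify
      fix f g assume f: "f \<in> colorings n u" "f \<circ> p = f" and g: "g \<in> colorings n v" "g \<circ> p = g"
      have "?F f g \<in> colorings n (\<lambda>c. int (card {i \<in> {1..n}. (f i, g i) = c}))"
        by (simp add: colorings_def cong: conj_cong)
      moreover have "?F f g \<circ> p = ?F f g"
        using f(2) g(2) pn by (auto simp: fun_eq_iff restrict_def)
      ultimately show "?F f g \<in> (\<Union>w\<in>mats k l u v. {h \<in> colorings n w. h \<circ> p = h})"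
        using pair_coloring_in_mats[OF f(1) g(1) u v] by blast
    qed
    show "?H ` (\<Union>w\<in>mats k l u v. {h \<in> colorings n w. h \<circ> p = h})
        \<subseteq> {f \<in> colorings n u. f \<circ> p = f} \<times> {g \<in> colorings n v. g \<circ> p = g}"
    proof
      fix x assume "x \<in> ?H ` (\<Union>w\<in>mats k l u v. {h \<in> colorings n w. h \<circ> p = h})"
      then obtain h w where x: "x = ?H h" and h: "h \<in> colorings n w" "h \<circ> p = h" and w: "w \<in> mats k l u v"
        by blast
      have "restrict (fst \<circ> h) {1..n} \<circ> p = restrict (fst \<circ> h) {1..n}"
        "restrict (snd \<circ> h) {1..n} \<circ> p = restrict (snd \<circ> h) {1..n}"
        using h(2) pn by (auto simp: fun_eq_iff restrict_def)
      with coloring_components[OF h(1) w u v] show "x \<in>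
          {f \<in> colorings n u. f \<circ> p = f} \<times> {g \<in> colorings n v. g \<circ> p = g}"
        unfolding x by blast
    qed
  qed
  then have "card {f \<in> colorings n u. f \<circ> p = f} * card {g \<in> colorings n v. g \<circ> p = g} =
      card (\<Union>w\<in>mats k l u v. {h \<in> colorings n w. h \<circ> p = h})"
    unfolding card_cartesian_product[symmetric] by (rule bij_betw_same_card)
  also have "\<dots> = (\<Sum>w\<in>mats k l u v. card {h \<in> colorings n w. h \<circ> p = h})"
  proof (rule card_UN_disjoint, simp_all only: finite_mats)
    show "\<forall>w\<in>mats k l u v. \<forall>w'\<in>mats k l u v. w \<noteq> w' \<longrightarrow>
      {h \<in> colorings n w. h \<circ> p = h} \<inter> {h \<in> colorings n w'. h \<circ> p = h} = {}"
    proof (intro ballI impI)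
      fix w w' :: "nat \<times> nat \<Rightarrow> int" assume "w \<noteq> w'"
      moreover have "w = w'" if "h \<in> colorings n w" "h \<in> colorings n w'" for h
        using coloring_content[OF that(1)] coloring_content[OF that(2)] by auto
      ultimately show "{h \<in> colorings n w. h \<circ> p = h} \<inter> {h \<in> colorings n w'. h \<circ> p = h} = {}" by blast
    qed
  qed (simp_all add: finite_mats)
  finally show ?thesis
    unfolding perm_char_def of_nat_mult[symmetric] of_nat_sum[symmetric] by (simp only:)
qed

text \<open>Each matrix contributes a transitive permutation character, whose mean is 1.\<close>

lemma ip_perm_char:
  assumes u: "\<And>a. k \<le> a \<Longrightarrow> u a = 0" and v: "\<And>b. l \<le> b \<Longrightarrow> v b = 0" and n: "(\<Sum>a<k. u a) = int n"
  shows "ip n (perm_char n u) (perm_char n v) = of_nat (card (mats k l u v))"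
proof -
  have "(\<Sum>p\<in>perms n. perm_char n u p * perm_char n v p) = (\<Sum>p\<in>perms n. \<Sum>w\<in>mats k l u v. perm_char n w p)"
    by (intro sum.cong refl perm_char_mult) (auto simp: u v)
  also have "\<dots> = (\<Sum>w\<in>mats k l u v. \<Sum>p\<in>perms n. perm_char n w p)" by (rule sum.swap)
  also have "\<dots> = (\<Sum>w\<in>mats k l u v. fact n)"
  proof (intro sum.cong refl sum_perm_char)
    fix w assume w: "w \<in> mats k l u v"
    have "sum w ({..<k} \<times> {..<l}) = (\<Sum>a<k. \<Sum>b<l. w (a, b))" by (simp add: sum.cartesian_product)
    also have "\<dots> = (\<Sum>a<k. u a)" using w by (simp add: mats_def)
    finally show "sum w ({..<k} \<times> {..<l}) = int n" using n by simp
  qed (auto simp: mats_def)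
  finally show ?thesis by (simp add: ip_def)
qed

section \<open>Alternants of permutation characters\<close>

text \<open>A sequence of integers \<open>y\<close> with a permutation of the staircase \<open>0, 1, \<dots>, k - 1\<close> added: the content that indexes one
  term of a Jacobi--Trudi determinant.\<close>

definition shifted :: "nat \<Rightarrow> (nat \<Rightarrow> int) \<Rightarrow> (nat \<Rightarrow> nat) \<Rightarrow> nat \<Rightarrow> int" where
  "shifted k y w = (\<lambda>i. if i < k then y i + int (w i) else 0)"

text \<open>The Jacobi--Trudi determinant with rows indexed by \<open>y\<close>, expanded over permutations. For a partition \<open>lam\<close>
  the entries of \<open>y\<close> are \<open>lam i - i\<close>, which do not depend on the number \<open>k\<close> of rows.\<close>

definition alternant :: "nat \<Rightarrow> nat \<Rightarrow> (nat \<Rightarrow> int) \<Rightarrow> (nat \<Rightarrow> nat) \<Rightarrow> complex" where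
  "alternant k n y p = (\<Sum>w | w permutes {..<k}. of_int (sign w) * perm_char n (shifted k y w) p)"

lemma permutation_lessThan: "w permutes {..<k :: nat} \<Longrightarrow> permutation w"
  by (rule permutation_permutes[THEN iffD2]) auto

lemma permutes_lessThan: "w permutes {..<k :: nat} \<Longrightarrow> w i < k \<longleftrightarrow> i < k"
  using permutes_in_image[of w "{..<k}" i] by simp

lemma shifted_permute:
  assumes "\<sigma> permutes {..<k}"
  shows "shifted k (y \<circ> \<sigma>) (w \<circ> \<sigma>) = (\<lambda>i. shifted k y w (\<sigma> i))"
  by (simp add: shifted_def fun_eq_iff permutes_lessThan[OF assms])

lemma sum_shifted:
  assumes "w permutes {..<k}"
  shows "(\<Sum>i<k. shifted k y w i) = (\<Sum>i<k. y i + int i)"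
proof -
  have "(\<Sum>i<k. int (w i)) = (\<Sum>i<k. int i)"
    using sum.permute[OF assms, of int] by (simp add: comp_def)
  then show ?thesis by (simp add: shifted_def sum.distrib)
qed

lemma signed_sum_permute:
  fixes f :: "(nat \<Rightarrow> nat) \<Rightarrow> 'a :: comm_ring_1"
  assumes "\<sigma> permutes {..<k}"
  shows "(\<Sum>w | w permutes {..<k}. of_int (sign w) * f w) =
    of_int (sign \<sigma>) * (\<Sum>w | w permutes {..<k}. of_int (sign w) * f (w \<circ> \<sigma>))"
proof -
  have "(\<Sum>w | w permutes {..<k}. of_int (sign w) * f w) =
      (\<Sum>w | w permutes {..<k}. of_int (sign (w \<circ> \<sigma>)) * f (w \<circ> \<sigma>))"
    by (rule sum_permutations_compose_right[OF assms])
  also have "\<dots> = (\<Sum>w | w permutes {..<k}. of_int (sign \<sigma>) * (of_int (sign w) * f (w \<circ> \<sigma>)))"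
    using assms by (intro sum.cong refl) (simp add: sign_compose permutation_lessThan mult_ac)
  finally show ?thesis by (simp add: sum_distrib_left)
qed

lemma alternant_permute:
  assumes \<sigma>: "\<sigma> permutes {..<k}" and p: "p permutes {1..n}"
  shows "alternant k n (y \<circ> \<sigma>) p = of_int (sign \<sigma>) * alternant k n y p"
proof -
  have "alternant k n (y \<circ> \<sigma>) p = of_int (sign \<sigma>) *
      (\<Sum>w | w permutes {..<k}. of_int (sign w) * perm_char n (shifted k (y \<circ> \<sigma>) (w \<circ> \<sigma>)) p)"
    unfolding alternant_def by (rule signed_sum_permute[OF \<sigma>])
  also have "\<dots> = of_int (sign \<sigma>) * alternant k n y p"
    unfolding alternant_def shifted_permute[OF \<sigma>] perm_char_reindex[OF permutes_bij[OF \<sigma>] p] ..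
  finally show ?thesis .
qed

lemma alternant_repeated:
  assumes "i < k" "j < k" "i \<noteq> j" "y i = y j" and p: "p permutes {1..n}"
  shows "alternant k n y p = 0"
proof -
  have "y \<circ> transpose i j = y" using assms(4) by (auto simp: fun_eq_iff transpose_def)
  with alternant_permute[OF permutes_swap_id[of i "{..<k}" j] p, of y] assms
  have "alternant k n y p = - alternant k n y p" by (simp add: sign_swap_id)
  then show ?thesis by simp
qed

text \<open>All terms in row \<open>i\<close> of the determinant have negative index.\<close>

lemma alternant_negative:
  assumes "i < k" "y i + int k \<le> 0"
  shows "alternant k n y p = 0"
proof -
  have "perm_char n (shifted k y w) p = 0" if w: "w permutes {..<k}" for w
  proof (rule perm_char_neg[of _ i])
    have "w i < k" using permutes_lessThan[OF w] assms(1) by blast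
    then have "int (w i) < int k" by simp
    with assms show "shifted k y w i < 0" by (simp add: shifted_def)
  qed
  then show ?thesis by (simp add: alternant_def)
qed

text \<open>Row \<open>k\<close> of the larger determinant has a single nonzero entry, namely 1 on the diagonal: a
  permutation with \<open>w k < k\<close> makes the content negative there.\<close>

lemma alternant_Suc:
  assumes "y k = - int k"
  shows "alternant (Suc k) n y p = alternant k n y p"
proof -
  have "alternant (Suc k) n y p =
      (\<Sum>w | w permutes {..<k}. of_int (sign w) * perm_char n (shifted (Suc k) y w) p)"
    unfolding alternant_def
  proof (rule sum.mono_neutral_right)
    show "{w. w permutes {..<k}} \<subseteq> {w. w permutes {..<Suc k}}"
      by (intro Collect_mono impI, erule permutes_subset) simp
    show "\<forall>w\<in>{w. w permutes {..<Suc k}} - {w. w permutes {..<k}}.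
        of_int (sign w) * perm_char n (shifted (Suc k) y w) p = 0"
    proof
      fix w assume w: "w \<in> {w. w permutes {..<Suc k}} - {w. w permutes {..<k}}"
      have "w k \<noteq> k"
      proof
        assume "w k = k"
        have "w permutes {..<k}"
        proof (rule permutes_superset[of w "{..<Suc k}"])
          fix x assume "x \<in> {..<Suc k} - {..<k}"
          then have "x = k" by auto
          with \<open>w k = k\<close> show "w x = x" by simp
        qed (use w in simp)
        with w show False by simp
      qed
      moreover have "w k < Suc k" using w permutes_lessThan[of w "Suc k" k] by simp
      ultimately have "shifted (Suc k) y w k < 0" using assms by (simp add: shifted_def)
      then have "perm_char n (shifted (Suc k) y w) p = 0" by (rule perm_char_neg)
      then show "of_int (sign w) * perm_char n (shifted (Suc k) y w) p = 0" by simp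
    qed
  qed (simp add: finite_permutations)
  also have "\<dots> = alternant k n y p"
    unfolding alternant_def
  proof (intro sum.cong refl)
    fix w assume "w \<in> {w. w permutes {..<k}}"
    then have "w k = k" by (simp add: permutes_not_in)
    then have "shifted (Suc k) y w = shifted k y w"
      using assms by (auto simp: shifted_def fun_eq_iff less_Suc_eq)
    then show "of_int (sign w) * perm_char n (shifted (Suc k) y w) p =
        of_int (sign w) * perm_char n (shifted k y w) p" by simp
  qed
  finally show ?thesis .
qed

lemma alternant_extend:
  assumes "k \<le> K" "\<And>i. k \<le> i \<Longrightarrow> y i = - int i"
  shows "alternant K n y p = alternant k n y p"
  using assms by (induction rule: dec_induct) (simp_all add: alternant_Suc)

lemma alternant_cong:
  assumes "\<And>i. i < k \<Longrightarrow> y i = z i"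
  shows "alternant k n y p = alternant k n z p"
proof -
  have "shifted k y w = shifted k z w" for w using assms by (auto simp: shifted_def)
  then show ?thesis by (simp add: alternant_def)
qed

definition comps :: "nat \<Rightarrow> int \<Rightarrow> (nat \<Rightarrow> int) set" where
  "comps k r = {c. (\<forall>i. 0 \<le> c i) \<and> (\<forall>i\<ge>k. c i = 0) \<and> (\<Sum>i<k. c i) = r}"

lemma finite_comps [simp]: "finite (comps k r)"
proof (rule finite_subset)
  show "comps k r \<subseteq> {c. \<forall>i. (i \<in> {..<k} \<longrightarrow> c i \<in> {0..r}) \<and> (i \<notin> {..<k} \<longrightarrow> c i = 0)}"
  proof (intro subsetI CollectI allI conjI impI)
    fix c i assume "c \<in> comps k r" "i \<in> {..<k}"
    then show "c i \<in> {0..r}" using member_le_sum[of i "{..<k}" c] by (auto simp: comps_def)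
  qed (auto simp: comps_def)
qed (intro finite_set_of_finite_funs finite_lessThan finite_atLeastAtMost_int)

text \<open>Sort the matrices by their last column.\<close>

lemma card_mats_Suc:
  "card (mats k (Suc l) u v) = (\<Sum>c\<in>comps k (v l). card (mats k l (\<lambda>i. u i - c i) v))"
proof -
  let ?M = "\<lambda>c. {w \<in> mats k (Suc l) u v. \<forall>a. w (a, l) = c a}"
  have cover: "mats k (Suc l) u v = (\<Union>c\<in>comps k (v l). ?M c)"
  proof (intro equalityI subsetI)
    fix w assume w: "w \<in> mats k (Suc l) u v"
    then have "(\<lambda>a. w (a, l)) \<in> comps k (v l)" by (auto simp: mats_def comps_def)
    with w show "w \<in> (\<Union>c\<in>comps k (v l). ?M c)" by blast
  qed blast
  have bij: "card (?M c) = card (mats k l (\<lambda>i. u i - c i) v)" if c: "c \<in> comps k (v l)" for c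
  proof (rule bij_betw_same_card)
    let ?f = "\<lambda>w (a, b). if b = l then 0 else w (a, b) :: int"
    let ?g = "\<lambda>w (a, b). if b = l then c a else w (a, b) :: int"
    show "bij_betw ?f (?M c) (mats k l (\<lambda>i. u i - c i) v)"
    proof (rule bij_betw_byWitness[of _ ?g])
      show "\<forall>w\<in>?M c. ?g (?f w) = w" by (auto simp: fun_eq_iff)
      show "\<forall>w\<in>mats k l (\<lambda>i. u i - c i) v. ?f (?g w) = w" by (auto simp: fun_eq_iff mats_def)
      show "?f ` ?M c \<subseteq> mats k l (\<lambda>i. u i - c i) v"
      proof
        fix z assume "z \<in> ?f ` ?M c"
        then obtain w where z: "z = ?f w" and w: "w \<in> ?M c" by blast
        have "(\<Sum>b<l. z (a, b)) = u a - c a" if "a < k" for a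
        proof -
          have "(\<Sum>b<Suc l. w (a, b)) = u a" using w that by (auto simp: mats_def)
          then show ?thesis using w by (simp add: z)
        qed
        moreover have "(\<Sum>a<k. z (a, b)) = v b" if "b < l" for b
          using w that by (auto simp: mats_def z)
        ultimately show "z \<in> mats k l (\<lambda>i. u i - c i) v"
          using w by (auto simp: mats_def z)
      qed
      show "?g ` mats k l (\<lambda>i. u i - c i) v \<subseteq> ?M c"
      proof
        fix z assume "z \<in> ?g ` mats k l (\<lambda>i. u i - c i) v"
        then obtain w where z: "z = ?g w" and w: "w \<in> mats k l (\<lambda>i. u i - c i) v" by blast
        have "(\<Sum>b<Suc l. z (a, b)) = u a" if "a < k" for a
          using w that by (auto simp: mats_def z)
        moreover have "(\<Sum>a<k. z (a, b)) = v b" if "b < Suc l" for b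
          using w that c by (cases "b = l") (auto simp: mats_def comps_def z)
        ultimately show "z \<in> ?M c"
          using w c by (auto simp: mats_def comps_def z)
      qed
    qed
  qed
  have "card (mats k (Suc l) u v) = card (\<Union>c\<in>comps k (v l). ?M c)"
    using cover by (rule arg_cong)
  also have "\<dots> = (\<Sum>c\<in>comps k (v l). card (?M c))"
  proof (rule card_UN_disjoint[OF finite_comps])
    show "\<forall>c\<in>comps k (v l). finite (?M c)"
      by (intro ballI finite_subset[OF _ finite_mats[of k "Suc l" u v]]) blast
    show "\<forall>c\<in>comps k (v l). \<forall>c'\<in>comps k (v l). c \<noteq> c' \<longrightarrow> ?M c \<inter> ?M c' = {}"
      by (auto simp: fun_eq_iff)
  qed
  finally show ?thesis using bij by simp
qed

lemma card_mats_permute: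
  assumes \<sigma>: "\<sigma> permutes {..<k}"
  shows "card (mats k l (\<lambda>i. u (\<sigma> i)) v) = card (mats k l u v)"
proof (rule bij_betw_same_card)
  let ?f = "\<lambda>\<sigma> (w :: nat \<times> nat \<Rightarrow> int) (a, b). w (\<sigma> a, b)"
  have into: "?f \<tau> w \<in> mats k l (\<lambda>i. u (\<tau> i)) v"
    if \<tau>: "\<tau> permutes {..<k}" and w: "w \<in> mats k l u v" for \<tau> w and u :: "nat \<Rightarrow> int"
  proof -
    have "(\<Sum>a<k. w (\<tau> a, b)) = (\<Sum>a<k. w (a, b))" for b
      using sum.permute[OF \<tau>, of "\<lambda>a. w (a, b)"] by (simp add: comp_def)
    then show ?thesis using w permutes_lessThan[OF \<tau>] by (auto simp: mats_def)
  qed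
  show "bij_betw (?f (inv' \<sigma>)) (mats k l (\<lambda>i. u (\<sigma> i)) v) (mats k l u v)"
  proof (rule bij_betw_byWitness[of _ "?f \<sigma>"])
    show "?f (inv' \<sigma>) ` mats k l (\<lambda>i. u (\<sigma> i)) v \<subseteq> mats k l u v"
      using into[OF permutes_inv[OF \<sigma>], of _ "\<lambda>i. u (\<sigma> i)"] by (auto simp: permutes_inverses[OF \<sigma>])
    show "?f \<sigma> ` mats k l u v \<subseteq> mats k l (\<lambda>i. u (\<sigma> i)) v" using into[OF \<sigma>] by blast
  qed (auto simp: permutes_inverses[OF \<sigma>])
qed

text \<open>The inner product of an alternant with the permutation character of content \<open>v\<close>, where \<open>v\<close> has \<open>l\<close> parts. In terms of
  symmetric functions it is the coefficient of the monomial with exponents \<open>y\<close> (shifted by the staircase) in the product of the Vandermonde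
  determinant with complete symmetric functions.\<close>

definition pieri :: "nat \<Rightarrow> (nat \<Rightarrow> int) \<Rightarrow> nat \<Rightarrow> (nat \<Rightarrow> int) \<Rightarrow> int" where
  "pieri k v l y = (\<Sum>w | w permutes {..<k}. of_int (sign w) * int (card (mats k l (shifted k y w) v)))"

lemma pieri_permute:
  assumes \<sigma>: "\<sigma> permutes {..<k}"
  shows "pieri k v l (y \<circ> \<sigma>) = of_int (sign \<sigma>) * pieri k v l y"
proof -
  have "pieri k v l (y \<circ> \<sigma>) = of_int (sign \<sigma>) *
      (\<Sum>w | w permutes {..<k}. of_int (sign w) * int (card (mats k l (shifted k (y \<circ> \<sigma>) (w \<circ> \<sigma>)) v)))"
    unfolding pieri_def by (rule signed_sum_permute[OF \<sigma>])
  also have "\<dots> = of_int (sign \<sigma>) * pieri k v l y"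
    unfolding pieri_def shifted_permute[OF \<sigma>] card_mats_permute[OF \<sigma>] ..
  finally show ?thesis .
qed

lemma mats_cong:
  assumes "\<And>i. i < k \<Longrightarrow> u i = u' i"
  shows "mats k l u v = mats k l u' v"
  using assms by (auto simp: mats_def)

lemma pieri_Suc: "pieri k v (Suc l) y = (\<Sum>c\<in>comps k (v l). pieri k v l (\<lambda>i. y i - c i))"
proof -
  have "int (card (mats k (Suc l) (shifted k y w) v)) =
      (\<Sum>c\<in>comps k (v l). int (card (mats k l (shifted k (\<lambda>i. y i - c i) w) v)))" for w
  proof -
    have "mats k l (\<lambda>i. shifted k y w i - c i) v = mats k l (shifted k (\<lambda>i. y i - c i) w) v" for c
      by (rule mats_cong) (simp add: shifted_def)
    then show ?thesis by (simp add: card_mats_Suc)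
  qed
  then have "pieri k v (Suc l) y = (\<Sum>w | w permutes {..<k}. \<Sum>c\<in>comps k (v l).
      of_int (sign w) * int (card (mats k l (shifted k (\<lambda>i. y i - c i) w) v)))"
    by (simp add: pieri_def sum_distrib_left)
  also have "\<dots> = (\<Sum>c\<in>comps k (v l). \<Sum>w | w permutes {..<k}.
      of_int (sign w) * int (card (mats k l (shifted k (\<lambda>i. y i - c i) w) v)))"
    by (rule sum.swap)
  finally show ?thesis by (simp add: pieri_def)
qed

lemma pieri_cong:
  assumes "\<And>i. i < k \<Longrightarrow> y i = z i"
  shows "pieri k v l y = pieri k v l z"
proof -
  have "shifted k y w = shifted k z w" for w using assms by (auto simp: shifted_def)
  then show ?thesis by (simp add: pieri_def)
qed

lemma pieri_negative:
  assumes "i < k" "y i + int k \<le> 0"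
  shows "pieri k v l y = 0"
proof -
  have "mats k l (shifted k y w) v = {}" if w: "w permutes {..<k}" for w
  proof -
    have "w i < k" using permutes_lessThan[OF w] assms(1) by blast
    then have "int (w i) < int k" by simp
    with assms have neg: "shifted k y w i < 0" by (simp add: shifted_def)
    have False if m: "m \<in> mats k l (shifted k y w) v" for m
    proof -
      have "0 \<le> (\<Sum>b<l. m (i, b))" using m by (intro sum_nonneg) (auto simp: mats_def)
      moreover have "(\<Sum>b<l. m (i, b)) = shifted k y w i" using m assms(1) by (auto simp: mats_def)
      ultimately show False using neg by simp
    qed
    then show ?thesis by blast
  qed
  then show ?thesis by (simp add: pieri_def)
qed

section \<open>The Pieri rule and the orthonormality of the Schur characters\<close>

text \<open>With \<open>y i = lam i - i\<close>, removing \<open>c i\<close> boxes from each row \<open>i\<close> of \<open>lam\<close> removes a horizontal strip exactly when the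
  condition on \<open>y\<close> holds.\<close>

definition strips :: "nat \<Rightarrow> int \<Rightarrow> (nat \<Rightarrow> int) \<Rightarrow> (nat \<Rightarrow> int) set" where
  "strips k r y = {c \<in> comps k r. \<forall>i. Suc i < k \<longrightarrow> y (Suc i) < y i - c i}"

text \<open>Terms that do not remove a horizontal strip cancel in pairs. If \<open>i\<close> is the first row with
  \<open>y i - c i \<le> y (Suc i)\<close>, then interchanging \<open>y - c\<close> in the rows \<open>i\<close> and \<open>Suc i\<close> is again a
  subtraction of nonnegative parts, has the same first bad row, and reverses the sign.\<close>

lemma pieri_rule:
  assumes y: "\<And>i. Suc i < k \<Longrightarrow> y (Suc i) < y i"
  shows "pieri k v (Suc l) y = (\<Sum>c\<in>strips k (v l) y. pieri k v l (\<lambda>i. y i - c i))"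
proof -
  define bad where "bad c i \<longleftrightarrow> Suc i < k \<and> y i - c i \<le> y (Suc i)" for c :: "nat \<Rightarrow> int" and i
  define B where "B = {c \<in> comps k (v l). \<exists>i. bad c i}"
  define j where "j c = (LEAST i. bad c i)" for c
  define \<tau> where "\<tau> c = transpose (j c) (Suc (j c))" for c
  \<comment> \<open>the involution on bad compositions: \<open>y - \<iota> c\<close> is \<open>y - c\<close> with two neighbouring rows interchanged\<close>
  define \<iota> where "\<iota> c = (\<lambda>i. y i - (y (\<tau> c i) - c (\<tau> c i)))" for c
  have badj: "bad c (j c)" if "c \<in> B" for c
    using that LeastI_ex[of "bad c"] by (simp add: B_def j_def)
  have \<tau>_perm: "\<tau> c permutes {..<k}" if "c \<in> B" for c
    using badj[OF that] unfolding \<tau>_def bad_def by (intro permutes_swap_id) auto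
  have \<iota>_lt: "\<iota> c i = c i" if "i < j c" for c i
    using that by (simp add: \<iota>_def \<tau>_def)
  have \<iota>_j: "\<iota> c (j c) = y (j c) - y (Suc (j c)) + c (Suc (j c))" for c
    by (simp add: \<iota>_def \<tau>_def)
  have \<iota>_B: "\<iota> c \<in> B" and j\<iota>: "j (\<iota> c) = j c" if c: "c \<in> B" for c
  proof -
    have cc: "c \<in> comps k (v l)" using c by (simp add: B_def)
    have pos: "0 \<le> c i" for i using cc by (simp add: comps_def)
    have bd: "Suc (j c) < k" "y (j c) - c (j c) \<le> y (Suc (j c))" using badj[OF c] by (auto simp: bad_def)
    have "0 \<le> \<iota> c i" for i
    proof -
      consider "i = j c" | "i = Suc (j c)" | "i \<noteq> j c" "i \<noteq> Suc (j c)" by blast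
      then show ?thesis
      proof cases
        case 1 then show ?thesis using \<iota>_j[of c] y[OF bd(1)] pos[of "Suc (j c)"] by simp
      next
        case 2 then show ?thesis using bd by (simp add: \<iota>_def \<tau>_def)
      next
        case 3 then show ?thesis using pos by (simp add: \<iota>_def \<tau>_def)
      qed
    qed
    moreover have "\<iota> c i = 0" if "k \<le> i" for i
    proof -
      have "i \<noteq> j c" "i \<noteq> Suc (j c)" using that bd by auto
      then have "\<iota> c i = c i" by (simp add: \<iota>_def \<tau>_def)
      then show ?thesis using cc that by (simp add: comps_def)
    qed
    moreover have "(\<Sum>i<k. \<iota> c i) = v l"
    proof -
      have "(\<Sum>i<k. y (\<tau> c i) - c (\<tau> c i)) = (\<Sum>i<k. y i - c i)"
        using sum.permute[OF \<tau>_perm[OF c], of "\<lambda>i. y i - c i"] by (simp add: comp_def)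
      then show ?thesis using cc by (simp add: \<iota>_def comps_def sum_subtractf)
    qed
    ultimately have comps: "\<iota> c \<in> comps k (v l)" by (simp add: comps_def)
    have bad': "bad (\<iota> c) (j c)" using bd pos[of "Suc (j c)"] by (simp add: bad_def \<iota>_j)
    with comps show "\<iota> c \<in> B" by (auto simp: B_def)
    have "\<not> bad (\<iota> c) i" if "i < j c" for i
      using \<iota>_lt[OF that] not_less_Least[of i "bad c"] that by (simp add: bad_def j_def)
    then show "j (\<iota> c) = j c"
      unfolding j_def[of "\<iota> c"] using bad' by (intro Least_equality) (auto simp: not_less[symmetric])
  qed
  have \<iota>\<iota>: "\<iota> (\<iota> c) = c" if c: "c \<in> B" for c
  proof -
    have "\<tau> (\<iota> c) = \<tau> c" by (simp add: \<tau>_def j\<iota>[OF c])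
    moreover have "\<tau> c (\<tau> c i) = i" for i by (simp add: \<tau>_def)
    ultimately show ?thesis by (simp add: \<iota>_def[of "\<iota> c"]) (simp add: \<iota>_def)
  qed
  have anti: "pieri k v l (\<lambda>i. y i - \<iota> c i) = - pieri k v l (\<lambda>i. y i - c i)" if c: "c \<in> B" for c
  proof -
    have "(\<lambda>i. y i - \<iota> c i) = (\<lambda>i. y i - c i) \<circ> \<tau> c" by (simp add: \<iota>_def fun_eq_iff)
    moreover have "sign (\<tau> c) = -1" by (simp add: \<tau>_def sign_swap_id)
    ultimately show ?thesis using pieri_permute[OF \<tau>_perm[OF c], of v l "\<lambda>i. y i - c i"] by simp
  qed
  have "(\<Sum>c\<in>B. pieri k v l (\<lambda>i. y i - c i)) = (\<Sum>c\<in>B. pieri k v l (\<lambda>i. y i - \<iota> c i))"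
    by (rule sum.reindex_bij_witness[of _ \<iota> \<iota>]) (simp_all add: \<iota>\<iota> \<iota>_B)
  also have "\<dots> = - (\<Sum>c\<in>B. pieri k v l (\<lambda>i. y i - c i))"
    by (simp add: anti sum_negf)
  finally have B0: "(\<Sum>c\<in>B. pieri k v l (\<lambda>i. y i - c i)) = 0" by simp
  have "comps k (v l) = strips k (v l) y \<union> B"
    by (auto simp: strips_def B_def bad_def not_less)
  moreover have "strips k (v l) y \<inter> B = {}" by (fastforce simp: strips_def B_def bad_def)
  moreover have "finite (strips k (v l) y)" "finite B" by (simp_all add: strips_def B_def)
  ultimately show ?thesis using B0 by (simp add: pieri_Suc sum.union_disjoint)
qed

text \<open>A horizontal strip has at most one box in each column, hence at most \<open>j\<close> boxes in the first \<open>j\<close> columns.\<close>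

lemma strip_trunc_bound:
  fixes a b :: "nat \<Rightarrow> int"
  assumes ab: "\<And>i. i < k \<Longrightarrow> b i \<le> a i" and inter: "\<And>i. Suc i < k \<Longrightarrow> a (Suc i) \<le> b i"
    and b: "\<And>i. i < k \<Longrightarrow> 0 \<le> b i"
  shows "(\<Sum>i<k. min (a i) (int j)) - (\<Sum>i<k. min (b i) (int j)) \<le> min (\<Sum>i<k. a i - b i) (int j)"
proof -
  have "(\<Sum>i<k. min (a i) (int j)) - (\<Sum>i<k. min (b i) (int j)) \<le> (\<Sum>i<k. a i - b i)"
    unfolding sum_subtractf[symmetric] by (intro sum_mono) (use ab in \<open>fastforce simp: min_def\<close>)
  moreover have "(\<Sum>i<k. min (a i) (int j)) - (\<Sum>i<k. min (b i) (int j)) \<le> int j"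
  proof (cases k)
    case (Suc m)
    have "(\<Sum>i<m. min (a (Suc i)) (int j)) \<le> (\<Sum>i<m. min (b i) (int j))"
      by (intro sum_mono) (use inter Suc in \<open>auto simp: min_le_iff_disj\<close>)
    moreover have "0 \<le> min (b m) (int j)" using b Suc by simp
    moreover have "(\<Sum>i<k. min (a i) (int j)) = min (a 0) (int j) + (\<Sum>i<m. min (a (Suc i)) (int j))"
      by (simp only: Suc sum.lessThan_Suc_shift)
    moreover have "(\<Sum>i<k. min (b i) (int j)) = (\<Sum>i<m. min (b i) (int j)) + min (b m) (int j)"
      by (simp only: Suc sum.lessThan_Suc)
    ultimately show ?thesis by linarith
  qed simp
  ultimately show ?thesis by simp
qed

lemma pieri_strip:
  assumes y: "\<And>i. Suc i < k \<Longrightarrow> y (Suc i) < y i" "\<And>i. i < k \<Longrightarrow> 0 \<le> y i + int i"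
    and c: "c \<in> strips k r y" and nz: "pieri k v l (\<lambda>i. y i - c i) \<noteq> 0"
  shows "\<And>i. Suc i < k \<Longrightarrow> y (Suc i) - c (Suc i) < y i - c i"
    and "\<And>i. i < k \<Longrightarrow> 0 \<le> y i - c i + int i"
    and "(\<Sum>i<k. min (y i + int i) (int j)) - (\<Sum>i<k. min (y i - c i + int i) (int j)) \<le> min r (int j)"
proof -
  have cs: "\<And>i. 0 \<le> c i" "\<And>i. Suc i < k \<Longrightarrow> y (Suc i) < y i - c i" "(\<Sum>i<k. c i) = r"
    using c by (auto simp: strips_def comps_def)
  show "y (Suc i) - c (Suc i) < y i - c i" if "Suc i < k" for i
    using cs(1)[of "Suc i"] cs(2)[OF that] by simp
  show nonneg: "0 \<le> y i - c i + int i" if "i < k" for i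
  proof (cases "Suc i < k")
    case True
    then show ?thesis using cs(2)[OF True] y(2)[OF True] by simp
  next
    case False
    then have "int k = int i + 1" using that by simp
    then show ?thesis using pieri_negative[of i k "\<lambda>i. y i - c i"] nz that by force
  qed
  have "(\<Sum>i<k. y i + int i - (y i - c i + int i)) = r" using cs(3) by simp
  moreover have "y (Suc i) + int (Suc i) \<le> y i - c i + int i" if "Suc i < k" for i
    using cs(2)[OF that] by simp
  ultimately show "(\<Sum>i<k. min (y i + int i) (int j)) - (\<Sum>i<k. min (y i - c i + int i) (int j)) \<le> min r (int j)"
    using strip_trunc_bound[of k "\<lambda>i. y i - c i + int i" "\<lambda>i. y i + int i" j] cs(1) nonneg by simp
qed

lemma card_mats_0: "card (mats k 0 u v) = (if \<forall>i<k. u i = 0 then 1 else 0)"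
proof -
  have "mats k 0 u v = (if \<forall>i<k. u i = 0 then {\<lambda>_. 0} else {})"
    by (auto simp: mats_def fun_eq_iff)
  then show ?thesis by simp
qed

text \<open>Build up \<open>lam\<close> by horizontal strips of sizes \<open>v 0, v 1, \<dots>\<close>: the strip of size \<open>v i\<close> puts at most
  \<open>min (v i) j\<close> boxes into the first \<open>j\<close> columns.\<close>

lemma pieri_dominance:
  assumes y: "\<And>i. Suc i < k \<Longrightarrow> y (Suc i) < y i" "\<And>i. i < k \<Longrightarrow> 0 \<le> y i + int i"
    and nz: "pieri k v l y \<noteq> 0"
  shows "(\<Sum>i<k. min (y i + int i) (int j)) \<le> (\<Sum>i<l. min (v i) (int j))"
  using y nz
proof (induction l arbitrary: y)
  case 0
  then obtain w where w: "w permutes {..<k}" "card (mats k 0 (shifted k y w) v) \<noteq> 0"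
    by (force simp: pieri_def elim: sum.not_neutral_contains_not_neutral)
  then have "\<forall>i<k. shifted k y w i = 0" by (simp add: card_mats_0 split: if_splits)
  then have "(\<Sum>i<k. y i + int i) = 0"
    unfolding sum_shifted[OF w(1), symmetric] by (intro sum.neutral) auto
  then have "\<forall>i\<in>{..<k}. y i + int i = 0"
    using 0 by (subst (asm) sum_nonneg_eq_0_iff) auto
  then show ?case by simp
next
  case (Suc l)
  from Suc.prems(3) obtain c where c: "c \<in> strips k (v l) y" and nz: "pieri k v l (\<lambda>i. y i - c i) \<noteq> 0"
    unfolding pieri_rule[of k y v l, OF Suc.prems(1), simplified] by (meson sum.not_neutral_contains_not_neutral)
  note strip = pieri_strip[OF Suc.prems(1,2) c nz]
  have "(\<Sum>i<k. min (y i - c i + int i) (int j)) \<le> (\<Sum>i<l. min (v i) (int j))"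
    by (rule Suc.IH) (use strip(1,2) nz in auto)
  moreover have "(\<Sum>i<k. min (y i + int i) (int j)) - (\<Sum>i<k. min (y i - c i + int i) (int j)) \<le> min (v l) (int j)"
    using Suc.prems by (intro pieri_strip(3)[OF _ _ c nz]) auto
  ultimately show ?case unfolding sum.lessThan_Suc by linarith
qed

text \<open>There is only one way to build \<open>v\<close> from horizontal strips of sizes \<open>v 0, v 1, \<dots>\<close>, row by row: otherwise a bound
  on the number of boxes in the first columns would be violated.\<close>

lemma pieri_diagonal:
  assumes v: "\<And>i. 0 \<le> v i" "antimono v" and "l \<le> k"
  shows "pieri k v l (\<lambda>i. (if i < l then v i else 0) - int i) = 1"
  using \<open>l \<le> k\<close>
proof (induction l)
  case 0
  have "pieri k v 0 (\<lambda>i. - int i) = (\<Sum>w | w permutes {..<k}. if w = id then 1 else 0)"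
    unfolding pieri_def
  proof (intro sum.cong refl)
    fix w assume "w \<in> {w. w permutes {..<k}}"
    then have w: "w permutes {..<k}" by simp
    have "(\<forall>i<k. shifted k (\<lambda>i. - int i) w i = 0) \<longleftrightarrow> w = id"
    proof
      assume *: "\<forall>i<k. shifted k (\<lambda>i. - int i) w i = 0"
      have "w i = i" for i
        using * permutes_not_in[OF w, of i] by (cases "i < k") (auto simp: shifted_def)
      then show "w = id" by (simp add: fun_eq_iff)
    qed (simp add: shifted_def)
    then show "of_int (sign w) * int (card (mats k 0 (shifted k (\<lambda>i. - int i) w) v)) = (if w = id then 1 else 0)"
      by (simp add: card_mats_0)
  qed
  also have "\<dots> = 1" by (subst sum.delta) (auto simp: finite_permutations permutes_id)
  finally show ?case by simp
next
  case (Suc l)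
  define y where "y = (\<lambda>i. (if i < Suc l then v i else 0) - int i)"
  \<comment> \<open>the strip that removes the last row\<close>
  define c0 where "c0 = (\<lambda>i. if i = l then v l else 0)"
  have dec: "v (Suc i) \<le> v i" for i using v(2) by (simp add: antimono_def)
  have y: "y (Suc i) < y i" "0 \<le> y i + int i" for i
    using dec[of i] v(1)[of i] by (auto simp: y_def)
  have "v (Suc i) - 1 < v i" for i using dec[of i] by simp
  then have c0: "c0 \<in> strips k (v l) y"
    using Suc.prems v(1) by (auto simp: strips_def comps_def c0_def y_def sum.delta')
  have "pieri k v (Suc l) y = (\<Sum>c\<in>strips k (v l) y. pieri k v l (\<lambda>i. y i - c i))"
    by (rule pieri_rule) (rule y)
  also have "\<dots> = (\<Sum>c\<in>{c0}. pieri k v l (\<lambda>i. y i - c i))"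
  proof (rule sum.mono_neutral_right)
    show "\<forall>c\<in>strips k (v l) y - {c0}. pieri k v l (\<lambda>i. y i - c i) = 0"
    proof (rule ballI, rule ccontr)
      fix c assume c': "c \<in> strips k (v l) y - {c0}" and nz: "pieri k v l (\<lambda>i. y i - c i) \<noteq> 0"
      then have c: "c \<in> strips k (v l) y" by simp
      note strip = pieri_strip[OF y c nz]
      define a where "a = (\<lambda>i. y i - c i + int i)"
      define b where "b = (\<lambda>i. if i < l then v i else 0)"
      have ab: "a i = b i" if "i < k" for i
      proof (rule decreasing_eqI_trunc_sums[of k])
        have step: "a (Suc i) \<le> a i" if "Suc i < k" for i using strip(1)[OF that] by (simp add: a_def)
        show "a j \<le> a i" if "i \<le> j" "j < k" for i j
          using that by (induction rule: dec_induct) (auto intro: order_trans[OF step])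
        show "b j \<le> b i" if "i \<le> j" for i j using v that by (auto simp: b_def antimono_def)
        show "0 \<le> a i" if "i < k" for i using strip(2)[OF that] by (simp add: a_def)
        show "0 \<le> b i" for i using v by (simp add: b_def)
        show "(\<Sum>i<k. min (a i) (int j)) = (\<Sum>i<k. min (b i) (int j))" for j
        proof -
          have trunc: "(\<Sum>i<k. min (if i < m then v i else 0) (int j)) = (\<Sum>i<m. min (v i) (int j))"
            if "m \<le> k" for m
          proof -
            have "(\<Sum>i<k. min (if i < m then v i else 0) (int j)) =
                (\<Sum>i<m. min (if i < m then v i else 0) (int j))"
              using that by (intro sum.mono_neutral_right) auto
            then show ?thesis by simp
          qed
          have "(\<Sum>i<k. min (y i + int i) (int j)) = (\<Sum>i<Suc l. min (v i) (int j))"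
            using trunc[of "Suc l"] Suc.prems by (simp add: y_def)
          moreover have "(\<Sum>i<k. min (b i) (int j)) = (\<Sum>i<l. min (v i) (int j))"
            using trunc[of l] Suc.prems by (simp add: b_def)
          moreover have "(\<Sum>i<k. min (a i) (int j)) \<le> (\<Sum>i<l. min (v i) (int j))"
            unfolding a_def by (rule pieri_dominance) (use strip(1,2) nz in auto)
          moreover have "(\<Sum>i<k. min (b i) (int j)) \<le> (\<Sum>i<k. min (a i) (int j))"
          proof -
            have "(\<Sum>i<k. min (y i + int i) (int j)) - (\<Sum>i<k. min (a i) (int j)) \<le> min (v l) (int j)"
              unfolding a_def by (rule pieri_strip(3)[OF y c nz])
            then show ?thesis using calculation unfolding sum.lessThan_Suc by linarith
          qed
          ultimately show ?thesis by linarith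
        qed
      qed (use that in auto)
      have "c i = c0 i" if "i < k" for i
        using ab[OF that] by (cases "i < l"; cases "i = l") (simp_all add: a_def b_def c0_def y_def)
      moreover have "c i = c0 i" if "\<not> i < k" for i
        using that c c0 by (simp add: strips_def comps_def)
      ultimately have "c = c0" by blast
      with c' show False by simp
    qed
  qed (use c0 in \<open>auto simp: strips_def\<close>)
  also have "\<dots> = pieri k v l (\<lambda>i. (if i < l then v i else 0) - int i)"
    by (simp, rule pieri_cong) (auto simp: c0_def y_def)
  also have "\<dots> = 1" using Suc by simp
  finally show ?case by (simp add: y_def)
qed

lemma partition_eq_0_iff:
  assumes "is_partition lam"
  shows "lam i = 0 \<longleftrightarrow> plength lam \<le> i"
proof -
  have anti: "lam j \<le> lam i" if "i \<le> j" for i j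
    using assms that by (simp add: is_partition_def antimono_def)
  have fin: "finite {i. lam i \<noteq> 0}" using assms by (simp add: is_partition_def)
  show ?thesis
  proof
    assume "lam i = 0"
    then have "j < i" if "lam j \<noteq> 0" for j using anti[of i j] that by (cases "i \<le> j") auto
    then have "{j. lam j \<noteq> 0} \<subseteq> {..<i}" by auto
    from card_mono[OF _ this] show "plength lam \<le> i" by (simp add: plength_def)
  next
    assume le: "plength lam \<le> i"
    show "lam i = 0"
    proof (rule ccontr)
      assume "lam i \<noteq> 0"
      then have "lam j \<noteq> 0" if "j \<le> i" for j using anti[OF that] by simp
      then have "{..i} \<subseteq> {j. lam j \<noteq> 0}" by auto
      from card_mono[OF fin this] le show False by (simp add: plength_def)
    qed
  qed
qed

lemma sum_partition:
  assumes "is_partition lam" "plength lam \<le> k"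
  shows "(\<Sum>i<k. lam i) = psize lam"
  unfolding psize_def
proof (rule sum.mono_neutral_right)
  show "{i. lam i \<noteq> 0} \<subseteq> {..<k}"
    using partition_eq_0_iff[OF assms(1)] assms(2) by (auto simp: not_le less_le_trans)
qed auto

text \<open>The sequence that represents a partition in an alternant; it is strictly decreasing.\<close>

definition beta :: "(nat \<Rightarrow> nat) \<Rightarrow> nat \<Rightarrow> int" where
  "beta lam i = int (lam i) - int i"

text \<open>The irreducible character of shape \<open>lam\<close>, defined by the Jacobi--Trudi determinant.\<close>

definition schur :: "nat \<Rightarrow> (nat \<Rightarrow> nat) \<Rightarrow> (nat \<Rightarrow> nat) \<Rightarrow> complex" where
  "schur n lam = alternant (plength lam) n (beta lam)"

lemma schur_alternant:
  assumes "is_partition lam" "plength lam \<le> k"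
  shows "schur n lam p = alternant k n (beta lam) p"
  unfolding schur_def
  using assms by (intro alternant_extend[symmetric]) (auto simp: beta_def partition_eq_0_iff)

lemma ip_commute: "ip n f g = ip n g f"
  by (simp add: ip_def mult.commute)

lemma ip_alternant_right:
  "ip n f (alternant k n y) = (\<Sum>w | w permutes {..<k}. of_int (sign w) * ip n f (perm_char n (shifted k y w)))"
proof -
  have "(\<Sum>p\<in>perms n. f p * alternant k n y p) =
      (\<Sum>p\<in>perms n. \<Sum>w | w permutes {..<k}. of_int (sign w) * (f p * perm_char n (shifted k y w) p))"
    by (simp add: alternant_def sum_distrib_left mult_ac)
  also have "\<dots> = (\<Sum>w | w permutes {..<k}. \<Sum>p\<in>perms n. of_int (sign w) * (f p * perm_char n (shifted k y w) p))"
    by (rule sum.swap)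
  finally show ?thesis by (simp add: ip_def sum_divide_distrib sum_distrib_left)
qed

lemma ip_cong:
  assumes "\<And>p. p permutes {1..n} \<Longrightarrow> f p = f' p" "\<And>p. p permutes {1..n} \<Longrightarrow> g p = g' p"
  shows "ip n f g = ip n f' g'"
  unfolding ip_def using assms by (intro arg_cong2[of _ _ _ _ "(/)"] sum.cong refl) auto

lemma sum_beta:
  assumes "partition_of n lam" "plength lam \<le> k"
  shows "(\<Sum>i<k. beta lam i + int i) = int n"
proof -
  have "(\<Sum>i<k. beta lam i + int i) = int (\<Sum>i<k. lam i)" by (simp add: beta_def)
  also have "(\<Sum>i<k. lam i) = n" using assms by (simp add: sum_partition partition_of_def)
  finally show ?thesis .
qed

lemma ip_schur_perm_char:
  fixes v :: "nat \<Rightarrow> int"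
  assumes lam: "partition_of n lam" "plength lam \<le> k" and v: "\<And>b. l \<le> b \<Longrightarrow> v b = 0"
  shows "ip n (schur n lam) (perm_char n v) = of_int (pieri k v l (beta lam))"
proof -
  have "ip n (schur n lam) (perm_char n v) = ip n (perm_char n v) (alternant k n (beta lam))"
    using lam by (subst ip_commute, intro ip_cong) (auto simp: schur_alternant partition_of_def)
  also have "\<dots> = (\<Sum>w | w permutes {..<k}. of_int (sign w) * of_nat (card (mats k l (shifted k (beta lam) w) v)))"
    unfolding ip_alternant_right
  proof (intro sum.cong refl)
    fix w assume "w \<in> {w. w permutes {..<k}}"
    then have "(\<Sum>i<k. shifted k (beta lam) w i) = int n"
      using sum_shifted[of w k] sum_beta[OF lam] by simp
    then show "of_int (sign w) * ip n (perm_char n v) (perm_char n (shifted k (beta lam) w)) =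
        of_int (sign w) * of_nat (card (mats k l (shifted k (beta lam) w) v))"
      using v by (subst ip_commute, subst ip_perm_char[of k _ l]) (auto simp: shifted_def)
  qed
  finally show ?thesis by (simp add: pieri_def)
qed

lemma beta_decreasing: "is_partition lam \<Longrightarrow> beta lam (Suc i) < beta lam i"
proof -
  assume "is_partition lam"
  then have "lam (Suc i) \<le> lam i" by (simp add: is_partition_def antimono_def)
  then show ?thesis by (simp add: beta_def)
qed

lemma ip_schur_dominance:
  fixes v :: "nat \<Rightarrow> int"
  assumes lam: "partition_of n lam" "plength lam \<le> k" and v: "\<And>b. l \<le> b \<Longrightarrow> v b = 0"
    and nz: "ip n (schur n lam) (perm_char n v) \<noteq> 0"
  shows "(\<Sum>i<k. min (int (lam i)) (int j)) \<le> (\<Sum>i<l. min (v i) (int j))"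
proof -
  have "pieri k v l (beta lam) \<noteq> 0" using nz ip_schur_perm_char[OF lam v] by auto
  then have "(\<Sum>i<k. min (beta lam i + int i) (int j)) \<le> (\<Sum>i<l. min (v i) (int j))"
  proof (rule pieri_dominance[rotated 2])
    show "beta lam (Suc i) < beta lam i" for i
      using lam by (simp add: beta_decreasing partition_of_def)
  qed (auto simp: beta_def)
  then show ?thesis by (simp add: beta_def)
qed

lemma ip_schur_diagonal:
  assumes lam: "partition_of n lam"
  shows "ip n (schur n lam) (perm_char n (\<lambda>i. int (lam i))) = 1"
proof -
  have P: "is_partition lam" using lam by (simp add: partition_of_def)
  let ?k = "plength lam"
  have "ip n (schur n lam) (perm_char n (\<lambda>i. int (lam i))) = of_int (pieri ?k (\<lambda>i. int (lam i)) ?k (beta lam))"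
    using lam P by (intro ip_schur_perm_char) (auto simp: partition_eq_0_iff)
  also have "pieri ?k (\<lambda>i. int (lam i)) ?k (beta lam) =
      pieri ?k (\<lambda>i. int (lam i)) ?k (\<lambda>i. (if i < ?k then int (lam i) else 0) - int i)"
    by (rule pieri_cong) (simp add: beta_def)
  also have "\<dots> = 1"
    using P by (intro pieri_diagonal) (auto simp: is_partition_def antimono_def)
  finally show ?thesis by simp
qed

text \<open>Sums of squares decrease along the dominance hypothesis but increase under a nontrivial permutation of the
  staircase. This makes the expansion of an alternant into permutation characters triangular.\<close>

lemma dominance_shifted:
  assumes lam: "partition_of n lam" "plength lam \<le> k" and mu: "partition_of n \<mu>" "plength \<mu> \<le> k"
    and w: "w permutes {..<k}" and pos: "\<And>i. 0 \<le> shifted k (beta \<mu>) w i"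
    and dom: "\<And>j. (\<Sum>i<k. min (int (lam i)) (int j)) \<le> (\<Sum>i<k. min (shifted k (beta \<mu>) w i) (int j))"
  shows "(\<Sum>i<k. (int (\<mu> i))\<^sup>2) \<le> (\<Sum>i<k. (int (lam i))\<^sup>2)"
    and "w \<noteq> id \<Longrightarrow> (\<Sum>i<k. (int (\<mu> i))\<^sup>2) < (\<Sum>i<k. (int (lam i))\<^sup>2)"
proof -
  have "(\<Sum>i<k. int (lam i)) = int n"
    using sum_beta[OF lam] by (simp add: beta_def)
  moreover have "(\<Sum>i<k. shifted k (beta \<mu>) w i) = int n"
    using sum_shifted[OF w] sum_beta[OF mu] by simp
  ultimately have le: "(\<Sum>i<k. (shifted k (beta \<mu>) w i)\<^sup>2) \<le> (\<Sum>i<k. (int (lam i))\<^sup>2)"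
    using pos dom by (intro sum_squares_antimono_dominance) auto
  have eq: "(\<Sum>i<k. (shifted k (beta \<mu>) w i)\<^sup>2) = (\<Sum>i<k. (int (\<mu> i) + int (w i) - int i)\<^sup>2)"
    by (intro sum.cong refl) (auto simp: shifted_def beta_def algebra_simps)
  have "antimono (\<lambda>i. int (\<mu> i))" using mu by (auto simp: partition_of_def is_partition_def antimono_def)
  then show strict: "(\<Sum>i<k. (int (\<mu> i))\<^sup>2) < (\<Sum>i<k. (int (lam i))\<^sup>2)" if "w \<noteq> id"
    using permuted_staircase_squares[OF _ w that, of "\<lambda>i. int (\<mu> i)"] le eq by simp
  show "(\<Sum>i<k. (int (\<mu> i))\<^sup>2) \<le> (\<Sum>i<k. (int (lam i))\<^sup>2)"
    using strict le eq by (cases "w = id") auto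
qed

lemma shifted_beta_id:
  assumes "is_partition lam" "plength lam \<le> k"
  shows "shifted k (beta lam) id = (\<lambda>i. int (lam i))"
  using assms by (auto simp: shifted_def beta_def fun_eq_iff partition_eq_0_iff)

text \<open>A functional that sees only contents dominated by \<open>lam\<close> picks out the diagonal term of the determinant:
  every other term has a content with a larger sum of squares than \<open>lam\<close>.\<close>

lemma triangular_functional:
  fixes E :: "((nat \<Rightarrow> nat) \<Rightarrow> complex) \<Rightarrow> complex"
  assumes lam: "partition_of n lam" "plength lam \<le> k"
    and dom: "\<And>v j. (\<And>b. k \<le> b \<Longrightarrow> v b = 0) \<Longrightarrow> E (perm_char n v) \<noteq> 0 \<Longrightarrow>
      (\<Sum>i<k. min (int (lam i)) (int j)) \<le> (\<Sum>i<k. min (v i) (int j))"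
    and E0: "E (\<lambda>_. 0) = 0"
  shows "(\<Sum>w | w permutes {..<k}. of_int (sign w) * E (perm_char n (shifted k (beta lam) w))) =
    E (perm_char n (\<lambda>i. int (lam i)))"
proof -
  have P: "is_partition lam" using lam by (simp add: partition_of_def)
  have "(\<Sum>w | w permutes {..<k}. of_int (sign w) * E (perm_char n (shifted k (beta lam) w))) =
      (\<Sum>w\<in>{id}. of_int (sign w) * E (perm_char n (shifted k (beta lam) w)))"
  proof (rule sum.mono_neutral_right)
    show "\<forall>w\<in>{w. w permutes {..<k}} - {id}. of_int (sign w) * E (perm_char n (shifted k (beta lam) w)) = 0"
    proof (rule ballI, rule ccontr)
      fix w assume w: "w \<in> {w. w permutes {..<k}} - {id}"
        and "of_int (sign w) * E (perm_char n (shifted k (beta lam) w)) \<noteq> 0"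
      then have nz: "E (perm_char n (shifted k (beta lam) w)) \<noteq> 0" by auto
      have pos: "0 \<le> shifted k (beta lam) w i" for i
      proof (rule ccontr)
        assume "\<not> 0 \<le> shifted k (beta lam) w i"
        then have "perm_char n (shifted k (beta lam) w) = (\<lambda>_. 0)"
          by (intro ext perm_char_neg[of _ i]) simp
        with nz E0 show False by simp
      qed
      have "(\<Sum>i<k. (int (lam i))\<^sup>2) < (\<Sum>i<k. (int (lam i))\<^sup>2)"
        using w by (intro dominance_shifted(2)[OF lam lam, of w] pos dom nz) (auto simp: shifted_def)
      then show False by simp
    qed
  qed (auto simp: finite_permutations permutes_id)
  then show ?thesis using shifted_beta_id[OF P lam(2)] by simp
qed

text \<open>If two Schur characters have a nonzero inner product, then each of the two shapes is dominated by the other.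
  On the diagonal only the leading permutation character contributes.\<close>

theorem ip_schur:
  assumes lam: "partition_of n lam" and mu: "partition_of n \<mu>"
  shows "ip n (schur n lam) (schur n \<mu>) = (if lam = \<mu> then 1 else 0)"
proof -
  define k where "k = max (plength lam) (plength \<mu>)"
  have k: "plength lam \<le> k" "plength \<mu> \<le> k" by (auto simp: k_def)
  have P: "is_partition lam" "is_partition \<mu>" using lam mu by (auto simp: partition_of_def)
  have expand: "ip n f (schur n \<mu>) =
      (\<Sum>w | w permutes {..<k}. of_int (sign w) * ip n f (perm_char n (shifted k (beta \<mu>) w)))"
    if "is_partition \<mu>" "plength \<mu> \<le> k" for f \<mu>
    using that ip_alternant_right[of n f k "beta \<mu>"] ip_cong[of n f f "schur n \<mu>" "alternant k n (beta \<mu>)"]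
    by (simp add: schur_alternant)
  show ?thesis
  proof (cases "lam = \<mu>")
    case True
    have "(\<Sum>w | w permutes {..<k}. of_int (sign w) * ip n (schur n lam) (perm_char n (shifted k (beta lam) w))) =
        ip n (schur n lam) (perm_char n (\<lambda>i. int (lam i)))"
      by (rule triangular_functional[OF lam k(1)])
        (rule ip_schur_dominance[OF lam k(1)], auto simp: ip_def)
    then show ?thesis using True expand[OF P(1) k(1)] ip_schur_diagonal[OF lam] by simp
  next
    case False
    have key: "(\<Sum>i<k. (int (\<mu> i))\<^sup>2) \<le> (\<Sum>i<k. (int (lam i))\<^sup>2) \<and>
        ((\<Sum>i<k. (int (\<mu> i))\<^sup>2) = (\<Sum>i<k. (int (lam i))\<^sup>2) \<longrightarrow>
          (\<forall>j. (\<Sum>i<k. min (int (lam i)) (int j)) \<le> (\<Sum>i<k. min (int (\<mu> i)) (int j))))"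
      if lam: "partition_of n lam" "plength lam \<le> k" and mu: "partition_of n \<mu>" "plength \<mu> \<le> k"
        and nz: "ip n (schur n lam) (schur n \<mu>) \<noteq> 0" for lam \<mu>
    proof -
      have Pmu: "is_partition \<mu>" using mu by (simp add: partition_of_def)
      obtain w where w: "w permutes {..<k}"
        and nz': "ip n (schur n lam) (perm_char n (shifted k (beta \<mu>) w)) \<noteq> 0"
        using nz unfolding expand[OF Pmu mu(2)] by (force elim: sum.not_neutral_contains_not_neutral)
      have pos: "0 \<le> shifted k (beta \<mu>) w i" for i
      proof (rule ccontr)
        assume "\<not> 0 \<le> shifted k (beta \<mu>) w i"
        then have "perm_char n (shifted k (beta \<mu>) w) = (\<lambda>_. 0)"
          by (intro ext perm_char_neg[of _ i]) simp
        with nz' show False by (simp add: ip_def)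
      qed
      have dom: "(\<Sum>i<k. min (int (lam i)) (int j)) \<le> (\<Sum>i<k. min (shifted k (beta \<mu>) w i) (int j))" for j
        by (rule ip_schur_dominance[OF lam _ nz']) (simp add: shifted_def)
      note q = dominance_shifted[OF lam mu w pos dom]
      show ?thesis using q dom shifted_beta_id[OF Pmu mu(2)] by (cases "w = id") auto
    qed
    show ?thesis
    proof (rule ccontr)
      assume "\<not> ?thesis"
      with False have nz: "ip n (schur n lam) (schur n \<mu>) \<noteq> 0" by simp
      then have nz': "ip n (schur n \<mu>) (schur n lam) \<noteq> 0" by (simp add: ip_commute)
      note k1 = key[OF lam k(1) mu k(2) nz] and k2 = key[OF mu k(2) lam k(1) nz']
      from k1 k2 have eq: "(\<Sum>i<k. min (int (lam i)) (int j)) = (\<Sum>i<k. min (int (\<mu> i)) (int j))" for j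
        by (meson order_antisym)
      have "int (lam i) = int (\<mu> i)" if "i < k" for i
      proof (rule decreasing_eqI_trunc_sums[of k "\<lambda>i. int (lam i)" "\<lambda>i. int (\<mu> i)"])
        show "int (lam j) \<le> int (lam i)" "int (\<mu> j) \<le> int (\<mu> i)" if "i \<le> j" for i j
          using P that by (auto simp: is_partition_def dest: antimonoD)
      qed (use that eq in auto)
      moreover have "lam i = 0" "\<mu> i = 0" if "\<not> i < k" for i
        using that k by (simp_all add: partition_eq_0_iff[OF P(1)] partition_eq_0_iff[OF P(2)])
      ultimately have "lam i = \<mu> i" for i by (cases "i < k") auto
      then have "lam = \<mu>" by blast
      with False show False by simp
    qed
  qed
qed

section \<open>The Young tableau\<close>

text \<open>Rewrite rules that normalize compositions of permutations, associated to the right.\<close>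

lemma perm_calculus:
  fixes n :: nat and y :: "'b \<Rightarrow> nat" and z :: "nat \<Rightarrow> 'c"
  shows "x permutes {1..n} \<Longrightarrow> inv' x \<circ> (x \<circ> y) = y"
    and "x permutes {1..n} \<Longrightarrow> x \<circ> (inv' x \<circ> y) = y"
    and "x permutes {1..n} \<Longrightarrow> inv' x \<circ> x = id"
    and "x permutes {1..n} \<Longrightarrow> x \<circ> inv' x = id"
    and "x permutes {1..n} \<Longrightarrow> inv' (inv' x) = x"
    and "x permutes {1..n} \<Longrightarrow> x' permutes {1..n} \<Longrightarrow> inv' (x \<circ> x') = inv' x' \<circ> inv' x"
    and "x permutes {1..n} \<Longrightarrow> inv' x permutes {1..n}"
    and "x permutes {1..n} \<Longrightarrow> x' permutes {1..n} \<Longrightarrow> x \<circ> x' permutes {1..n}"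
    and "z \<circ> x \<circ> y = z \<circ> (x \<circ> y)"
  by (simp_all add: permutes_inv_o permutes_inv_inv permutes_inv permutes_compose comp_assoc
      o_inv_distrib permutes_bij flip: comp_assoc[of "inv' x"] comp_assoc[of x])

lemma carrier_perms: "carrier (sym_group n) = perms n"
  by (auto simp: sym_group_carrier)

lemma sum_perms_inv: "(\<Sum>p\<in>perms n. f (inv' p)) = (\<Sum>p\<in>perms n. f p)"
  by (rule sum_permutations_inverse[symmetric])

lemma sum_perms_left: "q permutes {1..n} \<Longrightarrow> (\<Sum>p\<in>perms n. f (q \<circ> p)) = (\<Sum>p\<in>perms n. f p)"
  by (rule setum_permutations_compose_left[symmetric])

lemma sum_perms_right: "q permutes {1..n} \<Longrightarrow> (\<Sum>p\<in>perms n. f (p \<circ> q)) = (\<Sum>p\<in>perms n. f p)"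
  by (rule sum_permutations_compose_right[symmetric])

lemma permutation_perms: "p permutes {1..n :: nat} \<Longrightarrow> permutation p"
  by (rule permutation_permutes[THEN iffD2]) auto

locale young_tableau =
  fixes n :: nat and lam :: "nat \<Rightarrow> nat"
  assumes partition: "partition_of n lam"
begin

lemma psize: "psize lam = n" and is_partition: "is_partition lam"
  using partition by (auto simp: partition_of_def)

lemma sum_le_n: "(\<Sum>j\<le>i. lam j) \<le> n"
proof -
  have "(\<Sum>j\<le>i. lam j) \<le> (\<Sum>j<Suc (max i (plength lam)). lam j)"
    by (intro sum_mono2) auto
  also have "\<dots> = n" by (rule sum_partition[OF is_partition, unfolded psize]) simp
  finally show ?thesis .
qed

lemma tab_row_bounds:
  assumes "k \<in> {1..n}"
  shows "(\<Sum>j<tab_row lam k. lam j) < k" "k \<le> (\<Sum>j\<le>tab_row lam k. lam j)"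
proof -
  have "k \<le> (\<Sum>j\<le>plength lam. lam j)"
    using assms sum_partition[OF is_partition, of "Suc (plength lam)"]
    by (simp add: psize lessThan_Suc_atMost)
  then show "k \<le> (\<Sum>j\<le>tab_row lam k. lam j)" unfolding tab_row_def by (rule LeastI)
  show "(\<Sum>j<tab_row lam k. lam j) < k"
  proof (cases "tab_row lam k")
    case 0
    then show ?thesis using assms by simp
  next
    case (Suc i)
    then have "i < tab_row lam k" by simp
    then have "\<not> k \<le> (\<Sum>j\<le>i. lam j)" unfolding tab_row_def by (rule not_less_Least)
    then show ?thesis by (simp add: Suc lessThan_Suc_atMost)
  qed
qed

lemma tab_col_bounds:
  assumes "k \<in> {1..n}"
  shows "1 \<le> tab_col lam k" "tab_col lam k \<le> lam (tab_row lam k)"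
  using tab_row_bounds[OF assms] by (auto simp: tab_col_def lessThan_Suc_atMost[symmetric])

lemma tab_entry: "k \<in> {1..n} \<Longrightarrow> k = (\<Sum>j<tab_row lam k. lam j) + tab_col lam k"
  using tab_row_bounds[of k] by (simp add: tab_col_def)

lemma tab_inj:
  "k \<in> {1..n} \<Longrightarrow> k' \<in> {1..n} \<Longrightarrow> tab_row lam k = tab_row lam k' \<Longrightarrow> tab_col lam k = tab_col lam k' \<Longrightarrow> k = k'"
  using tab_entry[of k] tab_entry[of k'] by simp

lemma tab_surj:
  assumes "1 \<le> c" "c \<le> lam i"
  obtains k where "k \<in> {1..n}" "tab_row lam k = i" "tab_col lam k = c"
proof -
  define k where "k = (\<Sum>j<i. lam j) + c"
  have "k \<le> (\<Sum>j\<le>i. lam j)" using assms by (simp add: k_def lessThan_Suc_atMost[symmetric])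
  moreover from this have "k \<in> {1..n}" using sum_le_n[of i] assms by (simp add: k_def)
  moreover have "i \<le> i'" if "k \<le> (\<Sum>j\<le>i'. lam j)" for i'
  proof (rule ccontr)
    assume "\<not> i \<le> i'"
    then have "(\<Sum>j\<le>i'. lam j) \<le> (\<Sum>j<i. lam j)" by (intro sum_mono2) auto
    with that assms show False by (simp add: k_def)
  qed
  ultimately have "k \<in> {1..n}" "tab_row lam k = i" unfolding tab_row_def by (auto intro!: Least_equality)
  then show thesis using that tab_entry[of k] by (simp add: k_def)
qed

lemma card_tab_row_col: "card {k \<in> {1..n}. tab_row lam k = i \<and> tab_col lam k \<le> j} = min (lam i) j"
proof -
  have "bij_betw (tab_col lam) {k \<in> {1..n}. tab_row lam k = i \<and> tab_col lam k \<le> j} {1..min (lam i) j}"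
    unfolding bij_betw_def
  proof
    show "inj_on (tab_col lam) {k \<in> {1..n}. tab_row lam k = i \<and> tab_col lam k \<le> j}"
    proof (rule inj_onI)
      fix k k' assume "k \<in> {k \<in> {1..n}. tab_row lam k = i \<and> tab_col lam k \<le> j}"
        "k' \<in> {k \<in> {1..n}. tab_row lam k = i \<and> tab_col lam k \<le> j}" "tab_col lam k = tab_col lam k'"
      then show "k = k'" by (auto intro: tab_inj[of k k'])
    qed
    show "tab_col lam ` {k \<in> {1..n}. tab_row lam k = i \<and> tab_col lam k \<le> j} = {1..min (lam i) j}"
    proof (intro equalityI subsetI)
      fix c assume "c \<in> {1..min (lam i) j}"
      then have c: "1 \<le> c" "c \<le> lam i" "c \<le> j" by auto
      obtain k where "k \<in> {1..n}" "tab_row lam k = i" "tab_col lam k = c"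
        by (rule tab_surj[OF c(1,2)])
      with c(3) show "c \<in> tab_col lam ` {k \<in> {1..n}. tab_row lam k = i \<and> tab_col lam k \<le> j}"
        by blast
    next
      fix c assume "c \<in> tab_col lam ` {k \<in> {1..n}. tab_row lam k = i \<and> tab_col lam k \<le> j}"
      then obtain k where "k \<in> {1..n}" "tab_row lam k = i" "tab_col lam k \<le> j" "c = tab_col lam k" by blast
      then show "c \<in> {1..min (lam i) j}" using tab_col_bounds[of k] by simp
    qed
  qed
  from bij_betw_same_card[OF this] show ?thesis by simp
qed

lemma card_tab_row: "card {k \<in> {1..n}. tab_row lam k = i} = lam i"
proof -
  have "{k \<in> {1..n}. tab_row lam k = i} = {k \<in> {1..n}. tab_row lam k = i \<and> tab_col lam k \<le> lam i}"
    using tab_col_bounds by blast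
  then show ?thesis using card_tab_row_col[of i "lam i"] by simp
qed

lemma tab_row_coloring: "restrict (tab_row lam) {1..n} \<in> colorings n (\<lambda>i. int (lam i))"
  using card_tab_row by (simp add: colorings_def cong: conj_cong)

lemma card_color_col:
  assumes f: "f \<in> colorings n v" and inj: "inj_on (\<lambda>k. (f k, tab_col lam k)) {1..n}"
  shows "int (card {k \<in> {1..n}. f k = i \<and> tab_col lam k \<le> j}) \<le> min (v i) (int j)"
proof -
  have "card {k \<in> {1..n}. f k = i \<and> tab_col lam k \<le> j} \<le> card {k \<in> {1..n}. f k = i}"
    by (intro card_mono) auto
  moreover have "card {k \<in> {1..n}. f k = i \<and> tab_col lam k \<le> j} \<le> card {1..j}"
  proof (rule card_inj_on_le)
    show "inj_on (tab_col lam) {k \<in> {1..n}. f k = i \<and> tab_col lam k \<le> j}"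
    proof (rule inj_onI)
      fix k k' assume "k \<in> {k \<in> {1..n}. f k = i \<and> tab_col lam k \<le> j}"
        "k' \<in> {k \<in> {1..n}. f k = i \<and> tab_col lam k \<le> j}" "tab_col lam k = tab_col lam k'"
      then show "k = k'" by (intro inj_onD[OF inj]) auto
    qed
    show "tab_col lam ` {k \<in> {1..n}. f k = i \<and> tab_col lam k \<le> j} \<subseteq> {1..j}"
      using tab_col_bounds(1) by (simp add: image_subset_iff)
  qed simp
  ultimately show ?thesis using coloring_content[OF f, of i] by simp
qed

lemma card_col_by_color:
  fixes f :: "nat \<Rightarrow> nat"
  assumes "\<And>k. k \<in> {1..n} \<Longrightarrow> f k < K"
  shows "card {k \<in> {1..n}. tab_col lam k \<le> j} = (\<Sum>i<K. card {k \<in> {1..n}. f k = i \<and> tab_col lam k \<le> j})"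
proof -
  have "{k \<in> {1..n}. tab_col lam k \<le> j} = (\<Union>i<K. {k \<in> {1..n}. f k = i \<and> tab_col lam k \<le> j})"
    using assms by auto
  then show ?thesis by (simp only:) (rule card_UN_disjoint; auto)
qed

lemma tab_row_less: "k \<in> {1..n} \<Longrightarrow> plength lam \<le> K \<Longrightarrow> tab_row lam k < K"
  using tab_col_bounds[of k] partition_eq_0_iff[OF is_partition, of "tab_row lam k"] by (cases "plength lam \<le> tab_row lam k") auto

lemma trunc_sum_cols:
  assumes "plength lam \<le> K"
  shows "(\<Sum>i<K. min (int (lam i)) (int j)) = int (card {k \<in> {1..n}. tab_col lam k \<le> j})"
  using card_col_by_color[of "tab_row lam" K j] tab_row_less[OF _ assms] card_tab_row_col
  by (simp add: of_nat_min)

text \<open>If equal colors never share a column, then a color occurs at most \<open>min (v i) j\<close> times in the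
  first \<open>j\<close> columns.\<close>

lemma column_injective_dominance:
  assumes f: "f \<in> colorings n v" and inj: "inj_on (\<lambda>k. (f k, tab_col lam k)) {1..n}"
    and K: "plength lam \<le> K" "\<And>b. K \<le> b \<Longrightarrow> v b = 0"
  shows "(\<Sum>i<K. min (int (lam i)) (int j)) \<le> (\<Sum>i<K. min (v i) (int j))"
proof -
  have fK: "f k < K" if "k \<in> {1..n}" for k
    using coloring_color_nonzero[OF f that] K(2) by (meson not_less)
  have cols: "card {k \<in> {1..n}. tab_col lam k \<le> j} =
      (\<Sum>i<K. card {k \<in> {1..n}. f k = i \<and> tab_col lam k \<le> j})"
    by (rule card_col_by_color) (rule fK)
  show ?thesis
    unfolding trunc_sum_cols[OF K(1)] cols of_nat_sum
    by (intro sum_mono card_color_col[OF f inj])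
qed

text \<open>In the extreme case all bounds are attained: color \<open>i\<close> occupies the columns \<open>1, \<dots>, lam i\<close>, once each. Hence
  color and column determine an entry of the tableau, and moving each element to that entry is a column permutation.\<close>

lemma column_injective_row_translate:
  assumes f: "f \<in> colorings n (\<lambda>i. int (lam i))" and inj: "inj_on (\<lambda>k. (f k, tab_col lam k)) {1..n}"
  obtains s where "s permutes {1..n}" "\<And>k. k \<in> {1..n} \<Longrightarrow> tab_col lam (s k) = tab_col lam k"
    "\<And>k. k \<in> {1..n} \<Longrightarrow> tab_row lam (s k) = f k"
proof -
  have fK: "f k < plength lam" if "k \<in> {1..n}" for k
    using coloring_color_nonzero[OF f that] partition_eq_0_iff[OF is_partition, of "f k"] by simp
  have eq: "int (card {k \<in> {1..n}. f k = i \<and> tab_col lam k \<le> j}) = min (int (lam i)) (int j)"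
    if i: "i < plength lam" for i j
  proof -
    have "card {k \<in> {1..n}. tab_col lam k \<le> j} =
        (\<Sum>i<plength lam. card {k \<in> {1..n}. f k = i \<and> tab_col lam k \<le> j})"
      by (rule card_col_by_color) (rule fK)
    then have "(\<Sum>i<plength lam. int (card {k \<in> {1..n}. f k = i \<and> tab_col lam k \<le> j})) =
        (\<Sum>i<plength lam. min (int (lam i)) (int j))"
      unfolding trunc_sum_cols[OF order_refl] by (simp only: of_nat_sum)
    moreover have "int (card {k \<in> {1..n}. f k = i \<and> tab_col lam k \<le> j}) \<le> min (int (lam i)) (int j)" for i
      by (rule card_color_col[OF f inj])
    ultimately show ?thesis
      using i by (intro sum_mono_inv[of "\<lambda>i. int (card {k \<in> {1..n}. f k = i \<and> tab_col lam k \<le> j})"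
        "{..<plength lam}" "\<lambda>i. min (int (lam i)) (int j)"]) auto
  qed
  have col_le: "tab_col lam k \<le> lam (f k)" if k: "k \<in> {1..n}" for k
  proof -
    have "card {k' \<in> {1..n}. f k' = f k \<and> tab_col lam k' \<le> lam (f k)} = card {k' \<in> {1..n}. f k' = f k}"
      using eq[OF fK[OF k], of "lam (f k)"] coloring_content[OF f, of "f k"] by simp
    moreover have "{k' \<in> {1..n}. f k' = f k \<and> tab_col lam k' \<le> lam (f k)} \<subseteq> {k' \<in> {1..n}. f k' = f k}" by blast
    ultimately have "{k' \<in> {1..n}. f k' = f k \<and> tab_col lam k' \<le> lam (f k)} = {k' \<in> {1..n}. f k' = f k}"
      by (intro card_subset_eq) auto
    with k show ?thesis by blast
  qed
  have "\<exists>k'. k' \<in> {1..n} \<and> tab_row lam k' = f k \<and> tab_col lam k' = tab_col lam k" if "k \<in> {1..n}" for k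
    using tab_surj[OF tab_col_bounds(1)[OF that] col_le[OF that]] by metis
  then obtain t where t: "\<And>k. k \<in> {1..n} \<Longrightarrow> t k \<in> {1..n} \<and> tab_row lam (t k) = f k \<and> tab_col lam (t k) = tab_col lam k"
    by metis
  define s where "s k = (if k \<in> {1..n} then t k else k)" for k
  have "inj_on s {1..n}"
  proof (rule inj_onI)
    fix k k' assume k: "k \<in> {1..n}" "k' \<in> {1..n}" "s k = s k'"
    then have "t k = t k'" by (simp add: s_def)
    then have "(f k, tab_col lam k) = (f k', tab_col lam k')" using t[OF k(1)] t[OF k(2)] by metis
    then show "k = k'" using inj k unfolding inj_on_def by blast
  qed
  moreover have "s ` {1..n} \<subseteq> {1..n}" using t by (auto simp: s_def)
  ultimately have "bij_betw s {1..n} {1..n}"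
    by (simp add: bij_betw_def endo_inj_surj)
  then have "s permutes {1..n}"
    by (rule bij_imp_permutes) (auto simp: s_def)
  then show thesis by (rule that) (use t in \<open>simp_all add: s_def\<close>)
qed

end

section \<open>The Young symmetrizer\<close>

context young_tableau
begin

lemmas pc = perm_calculus(1-8)[where n = n] comp_assoc

abbreviation R where "R \<equiv> row_group lam"
abbreviation C where "C \<equiv> col_group lam"
abbreviation ysym where "ysym \<equiv> young_symmetrizer lam"

definition csign :: "(nat \<Rightarrow> nat) \<Rightarrow> complex" where
  "csign z = (if z \<in> C then of_int (sign z) else 0)"

lemma R_iff: "p \<in> R \<longleftrightarrow> p permutes {1..n} \<and> (\<forall>k\<in>{1..n}. tab_row lam (p k) = tab_row lam k)"
  by (simp add: row_group_def psize sym_group_carrier)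

lemma C_iff: "p \<in> C \<longleftrightarrow> p permutes {1..n} \<and> (\<forall>k\<in>{1..n}. tab_col lam (p k) = tab_col lam k)"
  by (simp add: col_group_def psize sym_group_carrier)

lemma R_perm: "p \<in> R \<Longrightarrow> p permutes {1..n}" and C_perm: "p \<in> C \<Longrightarrow> p permutes {1..n}"
  by (simp_all add: R_iff C_iff)

lemma finite_R [simp]: "finite R" and finite_C [simp]: "finite C"
  by (rule finite_subset[OF _ finite_perms[of n]]; auto simp: R_iff C_iff)+

lemma R_id: "id \<in> R" and C_id: "id \<in> C"
  by (simp_all add: R_iff C_iff permutes_id)

lemma R_comp: "p \<in> R \<Longrightarrow> q \<in> R \<Longrightarrow> p \<circ> q \<in> R"
  using permutes_in_image[of q "{1..n}"] by (auto simp: R_iff pc)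

lemma C_comp: "p \<in> C \<Longrightarrow> q \<in> C \<Longrightarrow> p \<circ> q \<in> C"
  using permutes_in_image[of q "{1..n}"] by (auto simp: C_iff pc)

lemma R_inv: assumes "p \<in> R" shows "inv' p \<in> R"
proof -
  have p: "p permutes {1..n}" using assms by (rule R_perm)
  have "tab_row lam (inv' p k) = tab_row lam k" if "k \<in> {1..n}" for k
  proof -
    have "inv' p k \<in> {1..n}" using that permutes_in_image[OF permutes_inv[OF p]] by blast
    then have "tab_row lam (p (inv' p k)) = tab_row lam (inv' p k)" using assms by (simp add: R_iff)
    then show ?thesis by (simp add: permutes_inverses[OF p])
  qed
  then show ?thesis using p by (simp add: R_iff permutes_inv)
qed

lemma C_inv: assumes "p \<in> C" shows "inv' p \<in> C"
proof -
  have p: "p permutes {1..n}" using assms by (rule C_perm)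
  have "tab_col lam (inv' p k) = tab_col lam k" if "k \<in> {1..n}" for k
  proof -
    have "inv' p k \<in> {1..n}" using that permutes_in_image[OF permutes_inv[OF p]] by blast
    then have "tab_col lam (p (inv' p k)) = tab_col lam (inv' p k)" using assms by (simp add: C_iff)
    then show ?thesis by (simp add: permutes_inverses[OF p])
  qed
  then show ?thesis using p by (simp add: C_iff permutes_inv)
qed

lemma sign_perms_comp: "p permutes {1..n} \<Longrightarrow> q permutes {1..n} \<Longrightarrow> sign (p \<circ> q) = sign p * sign q"
  by (simp add: sign_compose permutation_perms)

lemma csign_right:
  assumes q: "q \<in> C" and z: "z permutes {1..n}"
  shows "csign (z \<circ> q) = of_int (sign q) * csign z"
proof -
  have "z \<circ> q \<in> C \<longleftrightarrow> z \<in> C"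
  proof
    assume "z \<circ> q \<in> C"
    from C_comp[OF this C_inv[OF q]] show "z \<in> C" using C_perm[OF q] by (simp add: pc)
  qed (use q in \<open>simp add: C_comp\<close>)
  then show ?thesis using sign_perms_comp[OF z C_perm[OF q]] by (simp add: csign_def)
qed

lemma csign_inv:
  assumes z: "z permutes {1..n}"
  shows "csign (inv' z) = csign z"
proof -
  have "inv' z \<in> C \<longleftrightarrow> z \<in> C"
    using C_inv[of z] C_inv[of "inv' z"] z by (auto simp: pc)
  then show ?thesis using sign_inverse[OF permutation_perms[OF z]] by (simp add: csign_def)
qed

lemma ysym_eq: "ysym x = (\<Sum>r\<in>R. csign (inv' r \<circ> x))"
proof -
  have "ysym x = (\<Sum>r\<in>perms n. if r \<in> R then csign (inv' r \<circ> x) else 0)"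
    unfolding young_symmetrizer_def conv_def carrier_perms psize csign_def
    by (intro sum.cong refl) simp
  also have "\<dots> = (\<Sum>r\<in>R. csign (inv' r \<circ> x))"
    unfolding sum.inter_filter[OF finite_perms, symmetric]
    by (rule sum.cong) (auto simp: R_iff)
  finally show ?thesis .
qed

lemma ysym_left:
  assumes r: "r \<in> R"
  shows "ysym (r \<circ> x) = ysym x"
  unfolding ysym_eq
proof (rule sum.reindex_bij_witness[of _ "\<lambda>s. r \<circ> s" "\<lambda>s. inv' r \<circ> s"])
  fix s assume s: "s \<in> R"
  show "r \<circ> (inv' r \<circ> s) = s" "inv' r \<circ> (r \<circ> s) = s" using R_perm[OF r] by (simp_all add: pc)
  show "inv' r \<circ> s \<in> R" "r \<circ> s \<in> R" using r s by (simp_all add: R_comp R_inv)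
  have "inv' (inv' r \<circ> s) = inv' s \<circ> r" using R_perm[OF r] R_perm[OF s] by (simp add: pc)
  then show "csign (inv' (inv' r \<circ> s) \<circ> x) = csign (inv' s \<circ> (r \<circ> x))"
    by (simp add: comp_assoc)
qed

lemma ysym_right:
  assumes q: "q \<in> C" and x: "x permutes {1..n}"
  shows "ysym (x \<circ> q) = of_int (sign q) * ysym x"
  unfolding ysym_eq sum_distrib_left
proof (rule sum.cong[OF refl])
  fix r assume r: "r \<in> R"
  have "inv' r \<circ> x permutes {1..n}" using R_perm[OF r] x by (simp add: pc)
  from csign_right[OF q this] show "csign (inv' r \<circ> (x \<circ> q)) = of_int (sign q) * csign (inv' r \<circ> x)"
    by (simp add: comp_assoc)
qed

lemma R_Int_C:
  assumes "r \<in> R" "r \<in> C"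
  shows "r = id"
proof
  fix k show "r k = id k"
  proof (cases "k \<in> {1..n}")
    case True
    have "r k \<in> {1..n}" using permutes_in_image[OF R_perm[OF assms(1)]] True by blast
    then show ?thesis using tab_inj[OF _ True] True assms by (simp add: R_iff C_iff)
  next
    case False
    then show ?thesis using permutes_not_in[OF R_perm[OF assms(1)]] by simp
  qed
qed

lemma ysym_id: "ysym id = 1"
proof -
  have "ysym id = (\<Sum>r\<in>R. if r = id then 1 else 0)"
    unfolding ysym_eq
  proof (rule sum.cong[OF refl])
    fix r assume r: "r \<in> R"
    have "csign (inv' r) = (if r = id then 1 else 0)"
      using csign_inv[OF R_perm[OF r]] R_Int_C[OF r] C_id by (simp add: csign_def)
    then show "csign (inv' r \<circ> id) = (if r = id then 1 else 0)" by simp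
  qed
  then show ?thesis using R_id by simp
qed

lemma ysym_outside:
  assumes "\<not> x permutes {1..n}"
  shows "ysym x = 0"
proof -
  have "csign (inv' r \<circ> x) = 0" if r: "r \<in> R" for r
  proof -
    have "inv' r \<circ> x \<notin> C"
    proof
      assume "inv' r \<circ> x \<in> C"
      then have "r \<circ> (inv' r \<circ> x) permutes {1..n}"
        using R_perm[OF r] C_perm[of "inv' r \<circ> x"] permutes_compose by blast
      with assms show False using R_perm[OF r] by (simp add: pc)
    qed
    then show ?thesis by (simp add: csign_def)
  qed
  then show ?thesis by (simp add: ysym_eq)
qed

lemma ysym_real: "cnj (ysym x) = ysym x"
proof -
  have "cnj (csign z) = csign z" for z by (simp add: csign_def)
  then show ?thesis by (simp add: ysym_eq)
qed

text \<open>The Young symmetrizer is the product of the sum over the row group with the signed sum over the column group.\<close>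

lemma sum_ysym:
  "(\<Sum>x\<in>perms n. ysym x * g x) = (\<Sum>r\<in>R. \<Sum>q\<in>C. of_int (sign q) * g (r \<circ> q))"
proof -
  have "(\<Sum>x\<in>perms n. ysym x * g x) = (\<Sum>r\<in>R. \<Sum>x\<in>perms n. csign (inv' r \<circ> x) * g x)"
    unfolding ysym_eq sum_distrib_right by (rule sum.swap)
  also have "\<dots> = (\<Sum>r\<in>R. \<Sum>q\<in>C. of_int (sign q) * g (r \<circ> q))"
  proof (rule sum.cong[OF refl])
    fix r assume r: "r \<in> R"
    have "(\<Sum>x\<in>perms n. csign (inv' r \<circ> x) * g x) = (\<Sum>x\<in>perms n. csign (inv' r \<circ> (r \<circ> x)) * g (r \<circ> x))"
      by (rule sum_perms_left[OF R_perm[OF r], symmetric])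
    also have "\<dots> = (\<Sum>x\<in>perms n. if x \<in> C then of_int (sign x) * g (r \<circ> x) else 0)"
      using R_perm[OF r] by (intro sum.cong refl) (simp add: pc csign_def)
    also have "\<dots> = (\<Sum>q\<in>C. of_int (sign q) * g (r \<circ> q))"
      unfolding sum.inter_filter[OF finite_perms, symmetric]
      by (rule sum.cong) (auto simp: C_iff)
    finally show "(\<Sum>x\<in>perms n. csign (inv' r \<circ> x) * g x) = (\<Sum>q\<in>C. of_int (sign q) * g (r \<circ> q))" .
  qed
  finally show ?thesis .
qed

lemma transpose_C:
  assumes "k \<in> {1..n}" "k' \<in> {1..n}" "tab_col lam k = tab_col lam k'"
  shows "transpose k k' \<in> C"
  using assms permutes_swap_id[of k "{1..n}" k'] by (auto simp: C_iff transpose_def)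

text \<open>The coloring \<open>k \<mapsto> tab_row lam (x k)\<close> has content \<open>lam\<close>. If it separates the elements of each column, then it
  is the coloring by rows composed with a column permutation.\<close>

lemma row_column_factorization:
  assumes x: "x permutes {1..n}" and inj: "inj_on (\<lambda>k. (tab_row lam (x k), tab_col lam k)) {1..n}"
  obtains r q where "r \<in> R" "q \<in> C" "x = r \<circ> q"
proof -
  define f where "f = restrict (tab_row lam) {1..n} \<circ> x"
  have fk: "f k = tab_row lam (x k)" if "k \<in> {1..n}" for k
    using permutes_in_image[OF x] that by (simp add: f_def)
  have "f \<in> colorings n (\<lambda>i. int (lam i))"
    unfolding f_def by (rule colorings_permute[OF tab_row_coloring x])
  moreover have "inj_on (\<lambda>k. (f k, tab_col lam k)) {1..n}"
    using inj inj_on_cong[of "{1..n}" "\<lambda>k. (f k, tab_col lam k)" "\<lambda>k. (tab_row lam (x k), tab_col lam k)"]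
    by (simp only: fk)
  ultimately obtain s where s: "s permutes {1..n}" "\<And>k. k \<in> {1..n} \<Longrightarrow> tab_col lam (s k) = tab_col lam k"
    "\<And>k. k \<in> {1..n} \<Longrightarrow> tab_row lam (s k) = f k"
    using column_injective_row_translate by blast
  have "x \<circ> inv' s \<in> R"
  proof -
    have "tab_row lam (x (inv' s k)) = tab_row lam k" if k: "k \<in> {1..n}" for k
    proof -
      have k': "inv' s k \<in> {1..n}" using permutes_in_image[OF permutes_inv[OF s(1)]] k by blast
      then show ?thesis using s(3)[OF k'] fk[OF k'] by (simp add: permutes_inverses[OF s(1)])
    qed
    then show ?thesis using x s(1) by (simp add: R_iff pc)
  qed
  moreover have "s \<in> C" using s by (simp add: C_iff)
  moreover have "x = x \<circ> inv' s \<circ> s" using s(1) by (simp add: pc)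
  ultimately show thesis using that by blast
qed

text \<open>If \<open>x\<close> is not a product of a row and a column permutation, then two elements of one column are taken by \<open>x\<close> into
  one row. The transposition \<open>t\<close> of these elements is a column permutation and its conjugate by \<open>x\<close> is a row permutation, which
  forces \<open>G x = - G x\<close>. So \<open>G\<close> is determined by its value at the identity.\<close>

lemma sandwich:
  assumes G: "\<And>r q x. r \<in> R \<Longrightarrow> q \<in> C \<Longrightarrow> x permutes {1..n} \<Longrightarrow> G (r \<circ> x \<circ> q) = of_int (sign q) * G x"
    and x: "x permutes {1..n}"
  shows "G x = G id * ysym x"
proof (cases "inj_on (\<lambda>k. (tab_row lam (x k), tab_col lam k)) {1..n}")
  case True
  then obtain r q where rq: "r \<in> R" "q \<in> C" "x = r \<circ> q" using row_column_factorization x by blast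
  have "ysym x = of_int (sign q)"
    using ysym_left[OF rq(1), of "id \<circ> q"] ysym_right[OF rq(2), of id] rq(3) by (simp add: permutes_id ysym_id)
  moreover have "G x = of_int (sign q) * G id"
    using G[OF rq(1,2), of id] rq(3) by (simp add: permutes_id)
  ultimately show ?thesis by simp
next
  case False
  then obtain k k' where k: "k \<in> {1..n}" "k' \<in> {1..n}" "k \<noteq> k'"
    "tab_row lam (x k) = tab_row lam (x k')" "tab_col lam k = tab_col lam k'"
    by (auto simp: inj_on_def)
  define t where "t = transpose k k'"
  have t: "t \<in> C" unfolding t_def using k by (intro transpose_C) auto
  have "x \<circ> t \<circ> inv' x \<in> R"
  proof -
    have "tab_row lam ((x \<circ> t \<circ> inv' x) i) = tab_row lam i" if "i \<in> {1..n}" for i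
    proof -
      have "tab_row lam (x (t j)) = tab_row lam (x j)" for j using k(4) by (auto simp: t_def transpose_def)
      then show ?thesis by (simp add: permutes_inverses[OF x])
    qed
    then show ?thesis using x C_perm[OF t] by (simp add: R_iff pc)
  qed
  moreover have "(x \<circ> t \<circ> inv' x) \<circ> x \<circ> t = x"
  proof -
    have "t \<circ> t = id" by (simp add: t_def)
    then show ?thesis using x by (simp add: pc)
  qed
  moreover have "sign t = -1" using k(3) by (simp add: t_def sign_swap_id)
  ultimately have "F x = - F x" if "\<And>r q x. r \<in> R \<Longrightarrow> q \<in> C \<Longrightarrow> x permutes {1..n} \<Longrightarrow> F (r \<circ> x \<circ> q) = of_int (sign q) * F x"
    for F :: "(nat \<Rightarrow> nat) \<Rightarrow> complex" using that[of "x \<circ> t \<circ> inv' x" t x] t x by simp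
  from this[of G, OF G] this[of ysym] show ?thesis
    using ysym_left ysym_right by (simp add: comp_assoc)
qed

lemma ysym_convolve:
  assumes h: "\<And>q y. q \<in> C \<Longrightarrow> y permutes {1..n} \<Longrightarrow> h (y \<circ> q) = of_int (sign q) * h y"
    and x: "x permutes {1..n}"
  shows "(\<Sum>p\<in>perms n. ysym p * h (inv' p \<circ> x)) = (\<Sum>p\<in>perms n. ysym p * h (inv' p)) * ysym x"
proof -
  define G where "G x = (\<Sum>p\<in>perms n. ysym p * h (inv' p \<circ> x))" for x
  have "G x = G id * ysym x"
  proof (rule sandwich[OF _ x])
    fix r q y assume r: "r \<in> R" and q: "q \<in> C" and y: "y permutes {1..n}"
    have "G (r \<circ> y \<circ> q) = (\<Sum>p\<in>perms n. ysym (r \<circ> p) * h (inv' (r \<circ> p) \<circ> (r \<circ> y \<circ> q)))"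
      unfolding G_def by (rule sum_perms_left[OF R_perm[OF r], symmetric])
    also have "\<dots> = (\<Sum>p\<in>perms n. of_int (sign q) * (ysym p * h (inv' p \<circ> y)))"
    proof (rule sum.cong[OF refl])
      fix p assume "p \<in> perms n"
      then have p: "p permutes {1..n}" by simp
      have "inv' (r \<circ> p) \<circ> (r \<circ> y \<circ> q) = (inv' p \<circ> y) \<circ> q" using p R_perm[OF r] by (simp add: pc)
      then show "ysym (r \<circ> p) * h (inv' (r \<circ> p) \<circ> (r \<circ> y \<circ> q)) = of_int (sign q) * (ysym p * h (inv' p \<circ> y))"
        using h[OF q, of "inv' p \<circ> y"] p y by (simp add: pc ysym_left[OF r])
    qed
    finally show "G (r \<circ> y \<circ> q) = of_int (sign q) * G y" by (simp add: G_def sum_distrib_left)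
  qed
  then show ?thesis by (simp add: G_def)
qed

text \<open>The scalar by which the Young symmetrizer differs from an idempotent.\<close>

definition kappa :: complex where "kappa = (\<Sum>p\<in>perms n. ysym p * ysym (inv' p))"

lemma ysym_ysym:
  assumes "x permutes {1..n}"
  shows "(\<Sum>p\<in>perms n. ysym p * ysym (inv' p \<circ> x)) = kappa * ysym x"
  unfolding kappa_def by (rule ysym_convolve[OF ysym_right assms])

text \<open>The scalar is the coefficient at the identity; rotating the product cyclically there reduces it to \<open>ysym_ysym\<close>.\<close>

lemma ysym_x_ysym:
  assumes x: "x permutes {1..n}" and y: "y permutes {1..n}"
  shows "(\<Sum>p\<in>perms n. ysym p * ysym (inv' x \<circ> inv' p \<circ> y)) = kappa * ysym (inv' x) * ysym y"
proof -
  have "(\<Sum>p\<in>perms n. ysym p * ysym (inv' x \<circ> inv' p \<circ> y)) = (\<Sum>p\<in>perms n. ysym p * ysym (inv' x \<circ> inv' p)) * ysym y"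
    using ysym_convolve[of "\<lambda>z. ysym (inv' x \<circ> z)" y] ysym_right[of _ "inv' x \<circ> _"] x y
    by (simp add: pc)
  also have "(\<Sum>p\<in>perms n. ysym p * ysym (inv' x \<circ> inv' p)) =
      (\<Sum>p\<in>perms n. ysym (inv' p \<circ> inv' x) * ysym p)"
  proof (rule sum.reindex_bij_witness[of _ "\<lambda>p. inv' p \<circ> inv' x" "\<lambda>p. inv' x \<circ> inv' p"])
  qed (use x in \<open>simp_all add: pc\<close>)
  also have "\<dots> = kappa * ysym (inv' x)" using ysym_ysym[of "inv' x"] x by (simp add: pc mult.commute)
  finally show ?thesis .
qed

text \<open>The element \<open>d\<close> is the product row sum, signed column sum, row sum. It is real and invariant under inversion, so its product with
  itself has the sum of the squares of the coefficients of \<open>d\<close> as the coefficient at the identity. On the other hand that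
  product is a multiple of \<open>kappa\<close>, and \<open>d id\<close> is the order of the row group.\<close>

lemma kappa_nonzero: "kappa \<noteq> 0"
proof
  assume kappa: "kappa = 0"
  define d where "d x = (\<Sum>r\<in>R. ysym (x \<circ> r))" for x
  have d_inv: "d (inv' x) = d x" if x: "x permutes {1..n}" for x
  proof -
    have "d (inv' x) = (\<Sum>r\<in>R. \<Sum>s\<in>R. csign (inv' s \<circ> (inv' x \<circ> r)))" by (simp add: d_def ysym_eq)
    also have "\<dots> = (\<Sum>r\<in>R. \<Sum>s\<in>R. csign (inv' r \<circ> (x \<circ> s)))"
    proof (intro sum.cong refl)
      fix r s assume r: "r \<in> R" and s: "s \<in> R"
      have "inv' s \<circ> (inv' x \<circ> r) = inv' (inv' r \<circ> (x \<circ> s))"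
        using x R_perm[OF r] R_perm[OF s] by (simp add: pc)
      moreover have "inv' r \<circ> (x \<circ> s) permutes {1..n}" using x R_perm[OF r] R_perm[OF s] by (simp add: pc)
      ultimately show "csign (inv' s \<circ> (inv' x \<circ> r)) = csign (inv' r \<circ> (x \<circ> s))"
        by (simp only: csign_inv)
    qed
    also have "\<dots> = (\<Sum>s\<in>R. \<Sum>r\<in>R. csign (inv' r \<circ> (x \<circ> s)))" by (rule sum.swap)
    finally show ?thesis by (simp add: d_def ysym_eq)
  qed
  have d_real: "cnj (d x) = d x" for x by (simp add: d_def ysym_real)
  have "(\<Sum>x\<in>perms n. d x * d (inv' x)) = (\<Sum>r\<in>R. \<Sum>s\<in>R. \<Sum>x\<in>perms n. ysym (x \<circ> r) * ysym (inv' x \<circ> s))"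
    unfolding d_def sum_product by (subst sum.swap, rule sum.cong[OF refl], rule sum.swap)
  also have "\<dots> = (\<Sum>r\<in>R. \<Sum>s\<in>R. 0)"
  proof (intro sum.cong refl)
    fix r s assume r: "r \<in> R" and s: "s \<in> R"
    have "(\<Sum>x\<in>perms n. ysym (x \<circ> r) * ysym (inv' x \<circ> s)) =
        (\<Sum>x\<in>perms n. ysym x * ysym (inv' (x \<circ> inv' r) \<circ> s))"
      by (subst sum_perms_right[of "inv' r", symmetric]) (use R_perm[OF r] in \<open>simp_all add: pc\<close>)
    also have "\<dots> = (\<Sum>x\<in>perms n. ysym x * ysym (inv' x \<circ> s))"
    proof (rule sum.cong[OF refl])
      fix x assume "x \<in> perms n"
      then have "inv' (x \<circ> inv' r) \<circ> s = r \<circ> (inv' x \<circ> s)" using R_perm[OF r] by (simp add: pc)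
      then show "ysym x * ysym (inv' (x \<circ> inv' r) \<circ> s) = ysym x * ysym (inv' x \<circ> s)" by (simp add: ysym_left[OF r])
    qed
    also have "\<dots> = 0" using ysym_ysym[OF R_perm[OF s]] kappa by simp
    finally show "(\<Sum>x\<in>perms n. ysym (x \<circ> r) * ysym (inv' x \<circ> s)) = 0" .
  qed
  finally have "(\<Sum>x\<in>perms n. d x * cnj (d x)) = 0" using d_inv d_real by simp
  then have "complex_of_real (\<Sum>x\<in>perms n. (cmod (d x))\<^sup>2) = 0"
    by (simp only: of_real_sum complex_norm_square)
  then have "(\<Sum>x\<in>perms n. (cmod (d x))\<^sup>2) = 0" by (simp only: of_real_eq_0_iff)
  then have "d id = 0" by (simp add: sum_nonneg_eq_0_iff permutes_id)
  moreover have "d id = of_nat (card R)"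
    using ysym_left[of _ id] by (simp add: d_def ysym_id)
  ultimately show False using R_id by simp
qed

end

section \<open>The character of a Specht module\<close>

context young_tableau
begin

text \<open>The contribution of a single coloring \<open>f\<close> to the pairing of the Young symmetrizer with a permutation character.\<close>

definition col_sum :: "(nat \<Rightarrow> nat) \<Rightarrow> complex" where
  "col_sum f = (\<Sum>r\<in>R. \<Sum>q\<in>C. of_int (sign q) * (if f \<circ> (r \<circ> q) = f then 1 else 0))"

lemma sum_ysym_perm_char:
  fixes v :: "nat \<Rightarrow> int"
  shows "(\<Sum>p\<in>perms n. ysym p * perm_char n v p) = (\<Sum>f\<in>colorings n v. col_sum f)"
proof -
  have pcs: "perm_char n v p = (\<Sum>f\<in>colorings n v. if f \<circ> p = f then 1 else 0)" for p
    by (simp add: perm_char_def sum.If_cases Collect_conj_eq)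
  have "(\<Sum>p\<in>perms n. ysym p * perm_char n v p) =
      (\<Sum>f\<in>colorings n v. \<Sum>p\<in>perms n. ysym p * (if f \<circ> p = f then 1 else 0))"
    unfolding pcs sum_distrib_left by (rule sum.swap)
  then show ?thesis unfolding sum_ysym col_sum_def .
qed

text \<open>A transposition of two elements with the same color and column reverses the signs.\<close>

lemma col_sum_eq_0:
  assumes "\<not> inj_on (\<lambda>k. (f k, tab_col lam k)) {1..n}"
  shows "col_sum f = 0"
proof -
  obtain k k' where k: "k \<in> {1..n}" "k' \<in> {1..n}" "k \<noteq> k'" "f k = f k'" "tab_col lam k = tab_col lam k'"
    using assms by (auto simp: inj_on_def)
  define t where "t = transpose k k'"
  have t: "t \<in> C" unfolding t_def using k by (intro transpose_C) auto
  have ft: "f \<circ> t = f" using k(4) by (auto simp: t_def transpose_def fun_eq_iff)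
  have tt: "t \<circ> t = id" by (simp add: t_def)
  have st: "sign t = -1" using k(3) by (simp add: t_def sign_swap_id)
  have "(\<Sum>q\<in>C. of_int (sign q) * (if f \<circ> (r \<circ> q) = f then 1 else 0)) = (0 :: complex)" for r
  proof -
    let ?F = "\<lambda>q. of_int (sign q) * (if f \<circ> (r \<circ> q) = f then 1 else 0) :: complex"
    have qtt: "q \<circ> t \<circ> t = q" for q :: "nat \<Rightarrow> nat" using tt by (simp add: comp_assoc)
    have "(\<Sum>q\<in>C. ?F q) = (\<Sum>q\<in>C. ?F (q \<circ> t))"
      by (rule sum.reindex_bij_witness[of _ "\<lambda>q. q \<circ> t" "\<lambda>q. q \<circ> t"]) (simp_all add: qtt C_comp t)
    also have "\<dots> = (\<Sum>q\<in>C. - ?F q)"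
    proof (rule sum.cong[OF refl])
      fix q assume q: "q \<in> C"
      have "f \<circ> (r \<circ> (q \<circ> t)) = f \<longleftrightarrow> f \<circ> (r \<circ> q) = f"
      proof
        assume "f \<circ> (r \<circ> (q \<circ> t)) = f"
        then have "f \<circ> (r \<circ> (q \<circ> t)) \<circ> t = f" using ft by simp
        moreover have "f \<circ> (r \<circ> (q \<circ> t)) \<circ> t = f \<circ> (r \<circ> q)" using qtt[of q] by (simp add: comp_assoc)
        ultimately show "f \<circ> (r \<circ> q) = f" by simp
      next
        assume "f \<circ> (r \<circ> q) = f"
        then have "f \<circ> (r \<circ> q) \<circ> t = f" using ft by simp
        then show "f \<circ> (r \<circ> (q \<circ> t)) = f" by (simp add: comp_assoc)
      qed
      then show "?F (q \<circ> t) = - ?F q"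
        using sign_perms_comp[OF C_perm[OF q] C_perm[OF t]] st by simp
    qed
    finally show ?thesis by (simp add: sum_negf)
  qed
  then show ?thesis by (simp add: col_sum_def)
qed

lemma ysym_perm_char_dominance:
  fixes v :: "nat \<Rightarrow> int"
  assumes K: "plength lam \<le> K" "\<And>b. K \<le> b \<Longrightarrow> v b = 0"
    and nz: "(\<Sum>p\<in>perms n. ysym p * perm_char n v p) \<noteq> 0"
  shows "(\<Sum>i<K. min (int (lam i)) (int j)) \<le> (\<Sum>i<K. min (v i) (int j))"
proof -
  obtain f where f: "f \<in> colorings n v" "col_sum f \<noteq> 0"
    using nz unfolding sum_ysym_perm_char by (meson sum.not_neutral_contains_not_neutral)
  then have "inj_on (\<lambda>k. (f k, tab_col lam k)) {1..n}" using col_sum_eq_0 by blast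
  from column_injective_dominance[OF f(1) this K(1)] K(2) show ?thesis by simp
qed

text \<open>Both sides sum over the factorizations of the inverse of \<open>y\<close> into a row and a column permutation.\<close>

lemma ysym_inv:
  assumes y: "y permutes {1..n}"
  shows "ysym (inv' y) = (\<Sum>s\<in>C. of_int (sign s) * (if s \<circ> y \<in> R then 1 else 0))"
proof -
  have "ysym (inv' y) = (\<Sum>r\<in>R. csign (inv' (y \<circ> r)))"
    unfolding ysym_eq using y R_perm by (intro sum.cong refl) (simp add: pc)
  also have "\<dots> = (\<Sum>r\<in>{r \<in> R. inv' (y \<circ> r) \<in> C}. of_int (sign (inv' (y \<circ> r))))"
    unfolding csign_def by (subst sum.inter_filter) simp_all
  also have "\<dots> = (\<Sum>s\<in>{s \<in> C. s \<circ> y \<in> R}. of_int (sign s))"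
  proof (rule sum.reindex_bij_witness[of _ "\<lambda>s. inv' (s \<circ> y)" "\<lambda>r. inv' (y \<circ> r)"])
    fix r assume r: "r \<in> {r \<in> R. inv' (y \<circ> r) \<in> C}"
    then have r': "r permutes {1..n}" "inv' r \<in> R" using R_perm R_inv by auto
    have e: "inv' (y \<circ> r) \<circ> y = inv' r" using y r'(1) by (simp add: pc)
    show "inv' (inv' (y \<circ> r) \<circ> y) = r" unfolding e using r'(1) by (simp add: pc)
    show "inv' (y \<circ> r) \<in> {s \<in> C. s \<circ> y \<in> R}" using r e r' by auto
  next
    fix s assume s: "s \<in> {s \<in> C. s \<circ> y \<in> R}"
    then have s': "s permutes {1..n}" using C_perm by auto
    have e: "inv' (y \<circ> inv' (s \<circ> y)) = s" using y s' by (simp add: pc)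
    show "inv' (y \<circ> inv' (s \<circ> y)) = s" by (rule e)
    show "inv' (s \<circ> y) \<in> {r \<in> R. inv' (y \<circ> r) \<in> C}" using s e R_inv by auto
  qed simp
  also have "\<dots> = (\<Sum>s\<in>C. of_int (sign s) * (if s \<circ> y \<in> R then 1 else 0))"
    by (subst sum.inter_filter) (auto intro!: sum.cong)
  finally show ?thesis .
qed

lemma row_coloring_eq_iff:
  assumes y: "y permutes {1..n}" and s: "s permutes {1..n}"
  shows "restrict (tab_row lam) {1..n} \<circ> y = restrict (tab_row lam) {1..n} \<circ> s \<longleftrightarrow> y \<circ> inv' s \<in> R"
proof -
  let ?f = "restrict (tab_row lam) {1..n}"
  have stab: "?f \<circ> z = ?f \<longleftrightarrow> z \<in> R" if z: "z permutes {1..n}" for z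
  proof -
    have "(?f (z k) = ?f k) \<longleftrightarrow> (k \<in> {1..n} \<longrightarrow> tab_row lam (z k) = tab_row lam k)" for k
      using permutes_in_image[OF z, of k] permutes_not_in[OF z, of k] by (cases "k \<in> {1..n}") auto
    then show ?thesis using z by (auto simp: R_iff fun_eq_iff)
  qed
  have "?f \<circ> y = ?f \<circ> s \<longleftrightarrow> ?f \<circ> (y \<circ> inv' s) = ?f"
  proof
    assume "?f \<circ> y = ?f \<circ> s"
    then have "?f \<circ> y \<circ> inv' s = ?f \<circ> s \<circ> inv' s" by simp
    then show "?f \<circ> (y \<circ> inv' s) = ?f" using s by (simp add: pc)
  next
    assume "?f \<circ> (y \<circ> inv' s) = ?f"
    then have "?f \<circ> (y \<circ> inv' s) \<circ> s = ?f \<circ> s" by simp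
    then show "?f \<circ> y = ?f \<circ> s" using s by (simp add: pc)
  qed
  then show ?thesis using stab[of "y \<circ> inv' s"] y s by (simp add: pc)
qed

text \<open>Only the colorings \<open>tab_row lam \<circ> s\<close> with \<open>s\<close> in the column group contribute. Their contributions, rearranged, are
  the expansion of \<open>kappa\<close> as a sum over products of row and column permutations.\<close>

lemma sum_ysym_perm_char_self: "(\<Sum>p\<in>perms n. ysym p * perm_char n (\<lambda>i. int (lam i)) p) = kappa"
proof -
  let ?f = "restrict (tab_row lam) {1..n}"
  let ?Col = "colorings n (\<lambda>i. int (lam i))"
  have inj: "inj_on (\<lambda>s. ?f \<circ> s) C"
  proof (rule inj_onI)
    fix s s' assume s: "s \<in> C" "s' \<in> C" and "?f \<circ> s = ?f \<circ> s'"
    then have "s \<circ> inv' s' \<in> R" using row_coloring_eq_iff C_perm by blast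
    then have "s \<circ> inv' s' = id" using R_Int_C s C_comp C_inv by blast
    then have "s \<circ> inv' s' \<circ> s' = s'" by simp
    then show "s = s'" using C_perm[OF s(2)] by (simp add: pc)
  qed
  have "(\<Sum>f\<in>?Col. col_sum f) = (\<Sum>f\<in>(\<lambda>s. ?f \<circ> s) ` C. col_sum f)"
  proof (rule sum.mono_neutral_right)
    show "(\<lambda>s. ?f \<circ> s) ` C \<subseteq> ?Col"
      using colorings_permute[OF tab_row_coloring] C_perm by blast
    show "\<forall>f\<in>?Col - (\<lambda>s. ?f \<circ> s) ` C. col_sum f = 0"
    proof (rule ballI, rule ccontr)
      fix f assume f: "f \<in> ?Col - (\<lambda>s. ?f \<circ> s) ` C" and "col_sum f \<noteq> 0"
      then have "inj_on (\<lambda>k. (f k, tab_col lam k)) {1..n}" using col_sum_eq_0 by blast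
      then obtain s where s: "s permutes {1..n}" "\<And>k. k \<in> {1..n} \<Longrightarrow> tab_col lam (s k) = tab_col lam k"
        "\<And>k. k \<in> {1..n} \<Longrightarrow> tab_row lam (s k) = f k"
        using column_injective_row_translate f by blast
      have "f = ?f \<circ> s"
      proof
        fix k show "f k = (?f \<circ> s) k"
        proof (cases "k \<in> {1..n}")
          case True
          then show ?thesis using s(3)[OF True] permutes_in_image[OF s(1), of k] by simp
        next
          case False
          then have "f k = undefined" using f extensional_arb[of f "{1..n}" k] by (simp add: colorings_def)
          moreover have "?f k = undefined" by (simp only: restrict_apply False if_False)
          ultimately show ?thesis by (simp only: o_apply permutes_not_in[OF s(1) False])
        qed
      qed
      moreover have "s \<in> C" using s by (simp add: C_iff)
      ultimately show False using f by blast
    qed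
  qed simp
  also have "\<dots> = (\<Sum>s\<in>C. col_sum (?f \<circ> s))" by (simp add: sum.reindex[OF inj])
  also have "\<dots> = (\<Sum>s\<in>C. \<Sum>r\<in>R. \<Sum>q\<in>C. of_int (sign q) * (of_int (sign s) * (if s \<circ> (r \<circ> q) \<in> R then 1 else 0)))"
  proof (rule sum.cong[OF refl])
    fix s assume s: "s \<in> C"
    note s' = C_perm[OF s]
    show "col_sum (?f \<circ> s) = (\<Sum>r\<in>R. \<Sum>q\<in>C. of_int (sign q) * (of_int (sign s) * (if s \<circ> (r \<circ> q) \<in> R then 1 else 0)))"
      unfolding col_sum_def
    proof (rule sum.cong[OF refl])
      fix r assume r: "r \<in> R"
      let ?F = "\<lambda>q. of_int (sign q) * (if ?f \<circ> s \<circ> (r \<circ> q) = ?f \<circ> s then 1 else 0) :: complex"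
      have "(\<Sum>q\<in>C. ?F q) = (\<Sum>q\<in>C. ?F (q \<circ> s))"
        by (rule sum.reindex_bij_witness[of _ "\<lambda>q. q \<circ> s" "\<lambda>q. q \<circ> inv' s"])
          (use s s' C_perm in \<open>simp_all add: pc C_comp C_inv\<close>)
      also have "\<dots> = (\<Sum>q\<in>C. of_int (sign q) * (of_int (sign s) * (if s \<circ> (r \<circ> q) \<in> R then 1 else 0)))"
      proof (rule sum.cong[OF refl])
        fix q assume q: "q \<in> C"
        have "?f \<circ> s \<circ> (r \<circ> (q \<circ> s)) = ?f \<circ> s \<longleftrightarrow> ?f \<circ> (s \<circ> (r \<circ> (q \<circ> s))) = ?f \<circ> s"
          by (simp add: comp_assoc)
        also have "\<dots> \<longleftrightarrow> s \<circ> (r \<circ> (q \<circ> s)) \<circ> inv' s \<in> R"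
          using s' R_perm[OF r] C_perm[OF q] by (intro row_coloring_eq_iff) (simp_all add: pc)
        also have "s \<circ> (r \<circ> (q \<circ> s)) \<circ> inv' s = s \<circ> (r \<circ> q)" using s' by (simp add: pc)
        finally have e: "(?f \<circ> s \<circ> (r \<circ> (q \<circ> s)) = ?f \<circ> s) = (s \<circ> (r \<circ> q) \<in> R)" .
        show "?F (q \<circ> s) = of_int (sign q) * (of_int (sign s) * (if s \<circ> (r \<circ> q) \<in> R then 1 else 0))"
          unfolding e sign_perms_comp[OF C_perm[OF q] s'] by simp
      qed
      finally show "(\<Sum>q\<in>C. ?F q) = (\<Sum>q\<in>C. of_int (sign q) * (of_int (sign s) * (if s \<circ> (r \<circ> q) \<in> R then 1 else 0)))" .
    qed
  qed
  also have "\<dots> = (\<Sum>r\<in>R. \<Sum>q\<in>C. of_int (sign q) * (\<Sum>s\<in>C. of_int (sign s) * (if s \<circ> (r \<circ> q) \<in> R then 1 else 0)))"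
    unfolding sum_distrib_left by (subst sum.swap, rule sum.cong[OF refl], rule sum.swap)
  also have "\<dots> = (\<Sum>r\<in>R. \<Sum>q\<in>C. of_int (sign q) * ysym (inv' (r \<circ> q)))"
    using R_perm C_perm by (intro sum.cong refl) (simp add: ysym_inv pc(8))
  also have "\<dots> = kappa" unfolding kappa_def sum_ysym ..
  finally show ?thesis unfolding sum_ysym_perm_char .
qed

text \<open>The trace of left multiplication by \<open>g\<close> on the left ideal generated by the idempotent \<open>ysym / kappa\<close>: on the whole
  group algebra it is the trace of \<open>f \<mapsto> g f (ysym / kappa)\<close>.\<close>

definition ychar :: "(nat \<Rightarrow> nat) \<Rightarrow> complex" where
  "ychar g = (\<Sum>x\<in>perms n. ysym (inv' x \<circ> inv' g \<circ> x)) / kappa"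

lemma ychar_conj:
  assumes y: "y permutes {1..n}" and g: "g permutes {1..n}"
  shows "ychar (inv' y \<circ> g \<circ> y) = ychar g"
proof -
  have "(\<Sum>x\<in>perms n. ysym (inv' x \<circ> inv' g \<circ> x)) = (\<Sum>x\<in>perms n. ysym (inv' (y \<circ> x) \<circ> inv' g \<circ> (y \<circ> x)))"
    by (rule sum_perms_left[OF y, symmetric])
  also have "\<dots> = (\<Sum>x\<in>perms n. ysym (inv' x \<circ> inv' (inv' y \<circ> g \<circ> y) \<circ> x))"
    using y g by (intro sum.cong refl) (simp add: pc)
  finally show ?thesis by (simp add: ychar_def)
qed

text \<open>Inversion turns the Young symmetrizer into the product of its two factors in the opposite order, and averaging over conjugates does not
  see the order of a product.\<close>

lemma ychar_alt:
  assumes g: "g permutes {1..n}"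
  shows "ychar g = (\<Sum>x\<in>perms n. ysym (inv' x \<circ> g \<circ> x)) / kappa"
proof -
  have "(\<Sum>x\<in>perms n. ysym (inv' x \<circ> inv' g \<circ> x)) = (\<Sum>x\<in>perms n. \<Sum>r\<in>R. csign (inv' x \<circ> g \<circ> x \<circ> inv' r))"
  proof (rule sum.cong[OF refl])
    fix x assume "x \<in> perms n"
    then have x: "x permutes {1..n}" by simp
    have "ysym (inv' x \<circ> inv' g \<circ> x) = (\<Sum>r\<in>R. csign (inv' x \<circ> g \<circ> x \<circ> r))"
      unfolding ysym_eq
    proof (rule sum.cong[OF refl])
      fix r assume r: "r \<in> R"
      have "inv' r \<circ> (inv' x \<circ> inv' g \<circ> x) = inv' (inv' x \<circ> g \<circ> x \<circ> r)"
        using x g R_perm[OF r] by (simp add: pc)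
      moreover have "inv' x \<circ> g \<circ> x \<circ> r permutes {1..n}" using x g R_perm[OF r] by (simp add: pc)
      ultimately show "csign (inv' r \<circ> (inv' x \<circ> inv' g \<circ> x)) = csign (inv' x \<circ> g \<circ> x \<circ> r)"
        by (simp only: csign_inv)
    qed
    also have "\<dots> = (\<Sum>r\<in>R. csign (inv' x \<circ> g \<circ> x \<circ> inv' r))"
      by (rule sum.reindex_bij_witness[of _ "\<lambda>r. inv' r" "\<lambda>r. inv' r"])
        (use R_perm R_inv in \<open>simp_all add: pc\<close>)
    finally show "ysym (inv' x \<circ> inv' g \<circ> x) = (\<Sum>r\<in>R. csign (inv' x \<circ> g \<circ> x \<circ> inv' r))" .
  qed
  also have "\<dots> = (\<Sum>r\<in>R. \<Sum>x\<in>perms n. csign (inv' x \<circ> g \<circ> x \<circ> inv' r))" by (rule sum.swap)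
  also have "\<dots> = (\<Sum>r\<in>R. \<Sum>x\<in>perms n. csign (inv' r \<circ> (inv' x \<circ> g \<circ> x)))"
  proof (rule sum.cong[OF refl])
    fix r assume r: "r \<in> R"
    have "(\<Sum>x\<in>perms n. csign (inv' r \<circ> (inv' x \<circ> g \<circ> x))) =
        (\<Sum>x\<in>perms n. csign (inv' r \<circ> (inv' (x \<circ> inv' r) \<circ> g \<circ> (x \<circ> inv' r))))"
      by (rule sum_perms_right[symmetric]) (use R_perm[OF r] in \<open>simp add: pc\<close>)
    also have "\<dots> = (\<Sum>x\<in>perms n. csign (inv' x \<circ> g \<circ> x \<circ> inv' r))"
      using R_perm[OF r] by (intro sum.cong refl) (simp add: pc)
    finally show "(\<Sum>x\<in>perms n. csign (inv' x \<circ> g \<circ> x \<circ> inv' r)) =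
        (\<Sum>x\<in>perms n. csign (inv' r \<circ> (inv' x \<circ> g \<circ> x)))" ..
  qed
  also have "\<dots> = (\<Sum>x\<in>perms n. ysym (inv' x \<circ> g \<circ> x))" unfolding ysym_eq by (rule sum.swap)
  finally show ?thesis by (simp add: ychar_def)
qed

lemma ip_ychar:
  assumes "\<And>p x. p permutes {1..n} \<Longrightarrow> x permutes {1..n} \<Longrightarrow> \<phi> (inv' x \<circ> p \<circ> x) = \<phi> p"
  shows "ip n ychar \<phi> = (\<Sum>p\<in>perms n. ysym p * \<phi> p) / kappa"
proof -
  have "(\<Sum>p\<in>perms n. ychar p * \<phi> p) = (\<Sum>p\<in>perms n. \<Sum>x\<in>perms n. ysym (inv' x \<circ> p \<circ> x) * \<phi> (inv' x \<circ> p \<circ> x)) / kappa"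
    using assms by (simp add: ychar_alt sum_distrib_right sum_divide_distrib)
  also have "(\<Sum>p\<in>perms n. \<Sum>x\<in>perms n. ysym (inv' x \<circ> p \<circ> x) * \<phi> (inv' x \<circ> p \<circ> x)) =
      (\<Sum>x\<in>perms n. \<Sum>p\<in>perms n. ysym (inv' x \<circ> p \<circ> x) * \<phi> (inv' x \<circ> p \<circ> x))"
    by (rule sum.swap)
  also have "\<dots> = (\<Sum>x\<in>perms n. \<Sum>p\<in>perms n. ysym p * \<phi> p)"
  proof (rule sum.cong[OF refl])
    fix x assume "x \<in> perms n"
    then have x: "x permutes {1..n}" by simp
    show "(\<Sum>p\<in>perms n. ysym (inv' x \<circ> p \<circ> x) * \<phi> (inv' x \<circ> p \<circ> x)) = (\<Sum>p\<in>perms n. ysym p * \<phi> p)"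
      by (rule sum.reindex_bij_witness[of _ "\<lambda>p. x \<circ> p \<circ> inv' x" "\<lambda>p. inv' x \<circ> p \<circ> x"])
        (use x in \<open>simp_all add: pc\<close>)
  qed
  finally show ?thesis by (simp add: ip_def card_perms)
qed

text \<open>The identity for \<open>ysym x ysym\<close> turns the double sum into the sum that defines \<open>kappa\<close>.\<close>

lemma ip_ychar_self: "ip n ychar ychar = 1"
proof -
  have "ip n ychar ychar = (\<Sum>p\<in>perms n. ysym p * ychar p) / kappa"
    by (rule ip_ychar) (rule ychar_conj)
  also have "(\<Sum>p\<in>perms n. ysym p * ychar p) =
      (\<Sum>p\<in>perms n. \<Sum>x\<in>perms n. ysym p * ysym (inv' x \<circ> inv' p \<circ> x)) / kappa"
    by (simp add: ychar_def sum_distrib_left sum_divide_distrib)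
  also have "(\<Sum>p\<in>perms n. \<Sum>x\<in>perms n. ysym p * ysym (inv' x \<circ> inv' p \<circ> x)) =
      (\<Sum>x\<in>perms n. \<Sum>p\<in>perms n. ysym p * ysym (inv' x \<circ> inv' p \<circ> x))"
    by (rule sum.swap)
  also have "\<dots> = (\<Sum>x\<in>perms n. kappa * (ysym x * ysym (inv' x)))"
    by (intro sum.cong refl) (simp add: ysym_x_ysym)
  also have "\<dots> = kappa * kappa" by (simp add: kappa_def flip: sum_distrib_left)
  finally show ?thesis using kappa_nonzero by simp
qed

lemma ip_ychar_perm_char:
  "ip n ychar (perm_char n v) = (\<Sum>p\<in>perms n. ysym p * perm_char n v p) / kappa"
  by (rule ip_ychar) (rule perm_char_conj)

lemma ip_ychar_schur: "ip n ychar (schur n lam) = 1"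
proof -
  have "ip n ychar (schur n lam) = ip n ychar (perm_char n (\<lambda>i. int (lam i)))"
    unfolding schur_def ip_alternant_right
  proof (rule triangular_functional[OF partition order_refl])
    fix v :: "nat \<Rightarrow> int" and j
    assume "\<And>b. plength lam \<le> b \<Longrightarrow> v b = 0" "ip n ychar (perm_char n v) \<noteq> 0"
    then show "(\<Sum>i<plength lam. min (int (lam i)) (int j)) \<le> (\<Sum>i<plength lam. min (v i) (int j))"
      by (intro ysym_perm_char_dominance) (auto simp: ip_ychar_perm_char)
  qed (simp add: ip_def)
  then show ?thesis using kappa_nonzero by (simp add: ip_ychar_perm_char sum_ysym_perm_char_self)
qed

text \<open>Both characters are real and have norm 1, and their inner product is 1. Hence their difference has norm 0.\<close>

theorem ychar_eq_schur:
  assumes p: "p permutes {1..n}"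
  shows "ychar p = schur n lam p"
proof -
  define \<phi> where "\<phi> p = ychar p - schur n lam p" for p
  have "cnj kappa = kappa" by (simp add: kappa_def ysym_real)
  then have real: "cnj (\<phi> p) = \<phi> p" for p
    by (simp add: \<phi>_def ychar_def ysym_real schur_def alternant_def perm_char_def)
  have "ip n \<phi> \<phi> = ip n ychar ychar - 2 * ip n ychar (schur n lam) + ip n (schur n lam) (schur n lam)"
    unfolding ip_def \<phi>_def
    by (simp add: algebra_simps sum.distrib sum_subtractf sum_distrib_left add_divide_distrib diff_divide_distrib)
  also have "\<dots> = 0" using ip_ychar_self ip_ychar_schur ip_schur[OF partition partition] by simp
  finally have "(\<Sum>p\<in>perms n. \<phi> p * cnj (\<phi> p)) = 0" by (simp add: ip_def real)
  then have "complex_of_real (\<Sum>p\<in>perms n. (cmod (\<phi> p))\<^sup>2) = 0"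
    by (simp only: of_real_sum complex_norm_square)
  then have "(\<Sum>p\<in>perms n. (cmod (\<phi> p))\<^sup>2) = 0" by (simp only: of_real_eq_0_iff)
  then have "\<phi> p = 0" using p by (simp add: sum_nonneg_eq_0_iff)
  then show ?thesis by (simp add: \<phi>_def)
qed

end

section \<open>Complete reducibility\<close>

lemma fun_sum_apply: "(\<Sum>a\<in>A. F a) x = (\<Sum>a\<in>A. F a x)"
  for F :: "'b \<Rightarrow> 'x \<Rightarrow> complex"
  by (induction A rule: infinite_finite_induct) auto

lemma sym_representation_iff:
  "representation (sym_group n) V \<rho> \<longleftrightarrow> cfun.subspace V \<and>
    (\<forall>g v. g permutes {1..n} \<longrightarrow> v \<in> V \<longrightarrow> \<rho> g v \<in> V) \<and>
    (\<forall>g v w. g permutes {1..n} \<longrightarrow> v \<in> V \<longrightarrow> w \<in> V \<longrightarrow> \<rho> g (v + w) = \<rho> g v + \<rho> g w) \<and>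
    (\<forall>g v c. g permutes {1..n} \<longrightarrow> v \<in> V \<longrightarrow> \<rho> g (cscale c v) = cscale c (\<rho> g v)) \<and>
    (\<forall>v. v \<in> V \<longrightarrow> \<rho> id v = v) \<and>
    (\<forall>g h v. g permutes {1..n} \<longrightarrow> h permutes {1..n} \<longrightarrow> v \<in> V \<longrightarrow> \<rho> (g \<circ> h) v = \<rho> g (\<rho> h v))"
  unfolding representation_def representation_axioms_def
  by (simp add: sym_group_is_group sym_group_carrier sym_group_mult sym_group_one)

lemma direct_sum_union:
  fixes A B Z :: "('x \<Rightarrow> complex) set"
  assumes fin: "finite \<U>" "finite \<V>" and disj: "\<U> \<inter> \<V> = {}"
    and A: "bij_betw (\<lambda>u. \<Sum>U\<in>\<U>. u U) (\<Pi>\<^sub>E U\<in>\<U>. U) A"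
    and B: "bij_betw (\<lambda>u. \<Sum>U\<in>\<V>. u U) (\<Pi>\<^sub>E U\<in>\<V>. U) B"
    and sub: "cfun.subspace A" "cfun.subspace B" and AB: "A \<inter> B = {0}"
    and Z: "Z = {a + b | a b. a \<in> A \<and> b \<in> B}"
  shows "bij_betw (\<lambda>u. \<Sum>U\<in>\<U> \<union> \<V>. u U) (\<Pi>\<^sub>E U\<in>\<U> \<union> \<V>. U) Z"
proof -
  have split: "(\<Sum>U\<in>\<U> \<union> \<V>. u U) = (\<Sum>U\<in>\<U>. restrict u \<U> U) + (\<Sum>U\<in>\<V>. restrict u \<V> U)" for u :: "_ \<Rightarrow> 'x \<Rightarrow> complex"
    using fin disj by (simp add: sum.union_disjoint)
  have res: "restrict u \<U> \<in> (\<Pi>\<^sub>E U\<in>\<U>. U)" "restrict u \<V> \<in> (\<Pi>\<^sub>E U\<in>\<V>. U)"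
    if "u \<in> (\<Pi>\<^sub>E U\<in>\<U> \<union> \<V>. U)" for u
    using that by auto
  have sumA: "(\<Sum>U\<in>\<U>. restrict u \<U> U) \<in> A" and sumB: "(\<Sum>U\<in>\<V>. restrict u \<V> U) \<in> B"
    if "u \<in> (\<Pi>\<^sub>E U\<in>\<U> \<union> \<V>. U)" for u
    using bij_betwE[OF A] bij_betwE[OF B] res[OF that] by blast+
  show ?thesis
    unfolding bij_betw_def
  proof
    show "inj_on (\<lambda>u. \<Sum>U\<in>\<U> \<union> \<V>. u U) (\<Pi>\<^sub>E U\<in>\<U> \<union> \<V>. U)"
    proof (rule inj_onI)
      fix u u' assume u: "u \<in> (\<Pi>\<^sub>E U\<in>\<U> \<union> \<V>. U)" and u': "u' \<in> (\<Pi>\<^sub>E U\<in>\<U> \<union> \<V>. U)"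
        and eq: "(\<Sum>U\<in>\<U> \<union> \<V>. u U) = (\<Sum>U\<in>\<U> \<union> \<V>. u' U)"
      define a where "a u = (\<Sum>U\<in>\<U>. restrict u \<U> U)" for u :: "_ \<Rightarrow> 'x \<Rightarrow> complex"
      define b where "b u = (\<Sum>U\<in>\<V>. restrict u \<V> U)" for u :: "_ \<Rightarrow> 'x \<Rightarrow> complex"
      have ab: "a u \<in> A" "a u' \<in> A" "b u \<in> B" "b u' \<in> B"
        using sumA[OF u] sumA[OF u'] sumB[OF u] sumB[OF u'] by (simp_all only: a_def b_def)
      have "a u + b u = a u' + b u'" using eq unfolding split a_def b_def .
      then have d: "a u - a u' = b u' - b u" by (simp add: algebra_simps)
      have "a u - a u' \<in> A \<inter> B"
        using cfun.subspace_diff[OF sub(1) ab(1,2)] cfun.subspace_diff[OF sub(2) ab(4,3)] d by (simp only: Int_iff)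
      then have "a u = a u'" "b u = b u'" using AB d by auto
      have "restrict u \<U> = restrict u' \<U>"
        by (rule inj_onD[OF bij_betw_imp_inj_on[OF A] _ res(1)[OF u] res(1)[OF u']])
          (use \<open>a u = a u'\<close> in \<open>simp only: a_def\<close>)
      moreover have "restrict u \<V> = restrict u' \<V>"
        by (rule inj_onD[OF bij_betw_imp_inj_on[OF B] _ res(2)[OF u] res(2)[OF u']])
          (use \<open>b u = b u'\<close> in \<open>simp only: b_def\<close>)
      ultimately have uu: "u U = u' U" if "U \<in> \<U> \<union> \<V>" for U using that by (metis Un_iff restrict_apply')
      show "u = u'" by (rule PiE_ext[OF u u' uu])
    qed
    show "(\<lambda>u. \<Sum>U\<in>\<U> \<union> \<V>. u U) ` (\<Pi>\<^sub>E U\<in>\<U> \<union> \<V>. U) = Z"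
    proof (intro equalityI subsetI)
      fix z assume "z \<in> (\<lambda>u. \<Sum>U\<in>\<U> \<union> \<V>. u U) ` (\<Pi>\<^sub>E U\<in>\<U> \<union> \<V>. U)"
      then show "z \<in> Z" unfolding Z split using sumA sumB by blast
    next
      fix z assume "z \<in> Z"
      then obtain a b where ab: "z = a + b" "a \<in> A" "b \<in> B" unfolding Z by blast
      obtain u where u: "u \<in> (\<Pi>\<^sub>E U\<in>\<U>. U)" "(\<Sum>U\<in>\<U>. u U) = a"
        using ab(2) bij_betw_imp_surj_on[OF A] by blast
      obtain v where v: "v \<in> (\<Pi>\<^sub>E U\<in>\<V>. U)" "(\<Sum>U\<in>\<V>. v U) = b"
        using ab(3) bij_betw_imp_surj_on[OF B] by blast
      define w where "w = (\<lambda>U\<in>\<U> \<union> \<V>. if U \<in> \<U> then u U else v U)"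
      have "w \<in> (\<Pi>\<^sub>E U\<in>\<U> \<union> \<V>. U)" using u v by (auto simp: w_def)
      moreover have "(\<Sum>U\<in>\<U>. restrict w \<U> U) = a" unfolding u(2)[symmetric] by (simp add: w_def)
      moreover have "(\<Sum>U\<in>\<V>. restrict w \<V> U) = b"
        unfolding v(2)[symmetric] using disj by (intro sum.cong refl) (auto simp: w_def)
      ultimately show "z \<in> (\<lambda>u. \<Sum>U\<in>\<U> \<union> \<V>. u U) ` (\<Pi>\<^sub>E U\<in>\<U> \<union> \<V>. U)"
        unfolding split ab(1) by (intro image_eqI[of _ _ w]) auto
    qed
  qed
qed

locale sym_rep =
  fixes n :: nat and W :: "('x \<Rightarrow> complex) set" and \<sigma> :: "(nat \<Rightarrow> nat) \<Rightarrow> ('x \<Rightarrow> complex) \<Rightarrow> 'x \<Rightarrow> complex"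
    and X :: "'x set"
  assumes rep: "representation (sym_group n) W \<sigma>"
    and finite_X: "finite X"
    and support: "f \<in> W \<Longrightarrow> x \<notin> X \<Longrightarrow> f x = 0"
begin

lemmas rep' = rep[unfolded sym_representation_iff]

lemma subspace_W: "cfun.subspace W"
  and act_W: "g permutes {1..n} \<Longrightarrow> v \<in> W \<Longrightarrow> \<sigma> g v \<in> W"
  and act_add: "g permutes {1..n} \<Longrightarrow> v \<in> W \<Longrightarrow> w \<in> W \<Longrightarrow> \<sigma> g (v + w) = \<sigma> g v + \<sigma> g w"
  and act_scale: "g permutes {1..n} \<Longrightarrow> v \<in> W \<Longrightarrow> \<sigma> g (cscale c v) = cscale c (\<sigma> g v)"
  and act_id: "v \<in> W \<Longrightarrow> \<sigma> id v = v"
  and act_comp: "g permutes {1..n} \<Longrightarrow> h permutes {1..n} \<Longrightarrow> v \<in> W \<Longrightarrow> \<sigma> (g \<circ> h) v = \<sigma> g (\<sigma> h v)"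
  using rep' by blast+

lemma subrep_iff: "U \<subseteq> W \<Longrightarrow> representation (sym_group n) U \<sigma> \<longleftrightarrow>
    cfun.subspace U \<and> (\<forall>g v. g permutes {1..n} \<longrightarrow> v \<in> U \<longrightarrow> \<sigma> g v \<in> U)"
proof -
  assume "U \<subseteq> W"
  then have W: "v \<in> U \<Longrightarrow> v \<in> W" for v by blast
  show ?thesis
    unfolding sym_representation_iff by (auto simp: act_add act_scale act_id act_comp W)
qed

lemma independent_bound:
  assumes "B \<subseteq> W" "cfun.independent B"
  shows "finite B \<and> card B \<le> card X"
proof -
  define \<delta> where "\<delta> x = (\<lambda>y. if y = x then 1 else 0 :: complex)" for x :: 'x
  have "W \<subseteq> cfun.span (\<delta> ` X)"
  proof
    fix f assume f: "f \<in> W"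
    have "f = (\<Sum>x\<in>X. cscale (f x) (\<delta> x))"
    proof
      fix y
      have "(\<Sum>x\<in>X. cscale (f x) (\<delta> x)) y = (\<Sum>x\<in>X. if x = y then f x else 0)"
        unfolding fun_sum_apply by (intro sum.cong refl) (simp add: cscale_def \<delta>_def)
      then show "f y = (\<Sum>x\<in>X. cscale (f x) (\<delta> x)) y"
        using finite_X support[OF f, of y] by (simp add: sum.delta')
    qed
    then show "f \<in> cfun.span (\<delta> ` X)"
      by (metis (no_types, lifting) cfun.span_base cfun.span_scale cfun.span_sum imageI)
  qed
  then have "finite B \<and> card B \<le> card (\<delta> ` X)"
    using assms finite_X by (intro cfun.independent_span_bound) auto
  then show ?thesis using card_image_le[OF finite_X, of \<delta>] by linarith
qed

lemma act_zero: "g permutes {1..n} \<Longrightarrow> \<sigma> g 0 = 0"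
  using act_scale[of g 0 0] cfun.subspace_0[OF subspace_W] by simp

lemma act_sum:
  assumes "g permutes {1..n}" "\<And>a. a \<in> A \<Longrightarrow> F a \<in> W"
  shows "\<sigma> g (\<Sum>a\<in>A. F a) = (\<Sum>a\<in>A. \<sigma> g (F a))"
  using assms(2)
proof (induction A rule: infinite_finite_induct)
  case (insert a A)
  have "\<sigma> g (F a + (\<Sum>a\<in>A. F a)) = \<sigma> g (F a) + \<sigma> g (\<Sum>a\<in>A. F a)"
    using insert.prems by (intro act_add[OF assms(1)] cfun.subspace_sum[OF subspace_W]) auto
  then show ?case using insert by (simp only: sum.insert insert_iff simp_thms)
qed (simp_all add: act_zero assms(1))

text \<open>Average a linear projection onto \<open>U\<close> over the group. The kernel of the average is an invariant
  complement.\<close>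

lemma maschke:
  assumes U: "U \<subseteq> W" "representation (sym_group n) U \<sigma>"
  obtains U' where "U' \<subseteq> W" "representation (sym_group n) U' \<sigma>" "U \<inter> U' = {0}" "W = {a + b | a b. a \<in> U \<and> b \<in> U'}"
proof -
  have subU: "cfun.subspace U" and actU: "\<And>g v. g permutes {1..n} \<Longrightarrow> v \<in> U \<Longrightarrow> \<sigma> g v \<in> U"
    using U(2) subrep_iff[OF U(1)] by blast+
  interpret pair: vector_space_pair cscale cscale by unfold_locales
  have lin_id: "Vector_Spaces.linear cscale cscale (id :: ('x \<Rightarrow> complex) \<Rightarrow> _)" by (rule cfun.linear_id)
  obtain q :: "('x \<Rightarrow> complex) \<Rightarrow> 'x \<Rightarrow> complex" where q: "range q \<subseteq> U" "Vector_Spaces.linear cscale cscale q" "\<And>v. v \<in> U \<Longrightarrow> q v = v"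
    using pair.linear_exists_left_inverse_on[OF lin_id subU] by auto
  have hom: "module_hom cscale cscale q" using q(2) by (simp only: module_hom_iff_linear)
  have q_add: "q (v + w) = q v + q w" and q_scale: "q (cscale c v) = cscale c (q v)" for v w c
    by (rule module_hom.add[OF hom], rule module_hom.scale[OF hom])
  define Q where "Q w = cscale (1 / fact n) (\<Sum>p\<in>perms n. \<sigma> p (q (\<sigma> (inv' p) w)))" for w
  have qU: "q w \<in> U" for w using q(1) by blast
  have Q_U: "Q w \<in> U" for w
    unfolding Q_def using qU actU by (intro cfun.subspace_scale[OF subU] cfun.subspace_sum[OF subU]) auto
  have Q_id: "Q u = u" if u: "u \<in> U" for u
  proof -
    have "\<sigma> p (q (\<sigma> (inv' p) u)) = u" if "p permutes {1..n}" for p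
    proof -
      have "q (\<sigma> (inv' p) u) = \<sigma> (inv' p) u" using q(3) actU u that by (simp add: permutes_inv)
      then have "\<sigma> p (q (\<sigma> (inv' p) u)) = \<sigma> (p \<circ> inv' p) u"
        using act_comp[OF that permutes_inv[OF that], of u] U(1) u by auto
      then show ?thesis using act_id U(1) u that by (auto simp: permutes_inv_o)
    qed
    then have "(\<Sum>p\<in>perms n. \<sigma> p (q (\<sigma> (inv' p) u))) = (\<Sum>p\<in>perms n. u)" by (intro sum.cong refl) simp
    then have "Q u = cscale (1 / fact n) (\<Sum>p\<in>perms n. u)" by (simp add: Q_def)
    also have "\<dots> = u"
    proof
      fix x show "cscale (1 / fact n) (\<Sum>p\<in>perms n. u) x = u x"
        unfolding cscale_def fun_sum_apply by (simp add: card_perms)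
    qed
    finally show ?thesis .
  qed
  have Q_add: "Q (v + w) = Q v + Q w" if "v \<in> W" "w \<in> W" for v w
  proof -
    have "\<sigma> p (q (\<sigma> (inv' p) (v + w))) = \<sigma> p (q (\<sigma> (inv' p) v)) + \<sigma> p (q (\<sigma> (inv' p) w))" if "p permutes {1..n}" for p
      using that \<open>v \<in> W\<close> \<open>w \<in> W\<close> qU U(1) by (simp add: act_add q_add permutes_inv subset_eq)
    then have "(\<Sum>p\<in>perms n. \<sigma> p (q (\<sigma> (inv' p) (v + w)))) =
        (\<Sum>p\<in>perms n. \<sigma> p (q (\<sigma> (inv' p) v))) + (\<Sum>p\<in>perms n. \<sigma> p (q (\<sigma> (inv' p) w)))"
      unfolding sum.distrib[symmetric] by (intro sum.cong refl) auto
    then show ?thesis by (simp add: Q_def cfun.scale_right_distrib)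
  qed
  have Q_scale: "Q (cscale c v) = cscale c (Q v)" if "v \<in> W" for v c
  proof -
    have "\<sigma> p (q (\<sigma> (inv' p) (cscale c v))) = cscale c (\<sigma> p (q (\<sigma> (inv' p) v)))" if "p permutes {1..n}" for p
      using that \<open>v \<in> W\<close> qU U(1) by (simp add: act_scale q_scale permutes_inv subset_eq)
    then have "(\<Sum>p\<in>perms n. \<sigma> p (q (\<sigma> (inv' p) (cscale c v)))) =
        cscale c (\<Sum>p\<in>perms n. \<sigma> p (q (\<sigma> (inv' p) v)))"
      unfolding cfun.scale_sum_right by (intro sum.cong refl) auto
    then show ?thesis by (simp add: Q_def mult.commute)
  qed
  have Q_act: "Q (\<sigma> g w) = \<sigma> g (Q w)" if g: "g permutes {1..n}" and w: "w \<in> W" for g w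
  proof -
    have "(\<Sum>p\<in>perms n. \<sigma> p (q (\<sigma> (inv' p) (\<sigma> g w)))) =
        (\<Sum>p\<in>perms n. \<sigma> (g \<circ> p) (q (\<sigma> (inv' (g \<circ> p)) (\<sigma> g w))))"
      by (rule sum_perms_left[OF g, symmetric])
    also have "\<dots> = (\<Sum>p\<in>perms n. \<sigma> g (\<sigma> p (q (\<sigma> (inv' p) w))))"
    proof (intro sum.cong refl)
      fix p assume "p \<in> perms n"
      then have p: "p permutes {1..n}" by simp
      have "\<sigma> (inv' (g \<circ> p)) (\<sigma> g w) = \<sigma> (inv' (g \<circ> p) \<circ> g) w"
        using g p w by (intro act_comp[symmetric]) (simp_all add: permutes_inv permutes_compose)
      also have "inv' (g \<circ> p) \<circ> g = inv' p" using g p by (simp add: perm_calculus(1-8)[where n = n] comp_assoc)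
      finally show "\<sigma> (g \<circ> p) (q (\<sigma> (inv' (g \<circ> p)) (\<sigma> g w))) = \<sigma> g (\<sigma> p (q (\<sigma> (inv' p) w)))"
        using act_comp[OF g p] qU U(1) by (metis subsetD)
    qed
    also have "\<dots> = \<sigma> g (\<Sum>p\<in>perms n. \<sigma> p (q (\<sigma> (inv' p) w)))"
      using g actU qU U(1) by (intro act_sum[symmetric]) auto
    finally have eq: "(\<Sum>p\<in>perms n. \<sigma> p (q (\<sigma> (inv' p) (\<sigma> g w)))) = \<sigma> g (\<Sum>p\<in>perms n. \<sigma> p (q (\<sigma> (inv' p) w)))" .
    have "(\<Sum>p\<in>perms n. \<sigma> p (q (\<sigma> (inv' p) w))) \<in> W"
      using actU qU U(1) by (intro cfun.subspace_sum[OF subspace_W]) auto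
    then show ?thesis unfolding Q_def eq by (rule act_scale[OF g, symmetric])
  qed
  define U' where "U' = {w \<in> W. Q w = 0}"
  have sub': "U' \<subseteq> W" by (auto simp: U'_def)
  have Q0: "Q 0 = 0" using Q_id[OF cfun.subspace_0[OF subU]] .
  have "cfun.subspace U'"
    unfolding cfun.subspace_def U'_def using subspace_W Q0
    by (auto simp: cfun.subspace_0 cfun.subspace_add cfun.subspace_scale Q_add Q_scale)
  moreover have "\<sigma> g v \<in> U'" if "g permutes {1..n}" "v \<in> U'" for g v
    using that by (auto simp: U'_def act_W Q_act act_zero)
  ultimately have rep': "representation (sym_group n) U' \<sigma>" by (simp add: subrep_iff[OF sub'])
  have int: "U \<inter> U' = {0}"
  proof
    show "U \<inter> U' \<subseteq> {0}" using Q_id by (auto simp: U'_def)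
    show "{0} \<subseteq> U \<inter> U'" using cfun.subspace_0[OF subU] Q0 U(1) by (auto simp: U'_def)
  qed
  have "W = {a + b | a b. a \<in> U \<and> b \<in> U'}"
  proof (intro equalityI subsetI)
    fix w assume w: "w \<in> W"
    have QW: "Q w \<in> W" using Q_U U(1) by blast
    have "Q (w - Q w) + Q (Q w) = Q w"
      using Q_add[OF cfun.subspace_diff[OF subspace_W w QW] QW] by simp
    then have "Q (w - Q w) = 0" using Q_id[OF Q_U] by simp
    then have "w - Q w \<in> U'" using cfun.subspace_diff[OF subspace_W w QW] by (simp add: U'_def)
    moreover have "w = Q w + (w - Q w)" by simp
    ultimately show "w \<in> {a + b | a b. a \<in> U \<and> b \<in> U'}" using Q_U by blast
  next
    fix w assume "w \<in> {a + b | a b. a \<in> U \<and> b \<in> U'}"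
    then show "w \<in> W" using U(1) sub' cfun.subspace_add[OF subspace_W] by blast
  qed
  with sub' rep' int show thesis by (rule that)
qed

end

lemma sym_rep_subrep:
  assumes "sym_rep n W \<sigma> X" "U \<subseteq> W" "representation (sym_group n) U \<sigma>"
  shows "sym_rep n U \<sigma> X"
  using assms unfolding sym_rep_def by blast

text \<open>The number \<open>m\<close> in a bound on the sizes of independent subsets serves as the dimension in an induction.\<close>

lemma independent_bound_complement:
  assumes Z: "\<And>B. B \<subseteq> Z \<Longrightarrow> cfun.independent B \<Longrightarrow> finite B \<and> card B \<le> Suc m"
    and U: "cfun.subspace U" "U \<subseteq> Z" and w: "w \<in> Z" "w \<notin> U"
    and B: "B \<subseteq> U" "cfun.independent B"
  shows "finite B \<and> card B \<le> m"
proof -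
  have "cfun.span B \<subseteq> U" using cfun.span_minimal[OF B(1) U(1)] .
  then have "cfun.independent (insert w B)" using w B by (intro cfun.independent_insertI) auto
  moreover have "insert w B \<subseteq> Z" using w(1) B(1) U(2) by blast
  ultimately have "finite (insert w B) \<and> card (insert w B) \<le> Suc m" by (intro Z)
  moreover from this have "card (insert w B) = Suc (card B)"
    using w B by (intro card_insert_disjoint) auto
  ultimately show ?thesis by simp
qed

lemma exists_irreducible_decomposition:
  assumes "sym_rep n Z \<sigma> X"
  shows "\<exists>\<U>. irreducible_decomposition (sym_group n) Z \<sigma> \<U>"
proof -
  have "\<exists>\<U>. irreducible_decomposition (sym_group n) Z \<sigma> \<U>"
    if "sym_rep n Z \<sigma> X" "\<And>B. B \<subseteq> Z \<Longrightarrow> cfun.independent B \<Longrightarrow> finite B \<and> card B \<le> m" for m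
    using that
  proof (induction m arbitrary: Z)
    case (0 Z)
    interpret sym_rep n Z \<sigma> X by (rule 0(1))
    have "z = 0" if "z \<in> Z" for z
    proof (rule ccontr)
      assume "z \<noteq> 0"
      then have "cfun.independent {z}" by simp
      with 0(2)[of "{z}"] that show False by simp
    qed
    then have "Z = {0}" using cfun.subspace_0[OF subspace_W] by blast
    then have "irreducible_decomposition (sym_group n) Z \<sigma> {}"
      by (auto simp: irreducible_decomposition_def bij_betw_def)
    then show ?case by blast
  next
    case (Suc m Z)
    interpret sym_rep n Z \<sigma> X by (rule Suc.prems(1))
    consider "Z = {0}" | "irreducible_representation (sym_group n) Z \<sigma>"
      | U where "U \<subseteq> Z" "representation (sym_group n) U \<sigma>" "U \<noteq> {0}" "U \<noteq> Z"
      using rep unfolding irreducible_representation_def by blast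
    then show ?case
    proof cases
      case 1
      then have "irreducible_decomposition (sym_group n) Z \<sigma> {}"
        by (auto simp: irreducible_decomposition_def bij_betw_def)
      then show ?thesis by blast
    next
      case 2
      have "bij_betw (\<lambda>u. \<Sum>U\<in>{Z}. u U) (\<Pi>\<^sub>E U\<in>{Z}. U) Z"
        by (rule bij_betw_byWitness[of _ "\<lambda>z. \<lambda>U\<in>{Z}. z"]) (auto simp: PiE_iff extensional_def fun_eq_iff)
      with 2 have "irreducible_decomposition (sym_group n) Z \<sigma> {Z}"
        by (simp add: irreducible_decomposition_def)
      then show ?thesis by blast
    next
      case (3 U)
      obtain U' where U': "U' \<subseteq> Z" "representation (sym_group n) U' \<sigma>" "U \<inter> U' = {0}"
        "Z = {a + b | a b. a \<in> U \<and> b \<in> U'}"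
        using maschke[OF 3(1,2)] .
      have sub: "cfun.subspace U" "cfun.subspace U'"
        using 3(1,2) U'(1,2) by (simp_all add: subrep_iff)
      have "0 \<in> U" "0 \<in> U'" using sub by (simp_all add: cfun.subspace_0)
      obtain a where a: "a \<in> U" "a \<noteq> 0" using 3(3) \<open>0 \<in> U\<close> by blast
      have "U' \<noteq> {0}" using U'(4) 3(4) by auto
      then obtain b where b: "b \<in> U'" "b \<noteq> 0" using \<open>0 \<in> U'\<close> by blast
      have "b \<notin> U" "a \<notin> U'" using a b U'(3) by auto
      have "b \<in> Z" "a \<in> Z" using a b 3(1) U'(1) by auto
      have "\<exists>\<U>. irreducible_decomposition (sym_group n) U \<sigma> \<U>"
        by (rule Suc.IH[OF sym_rep_subrep[OF Suc.prems(1) 3(1,2)]],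
          rule independent_bound_complement[OF Suc.prems(2) sub(1) 3(1) \<open>b \<in> Z\<close> \<open>b \<notin> U\<close>])
      then obtain \<U> where \<U>: "irreducible_decomposition (sym_group n) U \<sigma> \<U>" by blast
      have "\<exists>\<U>. irreducible_decomposition (sym_group n) U' \<sigma> \<U>"
        by (rule Suc.IH[OF sym_rep_subrep[OF Suc.prems(1) U'(1,2)]],
          rule independent_bound_complement[OF Suc.prems(2) sub(2) U'(1) \<open>a \<in> Z\<close> \<open>a \<notin> U'\<close>])
      then obtain \<V> where \<V>: "irreducible_decomposition (sym_group n) U' \<sigma> \<V>" by blast
      have mem: "V \<subseteq> A" "V \<noteq> {0}" "0 \<in> V"
        if dec: "irreducible_decomposition (sym_group n) A \<sigma> \<W>" and V: "V \<in> \<W>" for A V \<W>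
      proof -
        have irr: "\<And>V. V \<in> \<W> \<Longrightarrow> irreducible_representation (sym_group n) V \<sigma>" and fin: "finite \<W>"
          and bij: "bij_betw (\<lambda>u. \<Sum>U\<in>\<W>. u U) (\<Pi>\<^sub>E U\<in>\<W>. U) A"
          using dec by (auto simp: irreducible_decomposition_def)
        have zero: "0 \<in> V" if "V \<in> \<W>" for V
          using irr[OF that] cfun.subspace_0 by (auto simp: irreducible_representation_def sym_representation_iff)
        show "V \<noteq> {0}" "0 \<in> V" using irr[OF V] zero[OF V] by (auto simp: irreducible_representation_def)
        show "V \<subseteq> A"
        proof
          fix v assume v: "v \<in> V"
          define u where "u = (\<lambda>U\<in>\<W>. if U = V then v else 0)"
          have "u \<in> (\<Pi>\<^sub>E U\<in>\<W>. U)" using v zero by (auto simp: u_def)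
          moreover have "(\<Sum>U\<in>\<W>. u U) = v" using V fin by (simp add: u_def sum.delta)
          ultimately show "v \<in> A" using bij_betwE[OF bij] by metis
        qed
      qed
      have "\<U> \<inter> \<V> = {}"
      proof (rule ccontr)
        assume "\<U> \<inter> \<V> \<noteq> {}"
        then obtain V where V: "V \<in> \<U>" "V \<in> \<V>" by blast
        have "V \<subseteq> U \<inter> U'" using mem(1)[OF \<U> V(1)] mem(1)[OF \<V> V(2)] by (rule Int_greatest)
        then have "V \<subseteq> {0}" by (simp only: U'(3))
        with mem(2,3)[OF \<U> V(1)] show False by blast
      qed
      then have "bij_betw (\<lambda>u. \<Sum>U\<in>\<U> \<union> \<V>. u U) (\<Pi>\<^sub>E U\<in>\<U> \<union> \<V>. U) Z"
        using \<U> \<V> by (intro direct_sum_union[OF _ _ _ _ _ sub U'(3,4)]) (simp_all only: irreducible_decomposition_def)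
      then have "irreducible_decomposition (sym_group n) Z \<sigma> (\<U> \<union> \<V>)"
        using \<U> \<V> by (auto simp: irreducible_decomposition_def)
      then show ?thesis by blast
    qed
  qed
  from this[OF assms, of "card X"] sym_rep.independent_bound[OF assms] show ?thesis by blast
qed

section \<open>Constituents isomorphic to a Specht module\<close>

context young_tableau
begin

lemma conv_perms: "conv n f g p = (\<Sum>q\<in>perms n. f q * g (inv' q \<circ> p))"
  by (simp add: conv_def carrier_perms)

lemma conv_eq_0:
  assumes "\<And>q. q permutes {1..n} \<Longrightarrow> g q = 0" "p permutes {1..n}"
  shows "conv n f g p = 0"
  unfolding conv_perms using assms by (intro sum.neutral ballI) (simp add: pc)

lemma ysym_conv_ysym: "p permutes {1..n} \<Longrightarrow> conv n ysym ysym p = kappa * ysym p"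
  by (simp add: conv_perms ysym_ysym)

lemma conv_ysym_right:
  assumes "q \<in> C" "y permutes {1..n}"
  shows "conv n f ysym (y \<circ> q) = of_int (sign q) * conv n f ysym y"
  unfolding conv_perms sum_distrib_left
proof (intro sum.cong refl)
  fix s assume "s \<in> perms n"
  then have "inv' s \<circ> y permutes {1..n}" using assms by (simp add: pc)
  from ysym_right[OF assms(1) this] show "f s * ysym (inv' s \<circ> (y \<circ> q)) = of_int (sign q) * (f s * ysym (inv' s \<circ> y))"
    by (simp add: comp_assoc)
qed

text \<open>The algebra \<open>ysym A ysym\<close> is one-dimensional.\<close>

lemma ysym_conv_conv_ysym:
  obtains \<theta> where "\<And>p. p permutes {1..n} \<Longrightarrow> conv n ysym (conv n f ysym) p = \<theta> * ysym p"
proof -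
  have "conv n ysym (conv n f ysym) p = (\<Sum>q\<in>perms n. ysym q * conv n f ysym (inv' q)) * ysym p"
    if "p permutes {1..n}" for p
    unfolding conv_perms[of ysym] by (rule ysym_convolve[OF conv_ysym_right that])
  then show thesis using that by blast
qed

definition unit_alg :: "(nat \<Rightarrow> nat) \<Rightarrow> complex" where
  "unit_alg p = (if p = id then 1 else 0)"

lemma unit_in_group_algebra: "unit_alg \<in> group_algebra n"
  by (auto simp: group_algebra_def unit_alg_def carrier_perms permutes_id)

lemma specht_eq: "specht lam = (\<lambda>f. conv n f ysym) ` group_algebra n"
  by (simp add: specht_def psize)

lemma conv_assoc: "conv n (conv n f g) h = conv n f (conv n g h)"
proof
  fix x
  have "conv n (conv n f g) h x = (\<Sum>s\<in>perms n. \<Sum>q\<in>perms n. f q * g (inv' q \<circ> s) * h (inv' s \<circ> x))"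
    by (simp add: conv_perms sum_distrib_right)
  also have "\<dots> = (\<Sum>q\<in>perms n. \<Sum>s\<in>perms n. f q * g (inv' q \<circ> s) * h (inv' s \<circ> x))" by (rule sum.swap)
  also have "\<dots> = (\<Sum>q\<in>perms n. f q * (\<Sum>s\<in>perms n. g s * h (inv' s \<circ> (inv' q \<circ> x))))"
  proof (intro sum.cong refl)
    fix q assume "q \<in> perms n"
    then have q: "q permutes {1..n}" by simp
    have "(\<Sum>s\<in>perms n. f q * g (inv' q \<circ> s) * h (inv' s \<circ> x)) =
        (\<Sum>s\<in>perms n. f q * g (inv' q \<circ> (q \<circ> s)) * h (inv' (q \<circ> s) \<circ> x))"
      by (rule sum_perms_left[OF q, symmetric])
    also have "\<dots> = (\<Sum>s\<in>perms n. f q * (g s * h (inv' s \<circ> (inv' q \<circ> x))))"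
      using q by (intro sum.cong refl) (simp add: pc mult.assoc)
    finally show "(\<Sum>s\<in>perms n. f q * g (inv' q \<circ> s) * h (inv' s \<circ> x)) =
        f q * (\<Sum>s\<in>perms n. g s * h (inv' s \<circ> (inv' q \<circ> x)))" by (simp only: sum_distrib_left)
  qed
  finally show "conv n (conv n f g) h x = conv n f (conv n g h) x" by (simp add: conv_perms)
qed

lemma conv_group_algebra:
  assumes "g \<in> group_algebra n"
  shows "conv n f g \<in> group_algebra n"
proof -
  have "g (inv' q \<circ> p) = 0" if q: "q permutes {1..n}" and p: "\<not> p permutes {1..n}" for p q
  proof -
    have "\<not> inv' q \<circ> p permutes {1..n}"
    proof
      assume "inv' q \<circ> p permutes {1..n}"
      then have "q \<circ> (inv' q \<circ> p) permutes {1..n}" using q by (simp only: pc(8))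
      then show False using q p by (simp only: pc(2))
    qed
    then show ?thesis using assms by (simp add: group_algebra_def carrier_perms)
  qed
  then show ?thesis unfolding group_algebra_def by (auto simp: carrier_perms conv_perms intro: sum.neutral)
qed

lemma ysym_group_algebra: "ysym \<in> group_algebra n"
  by (simp add: group_algebra_def carrier_perms ysym_outside)

text \<open>The adjoint on the group algebra: \<open>star f * f\<close> has the squared norm of \<open>f\<close> as its coefficient at the identity.\<close>

definition star :: "((nat \<Rightarrow> nat) \<Rightarrow> complex) \<Rightarrow> (nat \<Rightarrow> nat) \<Rightarrow> complex" where
  "star f p = cnj (f (inv' p))"

lemma conv_star_self:
  "conv n (star f) f id = of_real (\<Sum>p\<in>perms n. (cmod (f p))\<^sup>2)"
proof -
  have "conv n (star f) f id = (\<Sum>p\<in>perms n. cnj (f (inv' p)) * f (inv' p))"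
    by (simp add: conv_perms star_def)
  also have "\<dots> = (\<Sum>p\<in>perms n. cnj (f p) * f p)" by (rule sum_perms_inv)
  also have "\<dots> = (\<Sum>p\<in>perms n. of_real ((cmod (f p))\<^sup>2))"
    by (simp only: complex_norm_square mult.commute)
  finally show ?thesis by simp
qed

lemma conv_star_self_eq_0:
  assumes "conv n (star f) f id = 0" "p permutes {1..n}"
  shows "f p = 0"
proof -
  have "(\<Sum>p\<in>perms n. (cmod (f p))\<^sup>2) = 0" using assms(1) unfolding conv_star_self by (simp only: of_real_eq_0_iff)
  then show ?thesis using assms(2) by (simp add: sum_nonneg_eq_0_iff)
qed

lemma star_conv_star:
  assumes p: "p permutes {1..n}"
  shows "star (conv n (star f) f) p = conv n (star f) f p"
proof -
  have "star (conv n (star f) f) p = (\<Sum>q\<in>perms n. f (inv' q) * cnj (f (inv' q \<circ> inv' p)))"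
    by (simp add: star_def conv_perms)
  also have "\<dots> = (\<Sum>q\<in>perms n. f (inv' (inv' p \<circ> q)) * cnj (f (inv' (inv' p \<circ> q) \<circ> inv' p)))"
    by (rule sum_perms_left[symmetric]) (use p in \<open>simp add: pc\<close>)
  also have "\<dots> = (\<Sum>q\<in>perms n. cnj (f (inv' q)) * f (inv' q \<circ> p))"
    using p by (intro sum.cong refl) (simp add: pc)
  finally show ?thesis by (simp add: star_def conv_perms)
qed

text \<open>From \<open>v (star v) v = 0\<close> the self-adjoint element \<open>(star v) v\<close> has square zero, hence vanishes, hence so does \<open>v\<close>.
  This is semisimplicity of the group algebra in the form in which it is used.\<close>

lemma square_zero:
  assumes "\<And>p. p permutes {1..n} \<Longrightarrow> conv n v (conv n (star v) v) p = 0" and p: "p permutes {1..n}"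
  shows "v p = 0"
proof (rule conv_star_self_eq_0[OF _ p])
  let ?y = "conv n (star v) v"
  have "conv n (star ?y) ?y id = conv n ?y ?y id"
    unfolding conv_perms[of "star ?y"] conv_perms[of ?y ?y] by (intro sum.cong refl) (simp add: star_conv_star)
  also have "\<dots> = conv n (star v) (conv n v ?y) id" by (simp only: conv_assoc)
  also have "\<dots> = 0"
    by (rule conv_eq_0[OF assms(1) permutes_id])
  finally show "conv n (star v) v id = 0" by (rule conv_star_self_eq_0) (rule permutes_id)
qed

end

locale tableau_rep = young_tableau n lam + sym_rep n W \<sigma> X
  for n lam and W :: "('x \<Rightarrow> complex) set" and \<sigma> X
begin

text \<open>The action of an element of the group algebra.\<close>

definition hat :: "((nat \<Rightarrow> nat) \<Rightarrow> complex) \<Rightarrow> ('x \<Rightarrow> complex) \<Rightarrow> 'x \<Rightarrow> complex" where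
  "hat f w = (\<Sum>p\<in>perms n. cscale (f p) (\<sigma> p w))"

lemma hat_closed:
  assumes U: "U \<subseteq> W" "representation (sym_group n) U \<sigma>" and u: "u \<in> U"
  shows "hat f u \<in> U"
proof -
  have "cfun.subspace U" "\<And>g v. g permutes {1..n} \<Longrightarrow> v \<in> U \<Longrightarrow> \<sigma> g v \<in> U"
    using U(2) subrep_iff[OF U(1)] by blast+
  then show ?thesis unfolding hat_def using u by (intro cfun.subspace_sum cfun.subspace_scale) auto
qed

lemma hat_W: "w \<in> W \<Longrightarrow> hat f w \<in> W"
  by (rule hat_closed[OF order_refl rep])

lemma hat_add:
  assumes "v \<in> W" "w \<in> W"
  shows "hat f (v + w) = hat f v + hat f w"
proof -
  have "hat f (v + w) = (\<Sum>p\<in>perms n. cscale (f p) (\<sigma> p v) + cscale (f p) (\<sigma> p w))"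
    unfolding hat_def using assms by (intro sum.cong refl) (simp add: act_add cfun.scale_right_distrib)
  then show ?thesis by (simp only: sum.distrib hat_def)
qed

lemma hat_scale:
  assumes "w \<in> W"
  shows "hat f (cscale c w) = cscale c (hat f w)"
proof -
  have "hat f (cscale c w) = (\<Sum>p\<in>perms n. cscale c (cscale (f p) (\<sigma> p w)))"
    unfolding hat_def using assms by (intro sum.cong refl) (simp add: act_scale mult.commute)
  then show ?thesis by (simp only: cfun.scale_sum_right hat_def)
qed

lemma hat_zero: "hat f 0 = 0"
  using hat_scale[of 0 f 0] cfun.subspace_0[OF subspace_W] by simp

lemma hat_sum:
  assumes "\<And>a. a \<in> A \<Longrightarrow> F a \<in> W"
  shows "hat f (\<Sum>a\<in>A. F a) = (\<Sum>a\<in>A. hat f (F a))"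
  using assms
proof (induction A rule: infinite_finite_induct)
  case (insert a A)
  have "hat f (F a + (\<Sum>a\<in>A. F a)) = hat f (F a) + hat f (\<Sum>a\<in>A. F a)"
    using insert.prems by (intro hat_add cfun.subspace_sum[OF subspace_W]) auto
  then show ?case using insert by (simp only: sum.insert insert_iff simp_thms)
qed (simp_all only: sum.empty sum.infinite hat_zero simp_thms)

lemma hat_plus: "hat (f + g) w = hat f w + hat g w"
  by (simp only: hat_def plus_fun_apply cfun.scale_left_distrib sum.distrib)

lemma hat_cscale: "hat (cscale c f) w = cscale c (hat f w)"
proof -
  have "hat (cscale c f) w = (\<Sum>p\<in>perms n. cscale c (cscale (f p) (\<sigma> p w)))"
    unfolding hat_def by (intro sum.cong refl) (simp add: cscale_def mult.assoc)
  then show ?thesis by (simp only: cfun.scale_sum_right hat_def)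
qed

lemma hat_cong: "(\<And>p. p permutes {1..n} \<Longrightarrow> f p = g p) \<Longrightarrow> hat f w = hat g w"
  unfolding hat_def by (intro sum.cong refl) auto

lemma hat_left_mult:
  assumes q: "q permutes {1..n}" and w: "w \<in> W"
  shows "hat (left_mult q f) w = \<sigma> q (hat f w)"
proof -
  have "hat (left_mult q f) w = (\<Sum>p\<in>perms n. cscale (left_mult q f (q \<circ> p)) (\<sigma> (q \<circ> p) w))"
    unfolding hat_def by (rule sum_perms_left[OF q, symmetric])
  also have "\<dots> = (\<Sum>p\<in>perms n. \<sigma> q (cscale (f p) (\<sigma> p w)))"
  proof (intro sum.cong refl)
    fix p assume "p \<in> perms n"
    then have p: "p permutes {1..n}" by simp
    have "\<sigma> q (cscale (f p) (\<sigma> p w)) = cscale (f p) (\<sigma> q (\<sigma> p w))" by (rule act_scale[OF q act_W[OF p w]])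
    then show "cscale (left_mult q f (q \<circ> p)) (\<sigma> (q \<circ> p) w) = \<sigma> q (cscale (f p) (\<sigma> p w))"
      by (simp add: left_mult_def perm_calculus(1)[OF q] act_comp[OF q p w])
  qed
  also have "\<dots> = \<sigma> q (hat f w)"
    unfolding hat_def using act_W w cfun.subspace_scale[OF subspace_W] by (intro act_sum[symmetric] q) auto
  finally show ?thesis .
qed

lemma hat_conv:
  assumes w: "w \<in> W"
  shows "hat (conv n f g) w = hat f (hat g w)"
proof -
  have "hat f (hat g w) = (\<Sum>q\<in>perms n. cscale (f q) (hat (left_mult q g) w))"
    unfolding hat_def[of f "hat g w"] using w by (intro sum.cong refl) (simp add: hat_left_mult)
  also have "\<dots> = (\<Sum>q\<in>perms n. \<Sum>p\<in>perms n. cscale (f q * g (inv' q \<circ> p)) (\<sigma> p w))"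
    by (simp only: hat_def cfun.scale_sum_right left_mult_def cfun.scale_scale)
  also have "\<dots> = (\<Sum>p\<in>perms n. \<Sum>q\<in>perms n. cscale (f q * g (inv' q \<circ> p)) (\<sigma> p w))"
    by (rule sum.swap)
  also have "\<dots> = hat (conv n f g) w"
    by (simp only: hat_def conv_perms cfun.scale_sum_left)
  finally show ?thesis ..
qed

lemma hat_ysym_ysym: "w \<in> W \<Longrightarrow> hat ysym (hat ysym w) = cscale kappa (hat ysym w)"
proof -
  assume w: "w \<in> W"
  have "hat (conv n ysym ysym) w = hat (cscale kappa ysym) w"
    by (rule hat_cong) (simp add: ysym_conv_ysym cscale_def)
  then show ?thesis by (simp only: hat_conv[OF w] hat_cscale)
qed

text \<open>On an irreducible subspace this makes the image of the Young symmetrizer at most one-dimensional.\<close>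

lemma hat_sandwich:
  assumes "w \<in> W"
  obtains \<theta> where "hat ysym (hat f (hat ysym w)) = cscale \<theta> (hat ysym w)"
proof -
  obtain \<theta> where \<theta>: "\<And>p. p permutes {1..n} \<Longrightarrow> conv n ysym (conv n f ysym) p = \<theta> * ysym p"
    using ysym_conv_conv_ysym[of f] by blast
  have "hat (conv n ysym (conv n f ysym)) w = hat (cscale \<theta> ysym) w"
    by (rule hat_cong) (simp add: \<theta> cscale_def)
  then show thesis using that assms by (simp only: hat_conv hat_W hat_cscale)
qed

lemma hat_unit: "w \<in> W \<Longrightarrow> hat unit_alg w = w"
proof -
  assume w: "w \<in> W"
  have "hat unit_alg w = (\<Sum>p\<in>{id}. cscale (unit_alg p) (\<sigma> p w))"
    unfolding hat_def by (rule sum.mono_neutral_right) (auto simp: unit_alg_def permutes_id)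
  then show ?thesis using act_id[OF w] by (simp add: unit_alg_def)
qed

text \<open>The right-hand side is a nonzero invariant subspace.\<close>

lemma irreducible_cyclic:
  assumes U: "U \<subseteq> W" "irreducible_representation (sym_group n) U \<sigma>" and u0: "u0 \<in> U" "u0 \<noteq> 0"
  shows "U = (\<lambda>f. hat f u0) ` group_algebra n"
proof -
  have rU: "representation (sym_group n) U \<sigma>" using U(2) by (simp add: irreducible_representation_def)
  have u0W: "u0 \<in> W" using U(1) u0 by blast
  let ?V = "(\<lambda>f. hat f u0) ` group_algebra n"
  have VU: "?V \<subseteq> U" using hat_closed[OF U(1) rU u0(1)] by blast
  have "cfun.subspace ?V"
    unfolding cfun.subspace_def
  proof (intro conjI ballI allI)
    have "hat 0 u0 = 0" using hat_plus[of 0 0 u0] by simp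
    moreover have "0 \<in> group_algebra n" by (simp add: group_algebra_def)
    ultimately show "0 \<in> ?V" by (intro image_eqI[of _ _ 0]) auto
    fix x y assume "x \<in> ?V" "y \<in> ?V"
    then obtain f g where "x = hat f u0" "y = hat g u0" "f \<in> group_algebra n" "g \<in> group_algebra n" by blast
    then show "x + y \<in> ?V"
      by (intro image_eqI[of _ _ "f + g"]) (auto simp only: hat_plus, auto simp: group_algebra_def)
  next
    fix c x assume "x \<in> ?V"
    then obtain f where "x = hat f u0" "f \<in> group_algebra n" by blast
    then show "cscale c x \<in> ?V"
      by (intro image_eqI[of _ _ "cscale c f"]) (auto simp only: hat_cscale, auto simp: group_algebra_def cscale_def)
  qed
  moreover have "\<sigma> g v \<in> ?V" if g: "g permutes {1..n}" and "v \<in> ?V" for g v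
  proof -
    obtain f where f: "v = hat f u0" "f \<in> group_algebra n" using \<open>v \<in> ?V\<close> by blast
    have "left_mult g f \<in> group_algebra n" using g f(2) by (intro left_mult_group_algebra) (auto simp: carrier_perms)
    then show ?thesis using hat_left_mult[OF g u0W, of f] f(1) by (metis imageI)
  qed
  ultimately have "representation (sym_group n) ?V \<sigma>" using subrep_iff[of ?V] VU U(1) by blast
  moreover have "u0 \<in> ?V" using hat_unit[OF u0W] unit_in_group_algebra by (metis imageI)
  ultimately show ?thesis using U(2) VU u0(2) unfolding irreducible_representation_def by blast
qed

text \<open>With \<open>u0 = ysym u'\<close>, the map \<open>v \<mapsto> v u0\<close> is onto by irreducibility. For injectivity let \<open>v u0 = 0\<close> with \<open>v\<close>
  in the Specht module. For each \<open>x\<close> the element \<open>ysym x v\<close> is a multiple of \<open>ysym\<close> and annihilates \<open>u0\<close>, so it is zero. As \<open>v\<close> is a left multiple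
  of \<open>ysym\<close>, this gives \<open>v x v = 0\<close> for all \<open>x\<close>, in particular for the adjoint of \<open>v\<close>.\<close>

lemma specht_iso:
  assumes U: "U \<subseteq> W" "irreducible_representation (sym_group n) U \<sigma>"
    and u': "u' \<in> U" "hat ysym u' \<noteq> 0"
  shows "isomorphic_representations (sym_group n) (specht lam) left_mult U \<sigma>"
proof -
  have rU: "representation (sym_group n) U \<sigma>" using U(2) by (simp add: irreducible_representation_def)
  define u0 where "u0 = hat ysym u'"
  have u0: "u0 \<in> U" "u0 \<noteq> 0" "u0 \<in> W"
    using hat_closed[OF U(1) rU u'(1)] u'(2) U(1) by (auto simp: u0_def)
  have e0: "hat ysym u0 = cscale kappa u0" using hat_ysym_ysym[of u'] u'(1) U(1) by (auto simp: u0_def)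
  have sub: "cfun.subspace (specht lam)"
    using specht_representation[of lam] unfolding psize sym_representation_iff by blast
  have inj0: "v = 0" if v: "v \<in> specht lam" and v0: "hat v u0 = 0" for v
  proof -
    obtain f where f: "v = conv n f ysym" "f \<in> group_algebra n" using v unfolding specht_eq by blast
    have zero: "conv n ysym (conv n x v) p = 0" if p: "p permutes {1..n}" for x p
    proof -
      obtain \<theta> where \<theta>: "\<And>p. p permutes {1..n} \<Longrightarrow> conv n ysym (conv n (conv n x f) ysym) p = \<theta> * ysym p"
        using ysym_conv_conv_ysym[of "conv n x f"] by blast
      have "hat (conv n ysym (conv n x v)) u0 = hat (cscale \<theta> ysym) u0"
        by (rule hat_cong) (simp add: \<theta> cscale_def f(1) conv_assoc[symmetric, of x])
      then have "hat ysym (hat x (hat v u0)) = cscale \<theta> (cscale kappa u0)"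
        by (simp only: hat_conv[OF u0(3)] hat_cscale e0)
      then have "cscale \<theta> (cscale kappa u0) = 0" by (simp only: v0 hat_zero)
      then have "\<theta> = 0" using u0(2) kappa_nonzero by simp
      then show ?thesis using \<theta>[OF p] by (simp add: f(1) conv_assoc)
    qed
    have vv: "conv n v (conv n x v) p = 0" if p: "p permutes {1..n}" for x p
    proof -
      have "conv n v (conv n x v) p = conv n f (conv n ysym (conv n x v)) p" by (simp only: f(1) conv_assoc)
      also have "\<dots> = 0" by (rule conv_eq_0[OF zero p])
      finally show ?thesis .
    qed
    have "v p = 0" for p
    proof (cases "p permutes {1..n}")
      case True
      then show ?thesis using square_zero[OF vv] by blast
    next
      case False
      then show ?thesis using conv_group_algebra[OF ysym_group_algebra, of f] f(1)
        by (simp add: group_algebra_def carrier_perms)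
    qed
    then show ?thesis by (simp add: fun_eq_iff)
  qed
  have hom_add: "hat (v + w) u0 = hat v u0 + hat w u0" for v w by (rule hat_plus)
  have "inj_on (\<lambda>v. hat v u0) (specht lam)"
  proof (rule inj_onI)
    fix v w assume v: "v \<in> specht lam" and w: "w \<in> specht lam" and eq: "hat v u0 = hat w u0"
    have "hat (v - w) u0 + hat w u0 = hat v u0" using hat_plus[of "v - w" w u0] by simp
    then have "hat (v - w) u0 = 0" using eq by simp
    then have "v - w = 0" by (rule inj0[OF cfun.subspace_diff[OF sub v w]])
    then show "v = w" by simp
  qed
  moreover have "(\<lambda>v. hat v u0) ` specht lam = U"
  proof (intro equalityI subsetI)
    fix u assume "u \<in> (\<lambda>v. hat v u0) ` specht lam"
    then show "u \<in> U" using hat_closed[OF U(1) rU u0(1)] by blast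
  next
    fix u assume "u \<in> U"
    then obtain f where f: "f \<in> group_algebra n" "u = hat f u0"
      using irreducible_cyclic[OF U u0(1,2)] by blast
    \<comment> \<open>\<open>u0\<close> is fixed by \<open>ysym / kappa\<close>, so \<open>f u0 = (f / kappa) ysym u0\<close>\<close>
    let ?g = "cscale (1 / kappa) f"
    have "?g \<in> group_algebra n" using f(1) by (simp add: group_algebra_def cscale_def)
    moreover have "hat (conv n ?g ysym) u0 = u"
    proof -
      have "hat (conv n ?g ysym) u0 = cscale (1 / kappa) (hat f (cscale kappa u0))"
        by (simp only: hat_conv[OF u0(3)] hat_cscale e0)
      also have "\<dots> = hat f u0" using kappa_nonzero by (simp add: hat_scale[OF u0(3)])
      finally show ?thesis by (simp only: f(2))
    qed
    ultimately show "u \<in> (\<lambda>v. hat v u0) ` specht lam"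
      unfolding specht_eq by (intro image_eqI[of _ _ "conv n ?g ysym"] imageI) auto
  qed
  ultimately have "bij_betw (\<lambda>v. hat v u0) (specht lam) U" by (simp add: bij_betw_def)
  moreover have "hat (left_mult g v) u0 = \<sigma> g (hat v u0)" if "g \<in> carrier (sym_group n)" for g v
    using that u0(3) by (intro hat_left_mult) (auto simp: carrier_perms)
  ultimately show ?thesis
    unfolding isomorphic_representations_def
    by (intro exI[of _ "\<lambda>v. hat v u0"]) (simp add: hat_plus hat_cscale)
qed

text \<open>The image of the Young symmetrizer under an isomorphism is an eigenvector for \<open>kappa\<close>.\<close>

lemma specht_iso_converse:
  assumes U: "U \<subseteq> W" and iso: "isomorphic_representations (sym_group n) (specht lam) left_mult U \<sigma>"
  obtains u' where "u' \<in> U" "hat ysym u' \<noteq> 0"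
proof -
  obtain \<phi> where bij: "bij_betw \<phi> (specht lam) U"
    and add: "\<And>v w. v \<in> specht lam \<Longrightarrow> w \<in> specht lam \<Longrightarrow> \<phi> (v + w) = \<phi> v + \<phi> w"
    and scale: "\<And>c v. v \<in> specht lam \<Longrightarrow> \<phi> (cscale c v) = cscale c (\<phi> v)"
    and act: "\<And>g v. g permutes {1..n} \<Longrightarrow> v \<in> specht lam \<Longrightarrow> \<phi> (left_mult g v) = \<sigma> g (\<phi> v)"
    using iso unfolding isomorphic_representations_def carrier_perms by blast
  have sub: "cfun.subspace (specht lam)"
    and closed: "\<And>g v. g permutes {1..n} \<Longrightarrow> v \<in> specht lam \<Longrightarrow> left_mult g v \<in> specht lam"
    using specht_representation[of lam] unfolding psize sym_representation_iff by blast+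
  have zero: "\<phi> 0 = 0" using scale[of 0 0] cfun.subspace_0[OF sub] by simp
  have sum: "\<phi> (\<Sum>a\<in>A. F a) = (\<Sum>a\<in>A. \<phi> (F a))" if "\<And>a. a \<in> A \<Longrightarrow> F a \<in> specht lam" for A :: "(nat \<Rightarrow> nat) set" and F
    using that
  proof (induction A rule: infinite_finite_induct)
    case (insert a A)
    have "\<phi> (F a + (\<Sum>a\<in>A. F a)) = \<phi> (F a) + \<phi> (\<Sum>a\<in>A. F a)"
      using insert.prems by (intro add cfun.subspace_sum[OF sub]) auto
    then show ?case using insert by (simp only: sum.insert insert_iff simp_thms)
  qed (simp_all only: sum.empty sum.infinite zero simp_thms)
  have "conv n unit_alg ysym = ysym"
  proof
    fix p
    have "conv n unit_alg ysym p = (\<Sum>q\<in>{id}. unit_alg q * ysym (inv' q \<circ> p))"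
      unfolding conv_perms by (rule sum.mono_neutral_right) (auto simp: unit_alg_def permutes_id)
    then show "conv n unit_alg ysym p = ysym p" by (simp add: unit_alg_def)
  qed
  then have mem: "ysym \<in> specht lam" unfolding specht_eq using unit_in_group_algebra by (metis imageI)
  have "hat ysym (\<phi> ysym) = (\<Sum>p\<in>perms n. \<phi> (cscale (ysym p) (left_mult p ysym)))"
    unfolding hat_def using act scale closed mem by (intro sum.cong refl) auto
  also have "\<dots> = \<phi> (\<Sum>p\<in>perms n. cscale (ysym p) (left_mult p ysym))"
    using closed mem by (intro sum[symmetric] cfun.subspace_scale[OF sub]) auto
  also have "(\<Sum>p\<in>perms n. cscale (ysym p) (left_mult p ysym)) = cscale kappa ysym"
  proof
    fix x
    have "(\<Sum>p\<in>perms n. cscale (ysym p) (left_mult p ysym)) x = conv n ysym ysym x"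
      by (simp only: fun_sum_apply cscale_def left_mult_def conv_perms)
    also have "\<dots> = cscale kappa ysym x"
    proof (cases "x permutes {1..n}")
      case False
      then show ?thesis using conv_group_algebra[OF ysym_group_algebra, of ysym] ysym_group_algebra
        by (simp add: group_algebra_def carrier_perms cscale_def)
    qed (simp add: ysym_conv_ysym cscale_def)
    finally show "(\<Sum>p\<in>perms n. cscale (ysym p) (left_mult p ysym)) x = cscale kappa ysym x" .
  qed
  finally have eq: "hat ysym (\<phi> ysym) = cscale kappa (\<phi> ysym)" using scale[OF mem] by simp
  have "ysym \<noteq> 0" using ysym_id by (metis zero_fun_apply zero_neq_one)
  then have "\<phi> ysym \<noteq> 0"
    using inj_onD[OF bij_betw_imp_inj_on[OF bij], of ysym 0] mem cfun.subspace_0[OF sub] zero by auto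
  then have "hat ysym (\<phi> ysym) \<noteq> 0" using eq kappa_nonzero by simp
  moreover have "\<phi> ysym \<in> U" using bij_betwE[OF bij] mem by blast
  ultimately show thesis using that by blast
qed

end

section \<open>Multiplicities as traces\<close>

text \<open>The indicator functions of points, a basis for functions with finite support.\<close>

definition point :: "'x \<Rightarrow> 'x \<Rightarrow> complex" where
  "point x y = (if y = x then 1 else 0)"

text \<open>The projection \<open>P\<close> onto \<open>W\<close> turns traces of operators on \<open>W\<close> into traces on the space of all functions on \<open>X\<close>,
  where they are sums over the basis of points.\<close>

locale tableau_trace = tableau_rep n lam W \<sigma> X
  for n lam and W :: "('x \<Rightarrow> complex) set" and \<sigma> X +
  fixes P :: "('x \<Rightarrow> complex) \<Rightarrow> 'x \<Rightarrow> complex"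
  assumes P_add: "P (f + g) = P f + P g" and P_scale: "P (cscale c f) = cscale c (P f)"
    and P_into: "P f \<in> W" and P_id: "w \<in> W \<Longrightarrow> P w = w"
begin

text \<open>The components of \<open>w\<close> in an internal direct sum.\<close>

definition dec :: "('x \<Rightarrow> complex) set set \<Rightarrow> ('x \<Rightarrow> complex) \<Rightarrow> ('x \<Rightarrow> complex) set \<Rightarrow> 'x \<Rightarrow> complex" where
  "dec \<U> w = inv_into (\<Pi>\<^sub>E U\<in>\<U>. U) (\<lambda>u. \<Sum>U\<in>\<U>. u U) w"

context
  fixes \<U>
  assumes \<U>: "irreducible_decomposition (sym_group n) W \<sigma> \<U>"
begin

lemma finite_dec: "finite \<U>"
  and irr_dec: "U \<in> \<U> \<Longrightarrow> irreducible_representation (sym_group n) U \<sigma>"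
  and bij_dec: "bij_betw (\<lambda>u. \<Sum>U\<in>\<U>. u U) (\<Pi>\<^sub>E U\<in>\<U>. U) W"
  using \<U> by (auto simp: irreducible_decomposition_def)

lemma rep_dec: "U \<in> \<U> \<Longrightarrow> representation (sym_group n) U \<sigma>"
  using irr_dec by (simp add: irreducible_representation_def)

lemma subspace_dec: "U \<in> \<U> \<Longrightarrow> cfun.subspace U"
  using rep_dec by (simp add: sym_representation_iff)

lemma dec_PiE: "w \<in> W \<Longrightarrow> dec \<U> w \<in> (\<Pi>\<^sub>E U\<in>\<U>. U)"
  unfolding dec_def bij_betw_imp_surj_on[OF bij_dec, symmetric] by (rule inv_into_into)

lemma dec_mem: "w \<in> W \<Longrightarrow> U \<in> \<U> \<Longrightarrow> dec \<U> w U \<in> U"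
  using dec_PiE by blast

lemma dec_sum: "w \<in> W \<Longrightarrow> (\<Sum>U\<in>\<U>. dec \<U> w U) = w"
  using bij_betw_inv_into_right[OF bij_dec] unfolding dec_def by blast

lemma dec_unique:
  assumes "u \<in> (\<Pi>\<^sub>E U\<in>\<U>. U)" "(\<Sum>U\<in>\<U>. u U) = w"
  shows "dec \<U> w = u"
  using bij_betw_inv_into_left[OF bij_dec assms(1)] unfolding dec_def assms(2) .

lemma dec_add:
  assumes w: "w \<in> W" "w' \<in> W" and U: "U \<in> \<U>"
  shows "dec \<U> (w + w') U = dec \<U> w U + dec \<U> w' U"
proof -
  have "dec \<U> (w + w') = (\<lambda>U\<in>\<U>. dec \<U> w U + dec \<U> w' U)"
  proof (rule dec_unique)
    show "(\<lambda>U\<in>\<U>. dec \<U> w U + dec \<U> w' U) \<in> (\<Pi>\<^sub>E U\<in>\<U>. U)"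
      using w by (auto intro!: cfun.subspace_add[OF subspace_dec] dec_mem)
    have "(\<Sum>U\<in>\<U>. (\<lambda>U\<in>\<U>. dec \<U> w U + dec \<U> w' U) U) = (\<Sum>U\<in>\<U>. dec \<U> w U + dec \<U> w' U)"
      by (intro sum.cong refl) simp
    then show "(\<Sum>U\<in>\<U>. (\<lambda>U\<in>\<U>. dec \<U> w U + dec \<U> w' U) U) = w + w'"
      by (simp only: sum.distrib dec_sum[OF w(1)] dec_sum[OF w(2)])
  qed
  then show ?thesis using U by simp
qed

lemma dec_scale:
  assumes w: "w \<in> W" and U: "U \<in> \<U>"
  shows "dec \<U> (cscale c w) U = cscale c (dec \<U> w U)"
proof -
  have "dec \<U> (cscale c w) = (\<lambda>U\<in>\<U>. cscale c (dec \<U> w U))"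
  proof (rule dec_unique)
    show "(\<lambda>U\<in>\<U>. cscale c (dec \<U> w U)) \<in> (\<Pi>\<^sub>E U\<in>\<U>. U)"
      using w by (auto intro!: cfun.subspace_scale[OF subspace_dec] dec_mem)
    have "(\<Sum>U\<in>\<U>. (\<lambda>U\<in>\<U>. cscale c (dec \<U> w U)) U) = (\<Sum>U\<in>\<U>. cscale c (dec \<U> w U))"
      by (intro sum.cong refl) simp
    then show "(\<Sum>U\<in>\<U>. (\<lambda>U\<in>\<U>. cscale c (dec \<U> w U)) U) = cscale c w"
      by (simp only: cfun.scale_sum_right[symmetric] dec_sum[OF w])
  qed
  then show ?thesis using U by simp
qed

lemma dec_self:
  assumes U: "U \<in> \<U>" and u: "u \<in> U"
  shows "dec \<U> u U = u" "u \<in> W"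
proof -
  let ?u = "\<lambda>U'\<in>\<U>. if U' = U then u else 0"
  have mem: "?u \<in> (\<Pi>\<^sub>E U\<in>\<U>. U)" using u cfun.subspace_0[OF subspace_dec] by auto
  have sum: "(\<Sum>U'\<in>\<U>. ?u U') = u"
  proof -
    have "(\<Sum>U'\<in>\<U>. ?u U') = (\<Sum>U'\<in>\<U>. if U' = U then u else 0)" by (intro sum.cong refl) simp
    then show ?thesis using finite_dec U by (simp only: sum.delta if_True)
  qed
  from dec_unique[OF mem sum] show "dec \<U> u U = u" using U by simp
  show "u \<in> W" using bij_betwE[OF bij_dec] mem sum by metis
qed

lemma dec_subset: "U \<in> \<U> \<Longrightarrow> U \<subseteq> W"
  using dec_self(2) by blast

text \<open>Project onto \<open>W\<close>, then onto the summand \<open>U\<close>, then apply the idempotent multiple of the Young symmetrizer.\<close>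

definition T :: "('x \<Rightarrow> complex) set \<Rightarrow> ('x \<Rightarrow> complex) \<Rightarrow> 'x \<Rightarrow> complex" where
  "T U f = cscale (1 / kappa) (hat ysym (dec \<U> (P f) U))"

lemma T_add:
  assumes U: "U \<in> \<U>"
  shows "T U (f + g) = T U f + T U g"
proof -
  have "dec \<U> (P f) U \<in> W" "dec \<U> (P g) U \<in> W"
    using dec_mem[OF P_into U] dec_subset[OF U] by blast+
  then show ?thesis
    by (simp only: T_def P_add dec_add[OF P_into P_into U] hat_add cfun.scale_right_distrib)
qed

lemma T_scale:
  assumes U: "U \<in> \<U>"
  shows "T U (cscale c f) = cscale c (T U f)"
proof -
  have "dec \<U> (P f) U \<in> W" using dec_mem[OF P_into U] dec_subset[OF U] by blast
  then show ?thesis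
    by (simp only: T_def P_scale dec_scale[OF P_into U] hat_scale cfun.scale_scale mult.commute)
qed

lemma T_sum:
  assumes U: "U \<in> \<U>"
  shows "T U (\<Sum>a\<in>A. F a) = (\<Sum>a\<in>A. T U (F a))"
proof -
  have zero: "T U 0 = 0" using T_scale[OF U, of 0 0] by simp
  show ?thesis
  proof (induction A rule: infinite_finite_induct)
    case (insert a A)
    then show ?case by (simp only: sum.insert T_add[OF U] simp_thms not_False_eq_True)
  qed (simp_all only: sum.empty sum.infinite zero simp_thms)
qed

text \<open>The operator \<open>T U\<close> is idempotent. If it is nonzero, its image is spanned by a single vector \<open>u0\<close>, so
  \<open>T U f = \<phi> f u0\<close> for a linear form \<open>\<phi>\<close> with \<open>\<phi> u0 = 1\<close>, and the trace is \<open>\<phi> u0\<close>. The form is read off at a point \<open>x0\<close>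
  where \<open>u0\<close> does not vanish.\<close>

lemma trace_T:
  assumes U: "U \<in> \<U>"
  shows "(\<Sum>x\<in>X. T U (point x) x) = (if \<exists>u\<in>U. hat ysym u \<noteq> 0 then 1 else 0)"
proof (cases "\<exists>u\<in>U. hat ysym u \<noteq> 0")
  case False
  then have "T U f = 0" for f using dec_mem[OF P_into U] by (simp add: T_def)
  then show ?thesis using False by simp
next
  case True
  then obtain u' where u': "u' \<in> U" "hat ysym u' \<noteq> 0" by blast
  define u0 where "u0 = hat ysym u'"
  have u0: "u0 \<in> U" "u0 \<noteq> 0" "u0 \<in> W"
    using hat_closed[OF dec_subset[OF U] rep_dec[OF U] u'(1)] u'(2) dec_subset[OF U] by (auto simp: u0_def)
  have e0: "hat ysym u0 = cscale kappa u0" using hat_ysym_ysym[of u'] u'(1) dec_subset[OF U] by (auto simp: u0_def)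
  obtain x0 where x0: "u0 x0 \<noteq> 0" using u0(2) by (auto simp: fun_eq_iff)
  have line: "\<exists>c. T U f = cscale c u0" for f
  proof -
    obtain g where g: "dec \<U> (P f) U = hat g u0"
      using irreducible_cyclic[OF dec_subset[OF U] irr_dec[OF U] u0(1,2)] dec_mem[OF P_into U] by blast
    obtain \<theta> where "hat ysym (hat g (hat ysym u')) = cscale \<theta> (hat ysym u')"
      using hat_sandwich[of u' g] u'(1) dec_subset[OF U] by blast
    then have "T U f = cscale (1 / kappa) (cscale \<theta> u0)" by (simp only: T_def g u0_def)
    then show ?thesis by (metis cfun.scale_scale)
  qed
  have T_point: "T U (point x) x = u0 x * T U (point x) x0 / u0 x0" for x
  proof -
    obtain c where "T U (point x) = cscale c u0" using line by blast
    then show ?thesis using x0 by (simp add: cscale_def)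
  qed
  have expand: "u0 = (\<Sum>x\<in>X. cscale (u0 x) (point x))"
  proof
    fix y
    have "(\<Sum>x\<in>X. cscale (u0 x) (point x)) y = (\<Sum>x\<in>X. if x = y then u0 x else 0)"
      unfolding fun_sum_apply by (intro sum.cong refl) (simp add: cscale_def point_def)
    then show "u0 y = (\<Sum>x\<in>X. cscale (u0 x) (point x)) y"
      using finite_X support[OF u0(3), of y] by (simp add: sum.delta')
  qed
  have "T U u0 = cscale (1 / kappa) (hat ysym u0)"
    by (simp only: T_def P_id[OF u0(3)] dec_self(1)[OF U u0(1)])
  also have "\<dots> = u0" using kappa_nonzero by (simp add: e0)
  finally have "T U u0 = u0" .
  have "(\<Sum>x\<in>X. T U (point x) x) = (\<Sum>x\<in>X. u0 x * T U (point x) x0 / u0 x0)"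
    by (intro sum.cong refl T_point)
  also have "\<dots> = (\<Sum>x\<in>X. u0 x * T U (point x) x0) / u0 x0"
    by (simp only: sum_divide_distrib)
  also have "(\<Sum>x\<in>X. u0 x * T U (point x) x0) = (\<Sum>x\<in>X. cscale (u0 x) (T U (point x)) x0)"
    by (simp only: cscale_def)
  also have "\<dots> = T U (\<Sum>x\<in>X. cscale (u0 x) (point x)) x0"
    by (simp only: T_sum[OF U] T_scale[OF U] fun_sum_apply)
  also have "\<dots> = u0 x0" by (simp only: expand[symmetric] \<open>T U u0 = u0\<close>)
  finally show ?thesis using True x0 by simp
qed

lemma multiplicity_trace:
  "of_nat (card {U \<in> \<U>. isomorphic_representations (sym_group n) (specht lam) left_mult U \<sigma>}) =
    (\<Sum>p\<in>perms n. ysym p * (\<Sum>x\<in>X. \<sigma> p (P (point x)) x)) / kappa"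
proof -
  have iso: "isomorphic_representations (sym_group n) (specht lam) left_mult U \<sigma> \<longleftrightarrow> (\<exists>u\<in>U. hat ysym u \<noteq> 0)"
    if U: "U \<in> \<U>" for U
    using specht_iso[OF dec_subset[OF U] irr_dec[OF U]] specht_iso_converse[OF dec_subset[OF U]] by blast
  have "of_nat (card {U \<in> \<U>. isomorphic_representations (sym_group n) (specht lam) left_mult U \<sigma>}) =
      (\<Sum>U\<in>\<U>. if isomorphic_representations (sym_group n) (specht lam) left_mult U \<sigma> then 1 else 0 :: complex)"
    using finite_dec by (simp add: sum.If_cases Collect_conj_eq)
  also have "\<dots> = (\<Sum>U\<in>\<U>. \<Sum>x\<in>X. T U (point x) x)"
    by (intro sum.cong refl) (simp add: trace_T iso)
  also have "\<dots> = (\<Sum>x\<in>X. (\<Sum>U\<in>\<U>. T U (point x)) x)"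
    unfolding fun_sum_apply by (rule sum.swap)
  also have "\<dots> = (\<Sum>x\<in>X. (\<Sum>p\<in>perms n. ysym p * \<sigma> p (P (point x)) x) / kappa)"
  proof (intro sum.cong refl)
    fix x
    have "(\<Sum>U\<in>\<U>. T U (point x)) = cscale (1 / kappa) (\<Sum>U\<in>\<U>. hat ysym (dec \<U> (P (point x)) U))"
      by (simp only: T_def cfun.scale_sum_right)
    also have "(\<Sum>U\<in>\<U>. hat ysym (dec \<U> (P (point x)) U)) = hat ysym (\<Sum>U\<in>\<U>. dec \<U> (P (point x)) U)"
      using dec_mem[OF P_into] dec_subset by (intro hat_sum[symmetric]) blast
    also have "(\<Sum>U\<in>\<U>. dec \<U> (P (point x)) U) = P (point x)" by (rule dec_sum[OF P_into])
    finally have "(\<Sum>U\<in>\<U>. T U (point x)) x = (1 / kappa) * hat ysym (P (point x)) x"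
      by (simp add: cscale_def)
    also have "hat ysym (P (point x)) x = (\<Sum>p\<in>perms n. ysym p * \<sigma> p (P (point x)) x)"
      by (simp only: hat_def fun_sum_apply cscale_def)
    finally show "(\<Sum>U\<in>\<U>. T U (point x)) x = (\<Sum>p\<in>perms n. ysym p * \<sigma> p (P (point x)) x) / kappa" by simp
  qed
  also have "\<dots> = (\<Sum>x\<in>X. \<Sum>p\<in>perms n. ysym p * \<sigma> p (P (point x)) x) / kappa"
    by (simp only: sum_divide_distrib)
  also have "(\<Sum>x\<in>X. \<Sum>p\<in>perms n. ysym p * \<sigma> p (P (point x)) x) =
      (\<Sum>p\<in>perms n. ysym p * (\<Sum>x\<in>X. \<sigma> p (P (point x)) x))"
    unfolding sum_distrib_left by (rule sum.swap)
  finally show ?thesis .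
qed

end

text \<open>The trace does not depend on the decomposition, so the multiplicity is well defined.\<close>

theorem rep_multiplicity_trace:
  "of_nat (rep_multiplicity (sym_group n) (specht lam) left_mult W \<sigma>) =
    (\<Sum>p\<in>perms n. ysym p * (\<Sum>x\<in>X. \<sigma> p (P (point x)) x)) / kappa"
proof -
  obtain \<U> where \<U>: "irreducible_decomposition (sym_group n) W \<sigma> \<U>"
    using exists_irreducible_decomposition[of n W \<sigma> X] sym_rep_axioms by blast
  let ?m = "\<lambda>\<U>. card {U \<in> \<U>. isomorphic_representations (sym_group n) (specht lam) left_mult U \<sigma>}"
  have "rep_multiplicity (sym_group n) (specht lam) left_mult W \<sigma> = ?m \<U>"
    unfolding rep_multiplicity_def
  proof (rule the_equality)
    show "\<exists>\<V>. irreducible_decomposition (sym_group n) W \<sigma> \<V> \<and> ?m \<U> = ?m \<V>" using \<U> by blast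
    fix m assume "\<exists>\<V>. irreducible_decomposition (sym_group n) W \<sigma> \<V> \<and> m = ?m \<V>"
    then obtain \<V> where \<V>: "irreducible_decomposition (sym_group n) W \<sigma> \<V>" "m = ?m \<V>" by blast
    have "complex_of_nat (?m \<V>) = of_nat (?m \<U>)"
      unfolding multiplicity_trace[OF \<U>] multiplicity_trace[OF \<V>(1)] ..
    then show "m = ?m \<U>" unfolding \<V>(2) of_nat_eq_iff .
  qed
  then show ?thesis using multiplicity_trace[OF \<U>] by simp
qed

end

context young_tableau
begin

lemma specht_outside: "v \<in> specht lam \<Longrightarrow> \<not> p permutes {1..n} \<Longrightarrow> v p = 0"
  using conv_group_algebra[OF ysym_group_algebra] unfolding specht_eq
  by (auto simp: group_algebra_def carrier_perms)

lemma specht_right_unit: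
  assumes "v \<in> specht lam"
  shows "(\<Sum>q\<in>perms n. v q * ysym (inv' q \<circ> x)) / kappa = v x"
proof -
  obtain f where f: "v = conv n f ysym" using assms unfolding specht_eq by blast
  have "conv n v ysym x = kappa * v x"
  proof (cases "x permutes {1..n}")
    case True
    have "conv n v ysym x = conv n f (conv n ysym ysym) x" by (simp only: f conv_assoc)
    also have "\<dots> = (\<Sum>q\<in>perms n. kappa * (f q * ysym (inv' q \<circ> x)))"
      unfolding conv_perms[of f] using True by (intro sum.cong refl) (simp add: ysym_conv_ysym pc)
    also have "\<dots> = kappa * v x" by (simp only: f conv_perms sum_distrib_left)
    finally show ?thesis .
  next
    case False
    then show ?thesis
      using conv_group_algebra[OF ysym_group_algebra, of v] specht_outside[OF assms False]
      by (simp add: group_algebra_def carrier_perms)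
  qed
  then show ?thesis using kappa_nonzero by (simp add: conv_perms)
qed

lemma translate_in_specht:
  assumes "q permutes {1..n}"
  shows "(\<lambda>x. ysym (inv' q \<circ> x) / kappa) \<in> specht lam"
proof -
  let ?f = "cscale (1 / kappa) (point q)"
  have "?f \<in> group_algebra n" using assms by (auto simp: group_algebra_def carrier_perms cscale_def point_def)
  moreover have "conv n ?f ysym = (\<lambda>x. ysym (inv' q \<circ> x) / kappa)"
  proof
    fix x
    have "conv n ?f ysym x = (\<Sum>s\<in>perms n. if s = q then ysym (inv' q \<circ> x) / kappa else 0)"
      unfolding conv_perms by (intro sum.cong refl) (simp add: cscale_def point_def)
    then show "conv n ?f ysym x = ysym (inv' q \<circ> x) / kappa" using assms by simp
  qed
  ultimately show ?thesis unfolding specht_eq by (metis imageI)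
qed

end

section \<open>Kronecker coefficients as inner products\<close>

text \<open>The projection onto the tensor product is right multiplication by the two idempotents, one on
  each factor. Its composition with a group element has the product of the two characters as its trace.\<close>

theorem kronecker_ip:
  assumes lam: "partition_of n lam" and mu: "partition_of n \<mu>" and nu: "partition_of n \<nu>"
  shows "of_nat (kronecker \<mu> \<nu> lam) = ip n (schur n lam) (\<lambda>p. schur n \<mu> p * schur n \<nu> p)"
proof -
  interpret L: young_tableau n lam by standard (rule lam)
  interpret M: young_tableau n \<mu> by standard (rule mu)
  interpret N: young_tableau n \<nu> by standard (rule nu)
  let ?W = "tensor_space (specht \<mu>) (specht \<nu>)"
  \<comment> \<open>right multiplication by the two idempotents, applied to group elements\<close>
  define eM where "eM q x = young_symmetrizer \<mu> (inv' q \<circ> x) / M.kappa" for q x :: "nat \<Rightarrow> nat"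
  define eN where "eN q x = young_symmetrizer \<nu> (inv' q \<circ> x) / N.kappa" for q x :: "nat \<Rightarrow> nat"
  define P where "P F = (\<Sum>q\<in>perms n \<times> perms n. cscale (F q) (tensor (eM (fst q)) (eN (snd q))))"
    for F :: "(nat \<Rightarrow> nat) \<times> (nat \<Rightarrow> nat) \<Rightarrow> complex"
  have repM: "representation (sym_group n) (specht \<mu>) left_mult"
    using specht_representation[of \<mu>] by (simp only: M.psize)
  have repN: "representation (sym_group n) (specht \<nu>) left_mult"
    using specht_representation[of \<nu>] by (simp only: N.psize)
  have rep: "representation (sym_group n) ?W diag_mult" by (rule tensor_representation[OF repM repN])
  have supp: "F x = 0" if "F \<in> ?W" "x \<notin> perms n \<times> perms n" for F x
    using that(1) unfolding tensor_space_def
  proof (induction rule: cfun.span_induct_alt)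
    case (step c F G)
    then obtain v w where vw: "F = tensor v w" "v \<in> specht \<mu>" "w \<in> specht \<nu>" by blast
    have "F x = v (fst x) * w (snd x)" by (simp add: vw(1) tensor_def split_beta)
    then have "F x = 0"
      using that(2) M.specht_outside[OF vw(2)] N.specht_outside[OF vw(3)] by (auto simp: mem_Times_iff)
    then show ?case using step by (simp add: cscale_def)
  qed simp
  have P_add: "P (F + G) = P F + P G" for F G
    by (simp only: P_def plus_fun_apply cfun.scale_left_distrib sum.distrib)
  have P_scale: "P (cscale c F) = cscale c (P F)" for c F
  proof -
    have "P (cscale c F) = (\<Sum>q\<in>perms n \<times> perms n. cscale c (cscale (F q) (tensor (eM (fst q)) (eN (snd q)))))"
      unfolding P_def by (intro sum.cong refl) (simp add: cscale_def mult.assoc)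
    then show ?thesis by (simp only: P_def cfun.scale_sum_right)
  qed
  have P_into: "P F \<in> ?W" for F
    unfolding P_def tensor_space_def
  proof (intro cfun.span_sum cfun.span_scale cfun.span_base)
    fix q assume "q \<in> perms n \<times> perms n"
    then have "fst q permutes {1..n}" "snd q permutes {1..n}" by auto
    then have "eM (fst q) \<in> specht \<mu>" "eN (snd q) \<in> specht \<nu>"
      unfolding eM_def eN_def using M.translate_in_specht N.translate_in_specht by blast+
    then show "tensor (eM (fst q)) (eN (snd q)) \<in> {tensor v w |v w. v \<in> specht \<mu> \<and> w \<in> specht \<nu>}" by blast
  qed
  have P_apply: "P F (x, y) = (\<Sum>a\<in>perms n. \<Sum>b\<in>perms n. F (a, b) * (eM a x * eN b y))" for F x y
    by (simp add: P_def fun_sum_apply cscale_def tensor_def sum.cartesian_product split_beta)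
  have P_tensor: "P (tensor v w) = tensor v w" if v: "v \<in> specht \<mu>" and w: "w \<in> specht \<nu>" for v w
  proof
    fix z :: "(nat \<Rightarrow> nat) \<times> (nat \<Rightarrow> nat)"
    obtain x y where z: "z = (x, y)" by (cases z)
    have "P (tensor v w) (x, y) = (\<Sum>a\<in>perms n. \<Sum>b\<in>perms n. (v a * eM a x) * (w b * eN b y))"
      unfolding P_apply by (intro sum.cong refl) (simp add: tensor_def)
    also have "\<dots> = (\<Sum>a\<in>perms n. v a * eM a x) * (\<Sum>b\<in>perms n. w b * eN b y)"
      by (simp only: sum_product)
    also have "\<dots> = v x * w y"
      using M.specht_right_unit[OF v, of x] N.specht_right_unit[OF w, of y]
      by (simp add: eM_def eN_def sum_divide_distrib)
    finally show "P (tensor v w) z = tensor v w z" by (simp add: z tensor_def)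
  qed
  have P_0: "P 0 = 0" using P_scale[of 0 0] by simp
  have P_id: "P F = F" if "F \<in> ?W" for F
    using that unfolding tensor_space_def
  proof (induction rule: cfun.span_induct_alt)
    case base
    show ?case by (rule P_0)
  next
    case (step c F G)
    then have "P F = F" using P_tensor by blast
    with step show ?case by (simp only: P_add P_scale)
  qed
  interpret K: tableau_trace n lam ?W diag_mult "perms n \<times> perms n" P
    by (intro tableau_trace.intro tableau_rep.intro sym_rep.intro tableau_trace_axioms.intro
        L.young_tableau_axioms rep supp P_add P_scale P_into P_id) simp_all
  have tr: "(\<Sum>z\<in>perms n \<times> perms n. diag_mult p (P (point z)) z) = M.ychar p * N.ychar p" for p
  proof -
    have "(\<Sum>z\<in>perms n \<times> perms n. diag_mult p (P (point z)) z) =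
        (\<Sum>x\<in>perms n. \<Sum>y\<in>perms n. P (point (x, y)) (inv' p \<circ> x, inv' p \<circ> y))"
      by (simp add: diag_mult_def sum.cartesian_product split_beta)
    also have "\<dots> = (\<Sum>x\<in>perms n. \<Sum>y\<in>perms n. eM x (inv' p \<circ> x) * eN y (inv' p \<circ> y))"
    proof (intro sum.cong refl)
      fix x y assume x: "x \<in> perms n" and y: "y \<in> perms n"
      have "P (point (x, y)) (inv' p \<circ> x, inv' p \<circ> y) =
          (\<Sum>a\<in>perms n. \<Sum>b\<in>perms n. (if a = x then eM a (inv' p \<circ> x) else 0) *
            (if b = y then eN b (inv' p \<circ> y) else 0))"
        unfolding P_apply by (intro sum.cong refl) (simp add: point_def)
      also have "\<dots> = (\<Sum>a\<in>perms n. if a = x then eM a (inv' p \<circ> x) else 0) *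
          (\<Sum>b\<in>perms n. if b = y then eN b (inv' p \<circ> y) else 0)"
        by (simp only: sum_product)
      also have "\<dots> = eM x (inv' p \<circ> x) * eN y (inv' p \<circ> y)"
        using x y by simp
      finally show "P (point (x, y)) (inv' p \<circ> x, inv' p \<circ> y) = eM x (inv' p \<circ> x) * eN y (inv' p \<circ> y)" .
    qed
    also have "\<dots> = (\<Sum>x\<in>perms n. eM x (inv' p \<circ> x)) * (\<Sum>y\<in>perms n. eN y (inv' p \<circ> y))"
      by (simp only: sum_product)
    finally show ?thesis
      by (simp add: eM_def eN_def M.ychar_def N.ychar_def sum_divide_distrib comp_assoc)
  qed
  have "of_nat (kronecker \<mu> \<nu> lam) = (\<Sum>p\<in>perms n. young_symmetrizer lam p * (M.ychar p * N.ychar p)) / L.kappa"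
    unfolding kronecker_def L.psize K.rep_multiplicity_trace tr ..
  also have "\<dots> = ip n L.ychar (\<lambda>p. M.ychar p * N.ychar p)"
    by (rule L.ip_ychar[symmetric]) (simp add: M.ychar_conj N.ychar_conj)
  also have "\<dots> = ip n (schur n lam) (\<lambda>p. schur n \<mu> p * schur n \<nu> p)"
    by (rule ip_cong) (simp_all add: L.ychar_eq_schur M.ychar_eq_schur N.ychar_eq_schur)
  finally show ?thesis .
qed

section \<open>Characters stable in the degree\<close>

lemma psize_eq_sum:
  assumes "\<And>i. m \<le> i \<Longrightarrow> v i = 0"
  shows "psize v = (\<Sum>i<m. v i)"
  unfolding psize_def
proof (rule sum.mono_neutral_left)
  show "{i. v i \<noteq> 0} \<subseteq> {..<m}" using assms by (metis (mono_tags) lessThan_iff mem_Collect_eq not_less subsetI)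
qed auto

lemma finite_support_bound:
  fixes v :: "nat \<Rightarrow> nat"
  assumes "finite {i. v i \<noteq> (0 :: nat)}"
  obtains m where "\<And>i. m \<le> i \<Longrightarrow> v i = 0"
proof -
  obtain m where m: "\<forall>i\<in>{i. v i \<noteq> 0}. i < m"
    using assms unfolding finite_nat_set_iff_bounded by (rule exE)
  have "v i = 0" if "m \<le> i" for i
  proof (rule ccontr)
    assume "v i \<noteq> 0"
    then have "i < m" using m by simp
    with \<open>m \<le> i\<close> show False by simp
  qed
  then show thesis by (rule that)
qed

text \<open>The sequence \<open>v[n]\<close> with an integer, possibly negative, first term.\<close>

definition padded :: "nat \<Rightarrow> (nat \<Rightarrow> nat) \<Rightarrow> nat \<Rightarrow> int" where
  "padded n v = case_nat (int n - int (psize v)) (\<lambda>i. int (v i))"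

lemma padded_simps [simp]: "padded n v 0 = int n - int (psize v)" "padded n v (Suc i) = int (v i)"
  by (simp_all add: padded_def)

text \<open>The Jacobi--Trudi determinant of \<open>\<gamma>[n]\<close>, defined for every \<open>n\<close>.\<close>

definition stable_char :: "(nat \<Rightarrow> nat) \<Rightarrow> nat \<Rightarrow> (nat \<Rightarrow> nat) \<Rightarrow> complex" where
  "stable_char \<gamma> n = alternant (Suc (plength \<gamma>)) n (\<lambda>i. padded n \<gamma> i - int i)"

definition stable_span :: "(nat \<Rightarrow> (nat \<Rightarrow> nat) \<Rightarrow> complex) set" where
  "stable_span = {F. \<exists>B g. finite B \<and> (\<forall>\<gamma>\<in>B. is_partition \<gamma>) \<and>
     (\<forall>n p. p permutes {1..n} \<longrightarrow> F n p = (\<Sum>\<gamma>\<in>B. g \<gamma> * stable_char \<gamma> n p))}"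

lemma stable_span_char: "is_partition \<gamma> \<Longrightarrow> stable_char \<gamma> \<in> stable_span"
  unfolding stable_span_def by (intro CollectI exI[of _ "{\<gamma>}"] exI[of _ "\<lambda>_. 1"]) simp

lemma stable_span_cong:
  assumes "F \<in> stable_span" "\<And>n p. p permutes {1..n} \<Longrightarrow> G n p = F n p"
  shows "G \<in> stable_span"
proof -
  obtain B g where "finite B" "\<forall>\<gamma>\<in>B. is_partition \<gamma>"
    "\<forall>n p. p permutes {1..n} \<longrightarrow> F n p = (\<Sum>\<gamma>\<in>B. g \<gamma> * stable_char \<gamma> n p)"
    using assms(1) unfolding stable_span_def by blast
  then show ?thesis unfolding stable_span_def using assms(2)
    by (intro CollectI exI[of _ B] exI[of _ g]) simp
qed

lemma stable_span_lincomb: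
  assumes A: "finite A" and F: "\<And>a. a \<in> A \<Longrightarrow> F a \<in> stable_span"
  shows "(\<lambda>n p. \<Sum>a\<in>A. c a * F a n p) \<in> stable_span"
proof -
  let ?rep = "\<lambda>a Bg. finite (fst Bg) \<and> (\<forall>\<gamma>\<in>fst Bg. is_partition \<gamma>) \<and>
     (\<forall>n p. p permutes {1..n} \<longrightarrow> F a n p = (\<Sum>\<gamma>\<in>fst Bg. snd Bg \<gamma> * stable_char \<gamma> n p))"
  have "\<forall>a\<in>A. \<exists>Bg. ?rep a Bg"
    using F unfolding stable_span_def by simp
  from bchoice[OF this] obtain Bg where Bg: "\<forall>a\<in>A. ?rep a (Bg a)" by blast
  define B where "B a = fst (Bg a)" for a
  define g where "g a = snd (Bg a)" for a
  have B: "\<And>a. a \<in> A \<Longrightarrow> finite (B a)" "\<And>a \<gamma>. a \<in> A \<Longrightarrow> \<gamma> \<in> B a \<Longrightarrow> is_partition \<gamma>"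
    and g: "\<And>a n p. a \<in> A \<Longrightarrow> p permutes {1..n} \<Longrightarrow> F a n p = (\<Sum>\<gamma>\<in>B a. g a \<gamma> * stable_char \<gamma> n p)"
    using Bg by (simp_all add: B_def g_def)
  let ?B = "\<Union>a\<in>A. B a"
  have fin: "finite ?B" using A B(1) by blast
  let ?h = "\<lambda>\<gamma>. \<Sum>a\<in>A. c a * (if \<gamma> \<in> B a then g a \<gamma> else 0)"
  have "(\<Sum>a\<in>A. c a * F a n p) = (\<Sum>\<gamma>\<in>?B. ?h \<gamma> * stable_char \<gamma> n p)" if p: "p permutes {1..n}" for n p
  proof -
    have "F a n p = (\<Sum>\<gamma>\<in>?B. (if \<gamma> \<in> B a then g a \<gamma> else 0) * stable_char \<gamma> n p)" if a: "a \<in> A" for a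
      unfolding g[OF a p] using a by (intro sum.mono_neutral_cong_left fin) auto
    then have "(\<Sum>a\<in>A. c a * F a n p) =
        (\<Sum>a\<in>A. \<Sum>\<gamma>\<in>?B. c a * (if \<gamma> \<in> B a then g a \<gamma> else 0) * stable_char \<gamma> n p)"
      by (intro sum.cong refl) (simp add: sum_distrib_left mult.assoc)
    also have "\<dots> = (\<Sum>\<gamma>\<in>?B. \<Sum>a\<in>A. c a * (if \<gamma> \<in> B a then g a \<gamma> else 0) * stable_char \<gamma> n p)"
      by (rule sum.swap)
    finally show ?thesis by (simp only: sum_distrib_right)
  qed
  then show ?thesis unfolding stable_span_def using fin B(2)
    by (intro CollectI exI[of _ ?B] exI[of _ ?h]) blast
qed

text \<open>The value at \<open>p\<close> is the number of \<open>p\<close>-invariant families of disjoint subsets of \<open>{1..n}\<close> of sizes \<open>v 0, v 1, \<dots>\<close>: color 0 is given to the elements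
  outside all of them.\<close>

definition stable_perm :: "(nat \<Rightarrow> nat) \<Rightarrow> nat \<Rightarrow> (nat \<Rightarrow> nat) \<Rightarrow> complex" where
  "stable_perm v n = perm_char n (padded n v)"

definition shift_ok :: "(nat \<Rightarrow> nat) \<Rightarrow> (nat \<Rightarrow> nat) \<Rightarrow> bool" where
  "shift_ok v w \<longleftrightarrow> (\<forall>i<plength v. 0 \<le> int (v i) - int (Suc i) + int (w (Suc i)))"

text \<open>The rows below the first in one term of the Jacobi--Trudi determinant. The first row is recovered from \<open>n\<close>, since the
  total is fixed; this is what makes the expansion of \<open>stable_char\<close> independent of \<open>n\<close>.\<close>

definition shift_tail :: "(nat \<Rightarrow> nat) \<Rightarrow> (nat \<Rightarrow> nat) \<Rightarrow> nat \<Rightarrow> nat" where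
  "shift_tail v w i = (if i < plength v then nat (int (v i) - int (Suc i) + int (w (Suc i))) else 0)"

lemma shift_tail_finite: "finite {i. shift_tail v w i \<noteq> 0}"
  by (rule finite_subset[of _ "{..<plength v}"]) (auto simp: shift_tail_def split: if_splits)

lemma psize_shift_tail:
  assumes v: "is_partition v" and w: "w permutes {..<Suc (plength v)}" and ok: "shift_ok v w"
  shows "int (psize (shift_tail v w)) = int (psize v) - int (w 0)"
proof -
  let ?l = "plength v"
  have "psize (shift_tail v w) = (\<Sum>i<?l. shift_tail v w i)"
    by (rule psize_eq_sum) (simp add: shift_tail_def)
  then have "int (psize (shift_tail v w)) = (\<Sum>i<?l. int (v i) - int (Suc i) + int (w (Suc i)))"
    using ok by (simp add: shift_tail_def shift_ok_def)
  also have "\<dots> = int (\<Sum>i<?l. v i) + ((\<Sum>i<?l. int (w (Suc i))) - (\<Sum>i<?l. int (Suc i)))"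
    by (simp only: sum.distrib sum_subtractf of_nat_sum)
  also have "(\<Sum>i<?l. v i) = psize v" by (rule sum_partition[OF v order_refl])
  also have "(\<Sum>i<?l. int (w (Suc i))) - (\<Sum>i<?l. int (Suc i)) = - int (w 0)"
  proof -
    have "(\<Sum>i<Suc ?l. int (w i)) = (\<Sum>i<Suc ?l. int i)"
      using sum.permute[OF w, of int] by (simp only: comp_def)
    then have "int (w 0) + (\<Sum>i<?l. int (w (Suc i))) = int 0 + (\<Sum>i<?l. int (Suc i))"
      by (simp only: sum.lessThan_Suc_shift)
    then show ?thesis by simp
  qed
  finally show ?thesis by simp
qed

lemma stable_char_expand:
  assumes v: "is_partition v"
  shows "stable_char v n p = (\<Sum>w | w permutes {..<Suc (plength v)}.
    (if shift_ok v w then of_int (sign w) else 0) * stable_perm (shift_tail v w) n p)"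
  unfolding stable_char_def alternant_def
proof (rule sum.cong[OF refl])
  fix w assume "w \<in> {w. w permutes {..<Suc (plength v)}}"
  then have w: "w permutes {..<Suc (plength v)}" by simp
  let ?s = "shifted (Suc (plength v)) (\<lambda>i. padded n v i - int i) w"
  show "of_int (sign w) * perm_char n ?s p =
      (if shift_ok v w then of_int (sign w) else 0) * stable_perm (shift_tail v w) n p"
  proof (cases "shift_ok v w")
    case True
    have "?s c = padded n (shift_tail v w) c" for c
    proof (cases c)
      case 0
      then show ?thesis using psize_shift_tail[OF v w True] by (simp add: shifted_def)
    next
      case (Suc i)
      then show ?thesis using True by (simp add: shifted_def shift_tail_def shift_ok_def)
    qed
    then have "?s = padded n (shift_tail v w)" by blast
    then show ?thesis using True by (simp add: stable_perm_def)
  next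
    case False
    then obtain i where "i < plength v" "int (v i) - int (Suc i) + int (w (Suc i)) < 0"
      by (auto simp: shift_ok_def not_le)
    then have "?s (Suc i) < 0" by (simp add: shifted_def)
    then show ?thesis using False by (simp add: perm_char_neg)
  qed
qed

lemma psize_permute:
  assumes "bij \<sigma>"
  shows "psize (\<lambda>i. v (\<sigma> i)) = psize v"
  unfolding psize_def
proof (rule sum.reindex_bij_witness[of _ "inv' \<sigma>" \<sigma>])
qed (use assms in \<open>auto simp: bij_is_inj bij_is_surj surj_f_inv_f\<close>)

lemma stable_perm_permute:
  assumes \<sigma>: "bij \<sigma>" and p: "p permutes {1..n}"
  shows "stable_perm (\<lambda>i. v (\<sigma> i)) n p = stable_perm v n p"
proof -
  \<comment> \<open>color 0 stays in place\<close>
  define \<pi> where "\<pi> = case_nat 0 (\<lambda>i. Suc (\<sigma> i))"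
  have "bij \<pi>"
  proof (rule o_bij[of "case_nat 0 (\<lambda>i. Suc (inv' \<sigma> i))"])
    show "case_nat 0 (\<lambda>i. Suc (inv' \<sigma> i)) \<circ> \<pi> = id"
      using \<sigma> by (auto simp: \<pi>_def fun_eq_iff bij_is_inj split: nat.split)
    show "\<pi> \<circ> case_nat 0 (\<lambda>i. Suc (inv' \<sigma> i)) = id"
      using \<sigma> by (auto simp: \<pi>_def fun_eq_iff bij_is_surj surj_f_inv_f split: nat.split)
  qed
  moreover have "padded n (\<lambda>i. v (\<sigma> i)) = (\<lambda>c. padded n v (\<pi> c))"
    using psize_permute[OF \<sigma>, of v] by (auto simp: fun_eq_iff padded_def \<pi>_def split: nat.split)
  ultimately show ?thesis by (simp only: stable_perm_def perm_char_reindex[OF _ p])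
qed

lemma rearrange_to_partition:
  assumes "finite {i. v i \<noteq> (0 :: nat)}"
  obtains \<sigma> :: "nat \<Rightarrow> nat" where "bij \<sigma>" "is_partition (\<lambda>i. v (\<sigma> i))"
proof -
  obtain m where m: "\<And>i. m \<le> i \<Longrightarrow> v i = 0" using finite_support_bound[OF assms] by blast
  define xs where "xs = rev (sort (map v [0..<m]))"
  have "mset xs = mset (map v [0..<m])" by (simp add: xs_def)
  then obtain \<sigma> where \<sigma>: "\<sigma> permutes {..<length (map v [0..<m])}" "permute_list \<sigma> (map v [0..<m]) = xs"
    by (rule mset_eq_permutation)
  then have \<sigma>m: "\<sigma> permutes {..<m}" by simp
  have nth: "xs ! i = v (\<sigma> i)" if "i < m" for i
    using \<sigma> that permutes_lessThan[OF \<sigma>m, of i] by (auto simp: permute_list_def)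
  have len: "length xs = m" by (simp add: xs_def)
  have desc: "v (\<sigma> j) \<le> v (\<sigma> i)" if "i \<le> j" for i j
  proof (cases "j < m")
    case True
    have "sorted (rev xs)" by (simp add: xs_def)
    then have "xs ! j \<le> xs ! i" using sorted_rev_nth_mono[of xs i j] that True len by simp
    then show ?thesis using that True by (simp add: nth)
  next
    case False
    then have "\<sigma> j = j" using permutes_not_in[OF \<sigma>m] by simp
    then show ?thesis using m False by simp
  qed
  have "{i. v (\<sigma> i) \<noteq> 0} \<subseteq> {..<m}"
  proof
    fix i assume "i \<in> {i. v (\<sigma> i) \<noteq> 0}"
    then have "\<sigma> i < m" using m[of "\<sigma> i"] by (cases "m \<le> \<sigma> i") auto
    then show "i \<in> {..<m}" using permutes_lessThan[OF \<sigma>m] by simp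
  qed
  then have "is_partition (\<lambda>i. v (\<sigma> i))"
    unfolding is_partition_def using desc by (auto simp: antimono_def intro: finite_subset)
  then show thesis by (rule that[OF permutes_bij[OF \<sigma>m]])
qed

text \<open>Together with the size, this drives the induction by which permutation characters are expressed in stable characters.\<close>

definition sqsum :: "(nat \<Rightarrow> nat) \<Rightarrow> nat" where
  "sqsum v = (\<Sum>i | v i \<noteq> 0. (v i)\<^sup>2)"

lemma sqsum_eq_sum:
  assumes "\<And>i. m \<le> i \<Longrightarrow> v i = 0"
  shows "sqsum v = (\<Sum>i<m. (v i)\<^sup>2)"
  unfolding sqsum_def
proof (rule sum.mono_neutral_left)
  show "{i. v i \<noteq> 0} \<subseteq> {..<m}" using assms by (metis (mono_tags) lessThan_iff mem_Collect_eq not_less subsetI)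
qed auto

lemma sqsum_permute:
  assumes "bij \<sigma>"
  shows "sqsum (\<lambda>i. v (\<sigma> i)) = sqsum v"
  unfolding sqsum_def
proof (rule sum.reindex_bij_witness[of _ "inv' \<sigma>" \<sigma>])
qed (use assms in \<open>auto simp: bij_is_inj bij_is_surj surj_f_inv_f\<close>)

lemma sqsum_le:
  assumes "finite {i. v i \<noteq> (0 :: nat)}"
  shows "sqsum v \<le> (psize v)\<^sup>2"
proof -
  have "v i \<le> psize v" if "v i \<noteq> 0" for i
    unfolding psize_def using assms that by (intro member_le_sum) auto
  then have "sqsum v \<le> (\<Sum>i | v i \<noteq> 0. v i * psize v)"
    unfolding sqsum_def power2_eq_square by (intro sum_mono) auto
  also have "\<dots> = (psize v)\<^sup>2" by (simp only: psize_def power2_eq_square sum_distrib_right)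
  finally show ?thesis .
qed

lemma sqsum_shift_tail:
  assumes v: "is_partition v" and w: "w permutes {..<Suc (plength v)}" and ok: "shift_ok v w"
    and w0: "w 0 = 0" and "w \<noteq> id"
  shows "sqsum v < sqsum (shift_tail v w)"
proof -
  let ?l = "plength v"
  let ?a = "case_nat (int (v 0)) (\<lambda>i. int (v i)) :: nat \<Rightarrow> int"
  have anti: "v j \<le> v i" if "i \<le> j" for i j using v that by (auto simp: is_partition_def dest: antimonoD)
  have "antimono ?a"
    unfolding antimono_def using anti by (auto split: nat.split)
  from permuted_staircase_squares[OF this w \<open>w \<noteq> id\<close>]
  have "(\<Sum>i<?l. (int (v i))\<^sup>2) < (\<Sum>i<?l. (int (v i) + int (w (Suc i)) - int (Suc i))\<^sup>2)"
    unfolding sum.lessThan_Suc_shift by (simp add: w0)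
  moreover have "(\<Sum>i<?l. (int (v i) + int (w (Suc i)) - int (Suc i))\<^sup>2) = (\<Sum>i<?l. (int (shift_tail v w i))\<^sup>2)"
    using ok by (intro sum.cong refl) (simp add: shift_tail_def shift_ok_def algebra_simps)
  moreover have "(\<Sum>i<?l. (int (v i))\<^sup>2) = int (sqsum v)"
    using sqsum_eq_sum[of ?l v] v by (simp add: partition_eq_0_iff)
  moreover have "(\<Sum>i<?l. (int (shift_tail v w i))\<^sup>2) = int (sqsum (shift_tail v w))"
    using sqsum_eq_sum[of ?l "shift_tail v w"] by (simp add: shift_tail_def)
  ultimately show ?thesis by simp
qed

lemma shift_tail_id: "is_partition v \<Longrightarrow> shift_ok v id \<and> shift_tail v id = v"
  by (auto simp: shift_ok_def shift_tail_def fun_eq_iff partition_eq_0_iff)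

text \<open>In the determinant of \<open>v[n]\<close> the identity contributes \<open>stable_perm v\<close>. Any other permutation either moves the first row,
  and then the remaining rows have smaller size, or fixes it, and then they have the same size and a larger sum of squares.
  So \<open>stable_perm v\<close> can be solved for by induction. The order of the entries of \<open>v\<close> does not matter, so \<open>v\<close> may be sorted.\<close>

lemma stable_perm_in_span:
  assumes "finite {i. v i \<noteq> (0 :: nat)}"
  shows "stable_perm v \<in> stable_span"
proof -
  \<comment> \<open>smaller size first, then larger sum of squares, which is bounded by the square of the size\<close>
  define r where "r = measures [psize, \<lambda>v. (psize v)\<^sup>2 - sqsum v]"
  have "wf r" by (simp add: r_def)
  then show ?thesis using assms
  proof (induction v rule: wf_induct_rule)
    case (less u)
    obtain \<sigma> :: "nat \<Rightarrow> nat" where \<sigma>: "bij \<sigma>" "is_partition (\<lambda>i. u (\<sigma> i))" using rearrange_to_partition less.prems by blast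
    define v where "v = (\<lambda>i. u (\<sigma> i))"
    have v: "is_partition v" using \<sigma> by (simp add: v_def)
    have uv: "psize v = psize u" "sqsum v = sqsum u"
      using psize_permute[OF \<sigma>(1)] sqsum_permute[OF \<sigma>(1)] by (simp_all add: v_def)
    let ?W = "{w. w permutes {..<Suc (plength v)}}"
    let ?c = "\<lambda>w. if shift_ok v w then of_int (sign w) else 0 :: complex"
    have fin: "finite ?W" by (simp add: finite_permutations)
    have IH: "stable_perm (shift_tail v w) \<in> stable_span" if w: "w \<in> ?W" "w \<noteq> id" "shift_ok v w" for w
    proof (rule less.IH)
      have w': "w permutes {..<Suc (plength v)}" using w by simp
      have size: "int (psize (shift_tail v w)) = int (psize u) - int (w 0)"
        using psize_shift_tail[OF v w' w(3)] uv by simp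
      show "(shift_tail v w, u) \<in> r"
      proof (cases "w 0 = 0")
        case True
        have "sqsum u < sqsum (shift_tail v w)" using sqsum_shift_tail[OF v w' w(3) True w(2)] uv by simp
        moreover have "sqsum (shift_tail v w) \<le> (psize u)\<^sup>2"
          using sqsum_le[OF shift_tail_finite, of v w] size True by simp
        ultimately show ?thesis using size True by (simp add: r_def)
      next
        case False
        then show ?thesis using size by (simp add: r_def)
      qed
      show "finite {i. shift_tail v w i \<noteq> 0}" by (rule shift_tail_finite)
    qed
    have eq: "stable_perm u n p = stable_char v n p +
        (\<Sum>w\<in>?W - {id}. - ?c w * stable_perm (shift_tail v w) n p)" if p: "p permutes {1..n}" for n p
    proof -
      have "stable_char v n p = ?c id * stable_perm (shift_tail v id) n p +
          (\<Sum>w\<in>?W - {id}. ?c w * stable_perm (shift_tail v w) n p)"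
        unfolding stable_char_expand[OF v] by (rule sum.remove[OF fin]) (simp add: permutes_id)
      moreover have "?c id * stable_perm (shift_tail v id) n p = stable_perm u n p"
        using shift_tail_id[OF v] stable_perm_permute[OF \<sigma>(1) p, of u] by (simp add: v_def)
      ultimately show ?thesis by (simp add: sum_negf)
    qed
    have "(\<lambda>n p. \<Sum>w\<in>{w \<in> ?W - {id}. shift_ok v w}. - ?c w * stable_perm (shift_tail v w) n p) \<in> stable_span"
      using fin IH by (intro stable_span_lincomb) auto
    moreover have "(\<Sum>w\<in>{w \<in> ?W - {id}. shift_ok v w}. - ?c w * stable_perm (shift_tail v w) n p) =
        (\<Sum>w\<in>?W - {id}. - ?c w * stable_perm (shift_tail v w) n p)" for n p
      using fin by (intro sum.mono_neutral_left) auto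
    ultimately have rest: "(\<lambda>n p. \<Sum>w\<in>?W - {id}. - ?c w * stable_perm (shift_tail v w) n p) \<in> stable_span"
      by simp
    have "(\<lambda>n p. \<Sum>b\<in>{True, False}. 1 * (if b then stable_char v n p else
        (\<Sum>w\<in>?W - {id}. - ?c w * stable_perm (shift_tail v w) n p))) \<in> stable_span"
      by (rule stable_span_lincomb[where F = "\<lambda>b. if b then stable_char v else
        (\<lambda>n p. \<Sum>w\<in>?W - {id}. - ?c w * stable_perm (shift_tail v w) n p)" and c = "\<lambda>_. 1", simplified if_distribR])
        (use rest stable_span_char[OF v] in auto)
    then show ?case by (rule stable_span_cong) (simp add: eq)
  qed
qed

section \<open>Products of stable characters\<close>

text \<open>Sizes of the intersections of two families of disjoint sets, bordered by the sizes of the parts of each set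
  that lie outside the other family (index 0). The number of elements outside both families is not recorded: it sits at the
  corner, set to 0 here, and is the only entry that depends on \<open>n\<close>.\<close>

definition tables :: "nat \<Rightarrow> nat \<Rightarrow> (nat \<Rightarrow> nat) \<Rightarrow> (nat \<Rightarrow> nat) \<Rightarrow> (nat \<times> nat \<Rightarrow> nat) set" where
  "tables k l u v = {e. e (0, 0) = 0 \<and> (\<forall>x. x \<notin> {..k} \<times> {..l} \<longrightarrow> e x = 0) \<and>
     (\<forall>a<k. (\<Sum>b\<le>l. e (Suc a, b)) = u a) \<and> (\<forall>b<l. (\<Sum>a\<le>k. e (a, Suc b)) = v b)}"

lemma finite_tables: "finite (tables k l u v)"
proof (rule finite_subset)
  let ?M = "(\<Sum>a<k. u a) + (\<Sum>b<l. v b)"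
  show "tables k l u v \<subseteq> {e. \<forall>x. (x \<in> {..k} \<times> {..l} \<longrightarrow> e x \<in> {..?M}) \<and>
      (x \<notin> {..k} \<times> {..l} \<longrightarrow> e x = 0)}"
  proof (intro subsetI CollectI allI conjI impI)
    fix e x assume e: "e \<in> tables k l u v" and x: "x \<in> {..k} \<times> {..l}"
    obtain a b where ab: "x = (a, b)" "a \<le> k" "b \<le> l" using x by auto
    consider "a = 0" "b = 0" | a' where "a = Suc a'" | b' where "b = Suc b'" by (metis not0_implies_Suc)
    then have "e (a, b) \<le> ?M"
    proof cases
      case 1 then show ?thesis using e by (simp add: tables_def)
    next
      case (2 a')
      have "e (Suc a', b) \<le> (\<Sum>b\<le>l. e (Suc a', b))" using ab by (intro member_le_sum) auto
      also have "\<dots> = u a'" using e ab 2 by (simp add: tables_def)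
      also have "\<dots> \<le> (\<Sum>a<k. u a)" using ab 2 by (intro member_le_sum) auto
      finally show ?thesis using 2 by simp
    next
      case (3 b')
      have "e (a, Suc b') \<le> (\<Sum>a\<le>k. e (a, Suc b'))"
        using ab by (intro member_le_sum[of a "{..k}" "\<lambda>a. e (a, Suc b')"]) auto
      also have "\<dots> = v b'" using e ab 3 by (simp add: tables_def)
      also have "\<dots> \<le> (\<Sum>b<l. v b)" using ab 3 by (intro member_le_sum) auto
      finally show ?thesis using 3 by simp
    qed
    then show "e x \<in> {..?M}" using ab by simp
  next
    fix e x assume "e \<in> tables k l u v" "x \<notin> {..k} \<times> {..l}"
    then show "e x = 0" unfolding tables_def by blast
  qed
qed (intro finite_set_of_finite_funs finite_cartesian_product finite_atMost)

text \<open>The pairing function sends the corner \<open>(0, 0)\<close> to 0, the color of the elements outside all sets.\<close>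

definition linearize :: "(nat \<times> nat \<Rightarrow> nat) \<Rightarrow> nat \<Rightarrow> nat" where
  "linearize e = (\<lambda>i. e (prod_decode (Suc i)))"

lemma prod_decode_0: "prod_decode 0 = (0, 0)"
  by (simp add: prod_decode_def prod_decode_aux.simps)

lemma linearize_support:
  assumes e: "e \<in> tables k l u v"
  shows "finite {i. linearize e i \<noteq> 0}" "psize (linearize e) = sum e ({..k} \<times> {..l})"
proof -
  have e0: "e (0, 0) = 0" and supp: "\<And>x. x \<notin> {..k} \<times> {..l} \<Longrightarrow> e x = 0" using e unfolding tables_def by blast+
  have bij: "bij_betw (\<lambda>i. prod_decode (Suc i)) {i. linearize e i \<noteq> 0} {x. e x \<noteq> 0}"
  proof (rule bij_betw_byWitness[of _ "\<lambda>x. prod_encode x - 1"])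
    have pos: "prod_encode x \<noteq> 0" if "e x \<noteq> 0" for x
    proof
      assume "prod_encode x = 0"
      then have "x = prod_decode 0" by (metis prod_encode_inverse)
      then show False using e0 that by (simp add: prod_decode_0)
    qed
    show "\<forall>x\<in>{x. e x \<noteq> 0}. prod_decode (Suc (prod_encode x - 1)) = x"
      using pos by simp
    show "(\<lambda>x. prod_encode x - 1) ` {x. e x \<noteq> 0} \<subseteq> {i. linearize e i \<noteq> 0}"
      using pos by (auto simp: linearize_def)
  qed (auto simp: linearize_def)
  have sub: "{x. e x \<noteq> 0} \<subseteq> {..k} \<times> {..l}"
  proof
    fix x assume "x \<in> {x. e x \<noteq> 0}"
    then show "x \<in> {..k} \<times> {..l}" using supp[of x] by (cases "x \<in> {..k} \<times> {..l}") auto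
  qed
  then have "finite {x. e x \<noteq> 0}" by (rule finite_subset) simp
  then show "finite {i. linearize e i \<noteq> 0}" using bij_betw_finite[OF bij] by simp
  have "psize (linearize e) = (\<Sum>x | e x \<noteq> 0. e x)"
    unfolding psize_def using sum.reindex_bij_betw[OF bij, of e] by (simp only: linearize_def)
  also have "\<dots> = sum e ({..k} \<times> {..l})" using sub by (intro sum.mono_neutral_left) auto
  finally show "psize (linearize e) = sum e ({..k} \<times> {..l})" .
qed

text \<open>The full matrix of multiplicities in degree \<open>n\<close>.\<close>

definition corner :: "nat \<Rightarrow> nat \<Rightarrow> nat \<Rightarrow> (nat \<times> nat \<Rightarrow> nat) \<Rightarrow> nat \<times> nat \<Rightarrow> int" where
  "corner n k l e x = (if x = (0, 0) then int n - int (sum e ({..k} \<times> {..l})) else int (e x))"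

lemma perm_char_corner:
  assumes e: "e \<in> tables k l u v" and p: "p permutes {1..n}"
  shows "perm_char n (corner n k l e) p = stable_perm (linearize e) n p"
proof -
  have "padded n (linearize e) c = corner n k l e (prod_decode c)" for c
  proof (cases c)
    case 0
    then show ?thesis using linearize_support(2)[OF e] by (simp add: corner_def prod_decode_0)
  next
    case (Suc i)
    have "prod_decode c \<noteq> prod_decode 0" unfolding prod_decode_eq Suc by simp
    then show ?thesis using Suc by (simp add: corner_def prod_decode_0 linearize_def)
  qed
  then have "padded n (linearize e) = (\<lambda>c. corner n k l e (prod_decode c))" by blast
  then show ?thesis unfolding stable_perm_def using perm_char_reindex[OF bij_prod_decode p] by simp
qed

lemma sum_box_rows: "sum f ({..k} \<times> {..l}) = (\<Sum>b\<le>l. f (0, b)) + (\<Sum>a<k. \<Sum>b\<le>l. f (Suc a, b))"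
  for f :: "nat \<times> nat \<Rightarrow> 'a :: comm_monoid_add"
proof -
  have "sum f ({..k} \<times> {..l}) = (\<Sum>a\<le>k. \<Sum>b\<le>l. f (a, b))" by (simp add: sum.cartesian_product)
  also have "\<dots> = (\<Sum>a<Suc k. \<Sum>b\<le>l. f (a, b))" by (simp only: lessThan_Suc_atMost)
  also have "\<dots> = (\<Sum>b\<le>l. f (0, b)) + (\<Sum>a<k. \<Sum>b\<le>l. f (Suc a, b))" by (rule sum.lessThan_Suc_shift)
  finally show ?thesis .
qed

lemma sum_box_cols: "sum f ({..k} \<times> {..l}) = (\<Sum>a\<le>k. f (a, 0)) + (\<Sum>b<l. \<Sum>a\<le>k. f (a, Suc b))"
  for f :: "nat \<times> nat \<Rightarrow> 'a :: comm_monoid_add"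
proof -
  have "sum f ({..k} \<times> {..l}) = (\<Sum>a\<le>k. \<Sum>b\<le>l. f (a, b))" by (simp add: sum.cartesian_product)
  also have "\<dots> = (\<Sum>b\<le>l. \<Sum>a\<le>k. f (a, b))" by (rule sum.swap)
  also have "\<dots> = (\<Sum>b<Suc l. \<Sum>a\<le>k. f (a, b))" by (simp only: lessThan_Suc_atMost)
  also have "\<dots> = (\<Sum>a\<le>k. f (a, 0)) + (\<Sum>b<l. \<Sum>a\<le>k. f (a, Suc b))" by (rule sum.lessThan_Suc_shift)
  finally show ?thesis .
qed

lemma sum_corner:
  "sum (corner n k l e) ({..k} \<times> {..l}) = int n - int (e (0, 0))"
proof -
  have mem: "(0, 0) \<in> {..k} \<times> {..l}" and fin: "finite ({..k} \<times> {..l})" by auto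
  have "sum (corner n k l e) ({..k} \<times> {..l}) =
      corner n k l e (0, 0) + sum (corner n k l e) ({..k} \<times> {..l} - {(0, 0)})"
    by (rule sum.remove[OF fin mem])
  also have "sum (corner n k l e) ({..k} \<times> {..l} - {(0, 0)}) = sum (\<lambda>x. int (e x)) ({..k} \<times> {..l} - {(0, 0)})"
    by (intro sum.cong refl) (auto simp: corner_def)
  also have "\<dots> = int (sum e ({..k} \<times> {..l})) - int (e (0, 0))"
    using sum.remove[OF fin mem, of "\<lambda>x. int (e x)"] by simp
  finally show ?thesis by (simp add: corner_def)
qed

lemma corner_in_mats:
  assumes e: "e \<in> tables k l u v" and le: "sum e ({..k} \<times> {..l}) \<le> n"
    and u: "\<And>i. k \<le> i \<Longrightarrow> u i = 0" and v: "\<And>i. l \<le> i \<Longrightarrow> v i = 0"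
  shows "corner n k l e \<in> mats (Suc k) (Suc l) (padded n u) (padded n v)"
proof -
  have e0: "e (0, 0) = 0" and supp: "\<And>x. x \<notin> {..k} \<times> {..l} \<Longrightarrow> e x = 0"
    and rows: "\<And>a. a < k \<Longrightarrow> (\<Sum>b\<le>l. e (Suc a, b)) = u a" and cols: "\<And>b. b < l \<Longrightarrow> (\<Sum>a\<le>k. e (a, Suc b)) = v b"
    using e unfolding tables_def by blast+
  have r: "(\<Sum>b\<le>l. corner n k l e (Suc a, b)) = int (u a)" if "a < k" for a
    using rows[OF that] by (simp add: corner_def flip: of_nat_sum)
  have c: "(\<Sum>a\<le>k. corner n k l e (a, Suc b)) = int (v b)" if "b < l" for b
    using cols[OF that] by (simp add: corner_def flip: of_nat_sum)
  have r0: "(\<Sum>b\<le>l. corner n k l e (0, b)) = int n - int (psize u)"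
    using sum_box_rows[of "corner n k l e" k l] sum_corner[of n k l e] e0 r psize_eq_sum[of k u] u
    by simp
  have c0: "(\<Sum>a\<le>k. corner n k l e (a, 0)) = int n - int (psize v)"
    using sum_box_cols[of "corner n k l e" k l] sum_corner[of n k l e] e0 c psize_eq_sum[of l v] v
    by simp
  have "(\<Sum>b<Suc l. corner n k l e (a, b)) = padded n u a" if "a < Suc k" for a
    unfolding lessThan_Suc_atMost using r r0 that by (cases a) auto
  moreover have "(\<Sum>a<Suc k. corner n k l e (a, b)) = padded n v b" if "b < Suc l" for b
    unfolding lessThan_Suc_atMost using c c0 that by (cases b) auto
  moreover have "0 \<le> corner n k l e x" for x using le by (simp add: corner_def del: of_nat_sum)
  moreover have "corner n k l e x = 0" if "x \<notin> {..<Suc k} \<times> {..<Suc l}" for x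
  proof -
    have "x \<notin> {..k} \<times> {..l}" using that by (simp only: lessThan_Suc_atMost not_False_eq_True)
    moreover from this have "x \<noteq> (0, 0)" by auto
    ultimately show ?thesis using supp by (simp add: corner_def)
  qed
  ultimately show ?thesis unfolding mats_def by blast
qed

definition uncorner :: "(nat \<times> nat \<Rightarrow> int) \<Rightarrow> nat \<times> nat \<Rightarrow> nat" where
  "uncorner w x = (if x = (0, 0) then 0 else nat (w x))"

text \<open>The row sums fix the corner, because all entries add up to \<open>n\<close>.\<close>

lemma uncorner:
  assumes w: "w \<in> mats (Suc k) (Suc l) (padded n u) (padded n v)"
    and u: "\<And>i. k \<le> i \<Longrightarrow> u i = 0"
  shows "uncorner w \<in> tables k l u v" "corner n k l (uncorner w) = w"
    "sum (uncorner w) ({..k} \<times> {..l}) \<le> n"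
proof -
  have pos: "\<And>x. 0 \<le> w x" and supp: "\<And>x. x \<notin> {..k} \<times> {..l} \<Longrightarrow> w x = 0"
    and rows: "\<And>a. a \<le> k \<Longrightarrow> (\<Sum>b\<le>l. w (a, b)) = padded n u a"
    and cols: "\<And>b. b \<le> l \<Longrightarrow> (\<Sum>a\<le>k. w (a, b)) = padded n v b"
    using w unfolding mats_def lessThan_Suc_atMost less_Suc_eq_le by blast+
  have un: "int (uncorner w x) = w x" if "x \<noteq> (0, 0)" for x using that pos by (simp add: uncorner_def)
  have "int (\<Sum>b\<le>l. uncorner w (Suc a, b)) = int (u a)" if "a < k" for a
    using rows[of "Suc a"] that by (simp add: un)
  moreover have "int (\<Sum>a\<le>k. uncorner w (a, Suc b)) = int (v b)" if "b < l" for b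
    using cols[of "Suc b"] that by (simp add: un)
  moreover have "uncorner w x = 0" if "x \<notin> {..k} \<times> {..l}" for x
    using supp[OF that] by (simp add: uncorner_def)
  moreover have "uncorner w (0, 0) = 0" by (simp add: uncorner_def)
  ultimately show "uncorner w \<in> tables k l u v" unfolding tables_def of_nat_eq_iff by blast
  have mem: "(0, 0) \<in> {..k} \<times> {..l}" and fin: "finite ({..k} \<times> {..l})" by auto
  have "sum w ({..k} \<times> {..l}) = int n"
    using sum_box_rows[of w k l] rows psize_eq_sum[of k u] u by simp
  then have "w (0, 0) + (\<Sum>x\<in>{..k} \<times> {..l} - {(0, 0)}. w x) = int n"
    using sum.remove[OF fin mem, of w] by simp
  moreover have "(\<Sum>x\<in>{..k} \<times> {..l} - {(0, 0)}. w x) = int (sum (uncorner w) ({..k} \<times> {..l}))"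
  proof -
    have "(\<Sum>x\<in>{..k} \<times> {..l} - {(0, 0)}. w x) = (\<Sum>x\<in>{..k} \<times> {..l} - {(0, 0)}. int (uncorner w x))"
      by (intro sum.cong refl) (auto simp: un)
    also have "\<dots> = (\<Sum>x\<in>{..k} \<times> {..l}. int (uncorner w x))"
      using sum.remove[OF fin mem, of "\<lambda>x. int (uncorner w x)"] by (simp add: uncorner_def)
    finally show ?thesis by simp
  qed
  ultimately have w0: "w (0, 0) = int n - int (sum (uncorner w) ({..k} \<times> {..l}))" by linarith
  then show "sum (uncorner w) ({..k} \<times> {..l}) \<le> n" using pos[of "(0, 0)"] by linarith
  show "corner n k l (uncorner w) = w"
    using w0 un by (auto simp: corner_def fun_eq_iff)
qed

text \<open>The tables on the right-hand side depend on \<open>u\<close> and \<open>v\<close> only. A table whose total exceeds \<open>n\<close> contributes zero.\<close>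

lemma stable_perm_mult:
  assumes u: "\<And>i. k \<le> i \<Longrightarrow> u i = 0" and v: "\<And>i. l \<le> i \<Longrightarrow> v i = 0" and p: "p permutes {1..n}"
  shows "stable_perm u n p * stable_perm v n p = (\<Sum>e\<in>tables k l u v. stable_perm (linearize e) n p)"
proof -
  \<comment> \<open>the tables that fit into degree \<open>n\<close>\<close>
  let ?E = "{e \<in> tables k l u v. sum e ({..k} \<times> {..l}) \<le> n}"
  have zero: "padded n u a = 0" if "Suc k \<le> a" for a using u that by (cases a) auto
  have zero': "padded n v a = 0" if "Suc l \<le> a" for a using v that by (cases a) auto
  have "stable_perm u n p * stable_perm v n p =
      (\<Sum>w\<in>mats (Suc k) (Suc l) (padded n u) (padded n v). perm_char n w p)"
    unfolding stable_perm_def by (rule perm_char_mult[OF p zero zero'])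
  also have "\<dots> = (\<Sum>e\<in>?E. stable_perm (linearize e) n p)"
  proof (rule sum.reindex_bij_witness[of _ "corner n k l" uncorner])
    fix w assume w: "w \<in> mats (Suc k) (Suc l) (padded n u) (padded n v)"
    show "corner n k l (uncorner w) = w" by (rule uncorner(2)[OF w u])
    show "uncorner w \<in> ?E" using uncorner(1,3)[OF w u] by simp
    show "stable_perm (linearize (uncorner w)) n p = perm_char n w p"
      using perm_char_corner[OF uncorner(1)[OF w u] p] uncorner(2)[OF w u] by simp
  next
    fix e assume e: "e \<in> ?E"
    show "uncorner (corner n k l e) = e"
      using e by (auto simp: uncorner_def corner_def fun_eq_iff tables_def)
    show "corner n k l e \<in> mats (Suc k) (Suc l) (padded n u) (padded n v)"
      using e by (intro corner_in_mats u v) auto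
  qed
  also have "\<dots> = (\<Sum>e\<in>tables k l u v. stable_perm (linearize e) n p)"
  proof (rule sum.mono_neutral_left[OF finite_tables])
    show "\<forall>e\<in>tables k l u v - ?E. stable_perm (linearize e) n p = 0"
    proof
      fix e assume e: "e \<in> tables k l u v - ?E"
      then have "padded n (linearize e) 0 < 0" using linearize_support(2)[of e k l u v] by (simp add: not_le del: of_nat_sum)
      then show "stable_perm (linearize e) n p = 0" unfolding stable_perm_def by (rule perm_char_neg)
    qed
  qed auto
  finally show ?thesis .
qed

lemma stable_perm_mult_in_span:
  assumes "finite {i. u i \<noteq> (0 :: nat)}" "finite {i. v i \<noteq> (0 :: nat)}"
  shows "(\<lambda>n p. stable_perm u n p * stable_perm v n p) \<in> stable_span"
proof -
  obtain k where k: "\<And>i. k \<le> i \<Longrightarrow> u i = 0" using finite_support_bound[OF assms(1)] by blast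
  obtain l where l: "\<And>i. l \<le> i \<Longrightarrow> v i = 0" using finite_support_bound[OF assms(2)] by blast
  have "(\<lambda>n p. \<Sum>e\<in>tables k l u v. 1 * stable_perm (linearize e) n p) \<in> stable_span"
    using linearize_support(1) by (intro stable_span_lincomb finite_tables stable_perm_in_span) auto
  then show ?thesis
    by (rule stable_span_cong) (simp add: stable_perm_mult[OF k l])
qed

theorem stable_char_mult_in_span:
  assumes a: "is_partition \<alpha>" and b: "is_partition \<beta>"
  shows "(\<lambda>n p. stable_char \<alpha> n p * stable_char \<beta> n p) \<in> stable_span"
proof -
  let ?W = "\<lambda>v. {w. w permutes {..<Suc (plength v)}}"
  let ?c = "\<lambda>v w. if shift_ok v w then of_int (sign w) else 0 :: complex"
  have "(\<lambda>n p. \<Sum>x\<in>?W \<alpha> \<times> ?W \<beta>. (?c \<alpha> (fst x) * ?c \<beta> (snd x)) *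
      (stable_perm (shift_tail \<alpha> (fst x)) n p * stable_perm (shift_tail \<beta> (snd x)) n p)) \<in> stable_span"
    using stable_span_lincomb[of "?W \<alpha> \<times> ?W \<beta>"
      "\<lambda>x n p. stable_perm (shift_tail \<alpha> (fst x)) n p * stable_perm (shift_tail \<beta> (snd x)) n p"
      "\<lambda>x. ?c \<alpha> (fst x) * ?c \<beta> (snd x)"]
      stable_perm_mult_in_span[OF shift_tail_finite shift_tail_finite]
    by (simp add: finite_permutations)
  then show ?thesis
  proof (rule stable_span_cong)
    fix n p
    show "stable_char \<alpha> n p * stable_char \<beta> n p = (\<Sum>x\<in>?W \<alpha> \<times> ?W \<beta>. (?c \<alpha> (fst x) * ?c \<beta> (snd x)) *
      (stable_perm (shift_tail \<alpha> (fst x)) n p * stable_perm (shift_tail \<beta> (snd x)) n p))"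
      unfolding stable_char_expand[OF a] stable_char_expand[OF b] sum_product
      unfolding sum.cartesian_product by (intro sum.cong refl) (simp add: split_beta mult_ac)
  qed
qed

section \<open>Padding, the dagger operation and straightening\<close>

lemma ip_lincomb: "ip n f (\<lambda>p. \<Sum>a\<in>A. c a * F a p) = (\<Sum>a\<in>A. c a * ip n f (F a))"
proof -
  have "(\<Sum>p\<in>perms n. f p * (\<Sum>a\<in>A. c a * F a p)) = (\<Sum>p\<in>perms n. \<Sum>a\<in>A. c a * (f p * F a p))"
    by (simp add: sum_distrib_left mult_ac)
  also have "\<dots> = (\<Sum>a\<in>A. \<Sum>p\<in>perms n. c a * (f p * F a p))" by (rule sum.swap)
  finally show ?thesis by (simp add: ip_def sum_divide_distrib sum_distrib_left)
qed

lemma partition_antimono: "is_partition lam \<Longrightarrow> i \<le> j \<Longrightarrow> lam j \<le> lam i"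
  by (auto simp: is_partition_def dest: antimonoD)

lemma is_partitionI:
  assumes "\<And>i. lam (Suc i) \<le> lam i" "\<And>i. m \<le> i \<Longrightarrow> lam i = 0"
  shows "is_partition lam"
  unfolding is_partition_def
proof
  show "antimono lam" unfolding antimono_def using lift_Suc_antimono_le[of lam] assms(1) by blast
  have "{i. lam i \<noteq> 0} \<subseteq> {..<m}"
  proof
    fix i assume "i \<in> {i. lam i \<noteq> 0}"
    then show "i \<in> {..<m}" using assms(2)[of i] by (cases "m \<le> i") auto
  qed
  then show "finite {i. lam i \<noteq> 0}" by (rule finite_subset) simp
qed

lemma plength_le:
  assumes "\<And>i. m \<le> i \<Longrightarrow> lam i = 0"
  shows "plength lam \<le> m"
proof -
  have "{i. lam i \<noteq> 0} \<subseteq> {..<m}"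
  proof
    fix i assume "i \<in> {i. lam i \<noteq> 0}"
    then show "i \<in> {..<m}" using assms[of i] by (cases "m \<le> i") auto
  qed
  from card_mono[OF _ this] show ?thesis by (simp add: plength_def)
qed

lemma bar_partition:
  assumes "is_partition lam"
  shows "is_partition (bar lam)" "psize lam = lam 0 + psize (bar lam)"
proof -
  show "is_partition (bar lam)"
    using partition_antimono[OF assms] partition_eq_0_iff[OF assms]
    by (intro is_partitionI[of _ "plength lam"]) (auto simp: bar_def)
  have "psize lam = (\<Sum>i<Suc (plength lam). lam i)" using sum_partition[OF assms, of "Suc (plength lam)"] by simp
  also have "\<dots> = lam 0 + (\<Sum>i<plength lam. bar lam i)" by (simp only: sum.lessThan_Suc_shift bar_def)
  also have "(\<Sum>i<plength lam. bar lam i) = psize (bar lam)"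
    using partition_eq_0_iff[OF assms] by (intro psize_eq_sum[symmetric]) (simp add: bar_def)
  finally show "psize lam = lam 0 + psize (bar lam)" .
qed

lemma pad_bar:
  assumes "partition_of n lam"
  shows "pad (bar lam) n = lam"
proof
  fix i show "pad (bar lam) n i = lam i"
    using assms bar_partition(2)[of lam] by (cases i) (auto simp: pad_def bar_def partition_of_def)
qed

lemma bar_pad: "bar (pad \<gamma> n) = \<gamma>"
  by (simp add: bar_def pad_def)

lemma partition_of_pad:
  assumes \<gamma>: "is_partition \<gamma>" and n: "psize \<gamma> + \<gamma> 0 \<le> n"
  shows "partition_of n (pad \<gamma> n)"
proof -
  have P: "is_partition (pad \<gamma> n)"
  proof (rule is_partitionI[of _ "Suc (plength \<gamma>)"])
    show "pad \<gamma> n (Suc i) \<le> pad \<gamma> n i" for i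
      using n partition_antimono[OF \<gamma>] by (cases i) (auto simp: pad_def)
    show "pad \<gamma> n i = 0" if "Suc (plength \<gamma>) \<le> i" for i
      using that partition_eq_0_iff[OF \<gamma>] by (cases i) (auto simp: pad_def)
  qed
  moreover have "psize (pad \<gamma> n) = n"
    using bar_partition(2)[OF P] n by (simp add: bar_pad) (simp add: pad_def)
  ultimately show ?thesis by (simp add: partition_of_def)
qed

lemma stable_char_alternant:
  assumes "is_partition \<gamma>" "Suc (plength \<gamma>) \<le> k"
  shows "stable_char \<gamma> n p = alternant k n (\<lambda>i. padded n \<gamma> i - int i) p"
  unfolding stable_char_def
proof (rule alternant_extend[symmetric, OF assms(2)])
  fix i assume i: "Suc (plength \<gamma>) \<le> i"
  then show "padded n \<gamma> i - int i = - int i"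
    using partition_eq_0_iff[OF assms(1)] by (cases i) auto
qed

text \<open>The two determinants have the same rows.\<close>

lemma stable_char_pad:
  assumes \<gamma>: "is_partition \<gamma>" and n: "partition_of n (pad \<gamma> n)" "psize \<gamma> \<le> n"
  shows "stable_char \<gamma> n p = schur n (pad \<gamma> n) p"
proof -
  have "plength (pad \<gamma> n) \<le> Suc (plength \<gamma>)"
  proof (rule plength_le)
    show "pad \<gamma> n i = 0" if "Suc (plength \<gamma>) \<le> i" for i
      using that partition_eq_0_iff[OF \<gamma>] by (cases i) (auto simp: pad_def)
  qed
  then have "schur n (pad \<gamma> n) p = alternant (Suc (plength \<gamma>)) n (beta (pad \<gamma> n)) p"
    using n by (intro schur_alternant) (auto simp: partition_of_def)
  also have "\<dots> = stable_char \<gamma> n p"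
    unfolding stable_char_def
  proof (rule alternant_cong)
    fix i show "beta (pad \<gamma> n) i = padded n \<gamma> i - int i"
      using n(2) by (cases i) (auto simp: beta_def pad_def)
  qed
  finally show ?thesis ..
qed

lemma dagger_apply: "dagger lam i j = (if Suc j < i then Suc (lam j) else lam (Suc j))"
  by (simp add: dagger_def One_nat_def)

text \<open>The size formula follows by comparing the two sequences before and after position \<open>i\<close>.\<close>

lemma dagger_partition:
  assumes lam: "is_partition lam" and i: "1 \<le> i"
  shows "is_partition (dagger lam i)" "psize (dagger lam i) + lam (i - 1) = psize lam + (i - 1)"
    "i - 1 \<le> plength (dagger lam i)"
proof -
  let ?m = "max i (plength lam)"
  show P: "is_partition (dagger lam i)"
  proof (rule is_partitionI[of _ ?m])
    show "dagger lam i (Suc j) \<le> dagger lam i j" for j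
      using partition_antimono[OF lam, of j "Suc j"] partition_antimono[OF lam, of "Suc j" "Suc (Suc j)"]
        partition_antimono[OF lam, of j "Suc (Suc j)"]
      by (auto simp: dagger_apply)
    show "dagger lam i j = 0" if "?m \<le> j" for j
      using that partition_eq_0_iff[OF lam] by (auto simp: dagger_apply)
  qed
  have "psize (dagger lam i) = (\<Sum>j<?m. dagger lam i j)"
    using partition_eq_0_iff[OF lam] by (intro psize_eq_sum) (auto simp: dagger_apply)
  also have "\<dots> = (\<Sum>j<i - 1. dagger lam i j) + (\<Sum>j=i - 1..<?m. dagger lam i j)"
    using sum.atLeastLessThan_concat[of 0 "i - 1" ?m "dagger lam i"] i by (simp add: atLeast0LessThan)
  also have "(\<Sum>j<i - 1. dagger lam i j) = (\<Sum>j<i - 1. 1 + lam j)"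
    by (intro sum.cong refl) (auto simp: dagger_apply)
  also have "\<dots> = (i - 1) + (\<Sum>j<i - 1. lam j)" by (simp only: sum.distrib) simp
  also have "(\<Sum>j=i - 1..<?m. dagger lam i j) = (\<Sum>j=i - 1..<?m. lam (Suc j))"
    using i by (intro sum.cong refl) (auto simp: dagger_apply)
  also have "\<dots> = (\<Sum>j=i..<Suc ?m. lam j)"
    using sum.shift_bounds_Suc_ivl[of lam "i - 1" ?m] i by simp
  finally have eq: "psize (dagger lam i) = (i - 1) + (\<Sum>j<i - 1. lam j) + (\<Sum>j=i..<Suc ?m. lam j)" .
  have "psize lam = (\<Sum>j<Suc ?m. lam j)" by (rule sum_partition[OF lam, symmetric]) simp
  also have "\<dots> = (\<Sum>j<i. lam j) + (\<Sum>j=i..<Suc ?m. lam j)"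
    using sum.atLeastLessThan_concat[of 0 i "Suc ?m" lam] by (simp add: atLeast0LessThan)
  also have "(\<Sum>j<i. lam j) = (\<Sum>j<i - 1. lam j) + lam (i - 1)"
    using i sum.lessThan_Suc[of lam "i - 1"] by simp
  finally show "psize (dagger lam i) + lam (i - 1) = psize lam + (i - 1)" using eq by simp
  have nonzero: "dagger lam i j \<noteq> 0" if "Suc j < i" for j using that by (simp add: dagger_apply)
  show "i - 1 \<le> plength (dagger lam i)"
  proof (rule ccontr)
    assume "\<not> i - 1 \<le> plength (dagger lam i)"
    then have "dagger lam i (plength (dagger lam i)) \<noteq> 0" by (intro nonzero) simp
    then show False using partition_eq_0_iff[OF P] by simp
  qed
qed

text \<open>The cycle that moves position \<open>i - 1\<close> to the front.\<close>

definition rotation :: "nat \<Rightarrow> nat \<Rightarrow> nat" where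
  "rotation i j = (if j = 0 then i - 1 else if j < i then j - 1 else j)"

lemma rotation:
  assumes "1 \<le> i"
  shows "rotation i permutes {..<i} \<and> sign (rotation i) = (-1) ^ (i - 1)"
  using assms
proof (induction i rule: nat_induct_at_least)
  case base
  have "rotation 1 = id" by (auto simp: rotation_def fun_eq_iff)
  then show ?case by (simp only: permutes_id sign_id) simp
next
  case (Suc i)
  have eq: "rotation (Suc i) = transpose (i - 1) i \<circ> rotation i"
    using Suc.hyps by (auto simp: rotation_def fun_eq_iff transpose_def)
  have t: "transpose (i - 1) i permutes {..<Suc i}" by (intro permutes_swap_id) auto
  have r: "rotation i permutes {..<Suc i}"
    using Suc.IH permutes_subset[of "rotation i" "{..<i}" "{..<Suc i}"] by simp
  have "sign (rotation (Suc i)) = sign (transpose (i - 1) i) * sign (rotation i)"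
    unfolding eq using t r by (intro sign_compose permutation_lessThan)
  also have "\<dots> = (-1) ^ i"
    using Suc by (cases i) (auto simp: sign_swap_id)
  finally have "sign (rotation (Suc i)) = (-1) ^ (Suc i - 1)" by simp
  then show ?case using permutes_compose[OF r t, folded eq] by blast
qed

text \<open>In terms of \<open>beta\<close>, the sequence of \<open>dagger lam i\<close> in degree \<open>n\<close> is that of \<open>lam\<close> with its entry number \<open>i\<close>
  moved to the front; the sign is that of a cycle of length \<open>i\<close>.\<close>

lemma stable_char_dagger:
  assumes lam: "partition_of n lam" and i: "1 \<le> i" and p: "p permutes {1..n}"
  shows "stable_char (dagger lam i) n p = (-1) ^ (i + 1) * schur n lam p"
proof -
  have P: "is_partition lam" "psize lam = n" using lam by (auto simp: partition_of_def)
  note D = dagger_partition[OF P(1) i]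
  define k where "k = Suc (plength (dagger lam i)) + plength lam + i"
  have r: "rotation i permutes {..<k}"
    using rotation[OF i] permutes_subset[of "rotation i" "{..<i}" "{..<k}"] by (simp add: k_def)
  have "padded n (dagger lam i) j - int j = (beta lam \<circ> rotation i) j" for j
  proof (cases j)
    case 0
    then show ?thesis using D(2) P(2) i by (simp add: beta_def rotation_def of_nat_diff)
  next
    case (Suc j')
    then show ?thesis by (simp add: beta_def rotation_def dagger_apply)
  qed
  then have "stable_char (dagger lam i) n p = alternant k n (beta lam \<circ> rotation i) p"
    using stable_char_alternant[OF D(1), of k n p] by (simp add: k_def comp_def)
  also have "\<dots> = of_int (sign (rotation i)) * alternant k n (beta lam) p"
    by (rule alternant_permute[OF r p])
  also have "alternant k n (beta lam) p = schur n lam p"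
    by (rule schur_alternant[symmetric, OF P(1)]) (simp add: k_def)
  also have "of_int (sign (rotation i)) = (-1 :: complex) ^ (i + 1)"
    using rotation[OF i] i by (cases i) (auto simp: One_nat_def)
  finally show ?thesis .
qed

text \<open>The sizes of \<open>dagger lam i\<close> increase strictly with \<open>i\<close>.\<close>

lemma dagger_inj:
  assumes lam: "is_partition lam" and ij: "1 \<le> i" "1 \<le> j" and eq: "dagger lam i = dagger lam j"
  shows "i = j"
proof -
  have False if "1 \<le> i" "i < j" "dagger lam i = dagger lam j" for i j
  proof -
    have "lam (j - 1) \<le> lam (i - 1)" using that by (intro partition_antimono[OF lam]) simp
    then show False using dagger_partition(2)[OF lam, of i] dagger_partition(2)[OF lam, of j] that by simp
  qed
  from this[of i j] this[of j i] show ?thesis using ij eq by (metis linorder_neqE_nat)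
qed

text \<open>Only the first row of the determinant is out of order. If it coincides with another row or is too small, the
  determinant vanishes. Otherwise move it down to its place \<open>m\<close>; undoing the shifts of the rows it has passed gives \<open>lam\<close>.\<close>

lemma stable_char_straighten:
  assumes \<gamma>: "is_partition \<gamma>" and nz: "stable_char \<gamma> n p \<noteq> 0" and p: "p permutes {1..n}"
  obtains lam i where "partition_of n lam" "1 \<le> i" "\<gamma> = dagger lam i"
proof -
  let ?k = "plength \<gamma>"
  let ?y = "\<lambda>i. padded n \<gamma> i - int i"
  \<comment> \<open>the entry of the first row\<close>
  define y0 where "y0 = int n - int (psize \<gamma>)"
  have nz': "alternant (Suc ?k) n ?y p \<noteq> 0" using nz by (simp add: stable_char_def)
  have low: "- int (Suc ?k) < y0"
    using alternant_negative[of 0 "Suc ?k" ?y n p] nz' by (fastforce simp: y0_def)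
  have zero: "\<gamma> i = 0" if "?k \<le> i" for i using partition_eq_0_iff[OF \<gamma>] that by blast
  have anti: "\<gamma> j \<le> \<gamma> i" if "i \<le> j" for i j by (rule partition_antimono[OF \<gamma> that])
  \<comment> \<open>the number of rows that the first row has to pass\<close>
  define m where "m = (LEAST j. int (\<gamma> j) - int (Suc j) < y0)"
  have ex: "int (\<gamma> ?k) - int (Suc ?k) < y0" using low zero by simp
  then have mk: "m \<le> ?k" and m: "int (\<gamma> m) - int (Suc m) < y0"
    unfolding m_def by (rule Least_le, rule LeastI)
  have above: "y0 < int (\<gamma> j) - int (Suc j)" if j: "j < m" for j
  proof -
    have "\<not> int (\<gamma> j) - int (Suc j) < y0" using not_less_Least j unfolding m_def by blast
    moreover have "int (\<gamma> j) - int (Suc j) \<noteq> y0"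
    proof
      assume "int (\<gamma> j) - int (Suc j) = y0"
      then have "alternant (Suc ?k) n ?y p = 0"
        using j mk by (intro alternant_repeated[of 0 _ "Suc j"] p) (auto simp: y0_def)
      with nz' show False by simp
    qed
    ultimately show ?thesis by simp
  qed
  have pos: "1 \<le> \<gamma> j" if j: "j < m" for j
  proof -
    have "y0 < int (\<gamma> (m - 1)) - int m" using above[of "m - 1"] j by simp
    then have "int (\<gamma> m) < int (\<gamma> (m - 1))" using m by simp
    moreover have "\<gamma> (m - 1) \<le> \<gamma> j" using j by (intro anti) simp
    ultimately show ?thesis by linarith
  qed
  have y0m: "0 \<le> y0 + int m" using m by simp
  define lam where "lam j = (if j < m then \<gamma> j - 1 else if j = m then nat (y0 + int m) else \<gamma> (j - 1))" for j
  have dagger: "dagger lam (Suc m) = \<gamma>"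
  proof
    fix j show "dagger lam (Suc m) j = \<gamma> j"
      using pos[of j] by (cases "j < m") (auto simp: dagger_apply lam_def One_nat_def)
  qed
  have P: "is_partition lam"
  proof (rule is_partitionI[of _ "Suc ?k"])
    fix j
    consider "Suc j < m" | "Suc j = m" | "j = m" | "m < j" by linarith
    then show "lam (Suc j) \<le> lam j"
    proof cases
      case 1
      then show ?thesis using anti[of j "Suc j"] by (simp add: lam_def)
    next
      case 2
      then show ?thesis using above[of j] pos[of j] by (simp add: lam_def nat_le_iff of_nat_diff)
    next
      case 3
      then show ?thesis using m y0m by (simp add: lam_def le_nat_iff)
    next
      case 4
      then show ?thesis using anti[of "j - 1" j] by (simp add: lam_def)
    qed
  next
    fix j assume "Suc ?k \<le> j"
    then show "lam j = 0" using mk zero[of "j - 1"] by (simp add: lam_def)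
  qed
  have "int (psize \<gamma>) + (y0 + int m) = int (psize lam) + int m"
    using dagger_partition(2)[OF P, of "Suc m"] y0m unfolding dagger
    by (simp add: lam_def flip: of_nat_add)
  then have "psize lam = n" by (simp add: y0_def)
  then show thesis using that[of lam "Suc m"] P dagger by (simp add: partition_of_def)
qed

text \<open>By straightening, \<open>stable_char \<gamma> n\<close> is orthogonal to \<open>schur n lam\<close> unless \<open>\<gamma>\<close> arises from \<open>lam\<close>, and then from
  exactly one \<open>i\<close>. The bound on \<open>K\<close> ensures that this \<open>i\<close> occurs in the sum, since \<open>dagger lam i\<close> has at least \<open>i - 1\<close> parts.\<close>

lemma ip_schur_stable_char:
  assumes lam: "partition_of n lam" and \<gamma>: "is_partition \<gamma>" and K: "Suc (plength \<gamma>) \<le> K"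
  shows "ip n (schur n lam) (stable_char \<gamma> n) = (\<Sum>i = 1..K. (-1) ^ (i + 1) * (if dagger lam i = \<gamma> then 1 else 0))"
proof -
  have P: "is_partition lam" using lam by (simp add: partition_of_def)
  have dag: "ip n (schur n lam) (stable_char (dagger \<mu> i) n) = (-1) ^ (i + 1) * ip n (schur n lam) (schur n \<mu>)"
    if "partition_of n \<mu>" "1 \<le> i" for \<mu> i
  proof -
    have "ip n (schur n lam) (stable_char (dagger \<mu> i) n) = ip n (schur n lam) (\<lambda>p. \<Sum>a\<in>{()}. (-1) ^ (i + 1) * schur n \<mu> p)"
      using stable_char_dagger[OF that] by (intro ip_cong) auto
    then show ?thesis unfolding ip_lincomb by simp
  qed
  show ?thesis
  proof (cases "\<exists>i\<ge>1. dagger lam i = \<gamma>")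
    case True
    then obtain i where i: "1 \<le> i" "dagger lam i = \<gamma>" by blast
    have iK: "i \<in> {1..K}" using dagger_partition(3)[OF P i(1)] i K by simp
    have "(\<Sum>j = 1..K. (-1) ^ (j + 1) * (if dagger lam j = \<gamma> then 1 else 0)) =
        (\<Sum>j = 1..K. if j = i then (-1) ^ (i + 1) else 0 :: complex)"
    proof (intro sum.cong refl)
      fix j assume "j \<in> {1..K}"
      then have "dagger lam j = \<gamma> \<longleftrightarrow> j = i" using dagger_inj[OF P _ i(1), of j] i(2) by auto
      then show "(-1) ^ (j + 1) * (if dagger lam j = \<gamma> then 1 else 0) = (if j = i then (-1) ^ (i + 1) else 0 :: complex)"
        by simp
    qed
    also have "\<dots> = (-1) ^ (i + 1)" using iK by simp
    also have "\<dots> = ip n (schur n lam) (stable_char \<gamma> n)"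
      using dag[OF lam i(1)] ip_schur[OF lam lam] i(2) by simp
    finally show ?thesis ..
  next
    case False
    have "ip n (schur n lam) (stable_char \<gamma> n) = 0"
    proof (cases "\<exists>p. p permutes {1..n} \<and> stable_char \<gamma> n p \<noteq> 0")
      case True
      then obtain \<mu> i where \<mu>: "partition_of n \<mu>" "1 \<le> i" "\<gamma> = dagger \<mu> i"
        using stable_char_straighten[OF \<gamma>] by blast
      then have "lam \<noteq> \<mu>" using False by blast
      then show ?thesis using dag[OF \<mu>(1,2)] ip_schur[OF lam \<mu>(1)] \<mu>(3) by simp
    next
      case False
      then have "ip n (schur n lam) (stable_char \<gamma> n) = ip n (schur n lam) (\<lambda>_. 0)" by (intro ip_cong) auto
      then show ?thesis by (simp add: ip_def)
    qed
    then show ?thesis using False by (auto intro!: sum.neutral)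
  qed
qed

section \<open>The number of rows of a constituent\<close>

text \<open>Compare the first columns: this is the dominance relation at \<open>j = 1\<close>.\<close>

lemma ip_schur_perm_char_length:
  fixes w :: "nat \<Rightarrow> int"
  assumes lam: "partition_of n lam" and fin: "finite {c. w c \<noteq> 0}"
    and nz: "ip n (schur n lam) (perm_char n w) \<noteq> 0"
  shows "plength lam \<le> card {c. w c \<noteq> 0}"
proof -
  have P: "is_partition lam" using lam by (simp add: partition_of_def)
  obtain l where l: "\<forall>c\<in>{c. w c \<noteq> 0}. c < l" using fin unfolding finite_nat_set_iff_bounded by (rule exE)
  then have wl: "w c = 0" if "l \<le> c" for c using that by (cases "w c = 0") auto
  have "(\<Sum>i<plength lam. min (int (lam i)) (int 1)) \<le> (\<Sum>i<l. min (w i) (int 1))"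
    by (rule ip_schur_dominance[OF lam order_refl wl nz])
  moreover have "(\<Sum>i<plength lam. min (int (lam i)) (int 1)) = (\<Sum>i<plength lam. 1)"
  proof (intro sum.cong refl)
    fix i assume "i \<in> {..<plength lam}"
    then have "lam i \<noteq> 0" using partition_eq_0_iff[OF P, of i] by simp
    then show "min (int (lam i)) (int 1) = 1" by simp
  qed
  moreover have "(\<Sum>i<l. min (w i) (int 1)) \<le> (\<Sum>i<l. if w i \<noteq> 0 then 1 else 0)"
    by (intro sum_mono) auto
  moreover have "(\<Sum>i<l. if w i \<noteq> 0 then 1 else 0 :: int) = int (card ({..<l} \<inter> {i. w i \<noteq> 0}))"
    by (simp add: sum.If_cases)
  moreover have "{..<l} \<inter> {i. w i \<noteq> 0} = {c. w c \<noteq> 0}" using l by auto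
  ultimately show ?thesis by simp
qed

text \<open>With as many rows as the partitions have, the determinants for \<open>\<mu>\<close> and \<open>\<nu>\<close> involve only contents of at most
  \<open>plength \<mu>\<close> and \<open>plength \<nu>\<close> parts. Their products are permutation characters of matrices with at most
  \<open>plength \<mu> * plength \<nu>\<close> nonzero entries.\<close>

lemma ip_schur_product_length:
  assumes lam: "partition_of n lam" and mu: "partition_of n \<mu>" and nu: "partition_of n \<nu>"
    and len: "plength \<mu> * plength \<nu> < plength lam"
  shows "ip n (schur n lam) (\<lambda>p. schur n \<mu> p * schur n \<nu> p) = 0"
proof -
  let ?k = "plength \<mu>" and ?l = "plength \<nu>"
  let ?W = "{w. w permutes {..<?k}} \<times> {w. w permutes {..<?l}}"
  let ?u = "\<lambda>x. shifted ?k (beta \<mu>) (fst x)" and ?v = "\<lambda>x. shifted ?l (beta \<nu>) (snd x)"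
  have term0: "ip n (schur n lam) (\<lambda>p. perm_char n (?u x) p * perm_char n (?v x) p) = 0" for x
  proof -
    have "ip n (schur n lam) (\<lambda>p. perm_char n (?u x) p * perm_char n (?v x) p) =
        ip n (schur n lam) (\<lambda>p. \<Sum>w\<in>mats ?k ?l (?u x) (?v x). 1 * perm_char n (\<lambda>c. w (prod_decode c)) p)"
    proof (rule ip_cong)
      fix p assume p: "p permutes {1..n}"
      have "perm_char n (?u x) p * perm_char n (?v x) p = (\<Sum>w\<in>mats ?k ?l (?u x) (?v x). perm_char n w p)"
        by (rule perm_char_mult[OF p]) (simp_all add: shifted_def)
      then show "perm_char n (?u x) p * perm_char n (?v x) p =
          (\<Sum>w\<in>mats ?k ?l (?u x) (?v x). 1 * perm_char n (\<lambda>c. w (prod_decode c)) p)"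
        by (simp add: perm_char_reindex[OF bij_prod_decode p])
    qed simp
    also have "\<dots> = (\<Sum>w\<in>mats ?k ?l (?u x) (?v x). 1 * ip n (schur n lam) (perm_char n (\<lambda>c. w (prod_decode c))))"
      by (rule ip_lincomb)
    also have "\<dots> = 0"
    proof (rule sum.neutral, rule ballI, rule ccontr)
      fix w assume w: "w \<in> mats ?k ?l (?u x) (?v x)"
        and "1 * ip n (schur n lam) (perm_char n (\<lambda>c. w (prod_decode c))) \<noteq> 0"
      then have nz: "ip n (schur n lam) (perm_char n (\<lambda>c. w (prod_decode c))) \<noteq> 0" by simp
      have sub: "{c. w (prod_decode c) \<noteq> 0} \<subseteq> prod_encode ` ({..<?k} \<times> {..<?l})"
      proof
        fix c assume "c \<in> {c. w (prod_decode c) \<noteq> 0}"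
        then have "prod_decode c \<in> {..<?k} \<times> {..<?l}" using w unfolding mats_def by blast
        then show "c \<in> prod_encode ` ({..<?k} \<times> {..<?l})" by (metis image_eqI prod_decode_inverse)
      qed
      have "plength lam \<le> card {c. w (prod_decode c) \<noteq> 0}"
        using sub by (intro ip_schur_perm_char_length[OF lam _ nz]) (auto intro: finite_subset)
      also have "\<dots> \<le> card (prod_encode ` ({..<?k} \<times> {..<?l}))" using sub by (intro card_mono) auto
      also have "\<dots> \<le> ?k * ?l" using card_image_le[of "{..<?k} \<times> {..<?l}" prod_encode] by simp
      finally show False using len by simp
    qed
    finally show ?thesis .
  qed
  have "ip n (schur n lam) (\<lambda>p. schur n \<mu> p * schur n \<nu> p) =
      ip n (schur n lam) (\<lambda>p. \<Sum>x\<in>?W. (of_int (sign (fst x)) * of_int (sign (snd x))) *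
        (perm_char n (?u x) p * perm_char n (?v x) p))"
  proof (rule ip_cong)
    fix p
    show "schur n \<mu> p * schur n \<nu> p = (\<Sum>x\<in>?W. (of_int (sign (fst x)) * of_int (sign (snd x))) *
        (perm_char n (?u x) p * perm_char n (?v x) p))"
      unfolding schur_def alternant_def sum_product sum.cartesian_product
      by (intro sum.cong refl) (simp add: split_beta mult_ac)
  qed simp
  also have "\<dots> = 0" unfolding ip_lincomb by (simp add: term0)
  finally show ?thesis .
qed

section \<open>Reduced Kronecker coefficients\<close>

lemma reduced_kronecker_eqI:
  assumes "\<forall>\<^sub>F N in sequentially. kronecker (pad \<alpha> N) (pad \<beta> N) (pad \<gamma> N) = c"
  shows "reduced_kronecker \<alpha> \<beta> \<gamma> = c"
  unfolding reduced_kronecker_def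
proof (rule the_equality)
  show "\<forall>\<^sub>F N in sequentially. kronecker (pad \<alpha> N) (pad \<beta> N) (pad \<gamma> N) = c" by (rule assms)
  fix d assume "\<forall>\<^sub>F N in sequentially. kronecker (pad \<alpha> N) (pad \<beta> N) (pad \<gamma> N) = d"
  with assms have "\<forall>\<^sub>F N in sequentially. d = c" by eventually_elim simp
  then show "d = c" by simp
qed

text \<open>In large degree \<open>N\<close> all stable characters involved are the irreducible characters of the padded
  partitions, so orthonormality extracts the coefficient. In particular the Kronecker coefficient is the same for all large \<open>N\<close>.\<close>

lemma reduced_kronecker_coefficient:
  assumes a: "is_partition \<alpha>" and b: "is_partition \<beta>" and c: "is_partition \<gamma>"
    and B: "finite B" "\<And>\<gamma>. \<gamma> \<in> B \<Longrightarrow> is_partition \<gamma>"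
    and mult: "\<And>n p. p permutes {1..n} \<Longrightarrow>
      stable_char \<alpha> n p * stable_char \<beta> n p = (\<Sum>\<gamma>\<in>B. g \<gamma> * stable_char \<gamma> n p)"
  shows "of_nat (reduced_kronecker \<alpha> \<beta> \<gamma>) = (if \<gamma> \<in> B then g \<gamma> else 0)"
proof -
  let ?b = "\<lambda>\<gamma>. psize \<gamma> + \<gamma> 0"
  \<comment> \<open>from here on every partition involved can be padded\<close>
  define N0 where "N0 = ?b \<alpha> + ?b \<beta> + ?b \<gamma> + (\<Sum>\<delta>\<in>B. ?b \<delta>)"
  have kron: "of_nat (kronecker (pad \<alpha> N) (pad \<beta> N) (pad \<gamma> N)) = (if \<gamma> \<in> B then g \<gamma> else 0)" if N: "N0 \<le> N" for N
  proof -
    have pad: "partition_of N (pad \<delta> N)" "stable_char \<delta> N = schur N (pad \<delta> N)"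
      if "is_partition \<delta>" "?b \<delta> \<le> N" for \<delta>
      using partition_of_pad[OF that] stable_char_pad[OF that(1) partition_of_pad[OF that]] that(2)
      by (auto simp: fun_eq_iff)
    have bd: "?b \<delta> \<le> N" if "\<delta> \<in> B" for \<delta>
      using member_le_sum[of \<delta> B ?b] that B(1) N by (simp add: N0_def)
    have A: "?b \<alpha> \<le> N" "?b \<beta> \<le> N" "?b \<gamma> \<le> N" using N by (simp_all add: N0_def)
    have "of_nat (kronecker (pad \<alpha> N) (pad \<beta> N) (pad \<gamma> N)) =
        ip N (schur N (pad \<gamma> N)) (\<lambda>p. schur N (pad \<alpha> N) p * schur N (pad \<beta> N) p)"
      by (rule kronecker_ip) (intro pad a b c A)+
    also have "\<dots> = ip N (schur N (pad \<gamma> N)) (\<lambda>p. \<Sum>\<delta>\<in>B. g \<delta> * stable_char \<delta> N p)"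
      using mult[of _ N] pad(2)[OF a A(1)] pad(2)[OF b A(2)] by (intro ip_cong) auto
    also have "\<dots> = (\<Sum>\<delta>\<in>B. g \<delta> * ip N (schur N (pad \<gamma> N)) (schur N (pad \<delta> N)))"
      unfolding ip_lincomb using pad(2) B(2) bd by (intro sum.cong refl) simp
    also have "\<dots> = (\<Sum>\<delta>\<in>B. if \<delta> = \<gamma> then g \<delta> else 0)"
    proof (intro sum.cong refl)
      fix \<delta> assume \<delta>: "\<delta> \<in> B"
      have "pad \<gamma> N = pad \<delta> N \<longleftrightarrow> \<delta> = \<gamma>" by (metis bar_pad)
      then show "g \<delta> * ip N (schur N (pad \<gamma> N)) (schur N (pad \<delta> N)) = (if \<delta> = \<gamma> then g \<delta> else 0)"
        using ip_schur[OF pad(1)[OF c A(3)] pad(1)[OF B(2)[OF \<delta>] bd[OF \<delta>]]] by simp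
    qed
    also have "\<dots> = (if \<gamma> \<in> B then g \<gamma> else 0)" using B(1) by simp
    finally show ?thesis .
  qed
  have "kronecker (pad \<alpha> N) (pad \<beta> N) (pad \<gamma> N) = kronecker (pad \<alpha> N0) (pad \<beta> N0) (pad \<gamma> N0)" if "N0 \<le> N" for N
    using kron[OF that] kron[OF order_refl] by (metis of_nat_eq_iff)
  then have "\<forall>\<^sub>F N in sequentially. kronecker (pad \<alpha> N) (pad \<beta> N) (pad \<gamma> N) = kronecker (pad \<alpha> N0) (pad \<beta> N0) (pad \<gamma> N0)"
    unfolding eventually_sequentially by blast
  from reduced_kronecker_eqI[OF this] show ?thesis using kron[OF order_refl] by simp
qed

text \<open>The padded sequence of \<open>dagger lam i\<close> has at least \<open>i\<close> rows.\<close>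

lemma reduced_kronecker_length:
  assumes n: "n > 0" and mu: "partition_of n \<mu>" and nu: "partition_of n \<nu>" and lam: "is_partition lam"
    and i: "plength \<mu> * plength \<nu> < i"
  shows "reduced_kronecker (bar \<mu>) (bar \<nu>) (dagger lam i) = 0"
proof (rule reduced_kronecker_eqI)
  have i1: "1 \<le> i" using i by simp
  note D = dagger_partition[OF lam i1]
  have P: "is_partition (bar \<mu>)" "is_partition (bar \<nu>)" using mu nu bar_partition(1) by (auto simp: partition_of_def)
  have len: "plength (pad (bar \<mu>) N) \<le> plength \<mu>" if mu: "partition_of n \<mu>" for \<mu> N
  proof (rule plength_le)
    have Pm: "is_partition \<mu>" "psize \<mu> = n" using mu by (auto simp: partition_of_def)
    have "plength \<mu> \<noteq> 0"
    proof
      assume "plength \<mu> = 0"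
      then have "psize \<mu> = (\<Sum>i<0. \<mu> i)" using sum_partition[OF Pm(1), of 0] by simp
      then show False using Pm(2) n by simp
    qed
    then show "pad (bar \<mu>) N j = 0" if "plength \<mu> \<le> j" for j
      using that partition_eq_0_iff[OF Pm(1), of j] by (cases j) (auto simp: pad_def bar_def)
  qed
  let ?b = "\<lambda>\<gamma>. psize \<gamma> + \<gamma> 0"
  let ?d = "dagger lam i"
  show "\<forall>\<^sub>F N in sequentially. kronecker (pad (bar \<mu>) N) (pad (bar \<nu>) N) (pad ?d N) = 0"
    unfolding eventually_sequentially
  proof (intro exI allI impI)
    fix N assume N: "?b (bar \<mu>) + ?b (bar \<nu>) + ?b ?d + 1 \<le> N"
    have part: "partition_of N (pad (bar \<mu>) N)" "partition_of N (pad (bar \<nu>) N)" "partition_of N (pad ?d N)"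
      using N by (auto intro!: partition_of_pad P D(1))
    have Pd: "is_partition (pad ?d N)" using part(3) by (simp add: partition_of_def)
    have "pad ?d N (i - 1) \<noteq> 0"
      using N i1 by (cases "i - 1") (auto simp: pad_def dagger_apply)
    then have "i \<le> plength (pad ?d N)" using partition_eq_0_iff[OF Pd, of "i - 1"] by simp
    moreover have "plength (pad (bar \<mu>) N) * plength (pad (bar \<nu>) N) \<le> plength \<mu> * plength \<nu>"
      by (intro mult_le_mono len mu nu)
    ultimately have "plength (pad (bar \<mu>) N) * plength (pad (bar \<nu>) N) < plength (pad ?d N)" using i by simp
    from ip_schur_product_length[OF part(3,1,2) this] kronecker_ip[OF part(3,1,2)]
    show "kronecker (pad (bar \<mu>) N) (pad (bar \<nu>) N) (pad ?d N) = 0" by simp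
  qed
qed

theorem theorem1p1:
  fixes n :: nat and lam \<mu> \<nu> :: "nat \<Rightarrow> nat"
  assumes "n > 0" and "partition_of n lam" and "partition_of n \<mu>" and "partition_of n \<nu>"
  shows "int (kronecker \<mu> \<nu> lam) =
    (\<Sum>i = 1..plength \<mu> * plength \<nu>.
       (-1) ^ (i + 1) * int (reduced_kronecker (bar \<mu>) (bar \<nu>) (dagger lam i)))"
proof -
  have P: "is_partition lam" "is_partition \<mu>" "is_partition \<nu>" using assms by (auto simp: partition_of_def)
  note bars = bar_partition(1)[OF P(2)] bar_partition(1)[OF P(3)]
  obtain B g where B: "finite B" "\<forall>\<gamma>\<in>B. is_partition \<gamma>"
    and mult: "\<forall>n p. p permutes {1..n} \<longrightarrow>
      stable_char (bar \<mu>) n p * stable_char (bar \<nu>) n p = (\<Sum>\<gamma>\<in>B. g \<gamma> * stable_char \<gamma> n p)"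
    using stable_char_mult_in_span[OF bars] unfolding stable_span_def by blast
  have red: "of_nat (reduced_kronecker (bar \<mu>) (bar \<nu>) \<gamma>) = (if \<gamma> \<in> B then g \<gamma> else 0)" if "is_partition \<gamma>" for \<gamma>
    using B mult by (intro reduced_kronecker_coefficient[OF bars that]) auto
  \<comment> \<open>large enough for all \<open>\<gamma>\<close> in \<open>B\<close> and for the range of the sum in the claim\<close>
  define K where "K = plength \<mu> * plength \<nu> + (\<Sum>\<gamma>\<in>B. Suc (plength \<gamma>))"
  have K: "Suc (plength \<gamma>) \<le> K" if "\<gamma> \<in> B" for \<gamma>
    using member_le_sum[of \<gamma> B "\<lambda>\<gamma>. Suc (plength \<gamma>)"] that B(1) by (simp add: K_def)
  have st: "stable_char (bar \<kappa>) n p = schur n \<kappa> p" if "partition_of n \<kappa>" for \<kappa> p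
  proof -
    have "is_partition \<kappa>" "psize \<kappa> = n" using that by (auto simp: partition_of_def)
    then show ?thesis
      using stable_char_pad[of "bar \<kappa>" n p] bar_partition[of \<kappa>] pad_bar[OF that] that by simp
  qed
  have "of_nat (kronecker \<mu> \<nu> lam) = ip n (schur n lam) (\<lambda>p. schur n \<mu> p * schur n \<nu> p)"
    by (rule kronecker_ip[OF assms(2,3,4)])
  also have "\<dots> = ip n (schur n lam) (\<lambda>p. \<Sum>\<gamma>\<in>B. g \<gamma> * stable_char \<gamma> n p)"
  proof (rule ip_cong)
    fix p assume "p permutes {1..n}"
    then show "schur n \<mu> p * schur n \<nu> p = (\<Sum>\<gamma>\<in>B. g \<gamma> * stable_char \<gamma> n p)"
      unfolding st[OF assms(3), symmetric] st[OF assms(4), symmetric] using mult by blast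
  qed simp
  also have "\<dots> = (\<Sum>\<gamma>\<in>B. g \<gamma> * (\<Sum>i = 1..K. (-1) ^ (i + 1) * (if dagger lam i = \<gamma> then 1 else 0)))"
    unfolding ip_lincomb using B K by (intro sum.cong refl) (simp add: ip_schur_stable_char[OF assms(2)])
  also have "\<dots> = (\<Sum>i = 1..K. \<Sum>\<gamma>\<in>B. (-1) ^ (i + 1) * (if \<gamma> = dagger lam i then g \<gamma> else 0))"
    unfolding sum_distrib_left by (subst sum.swap) (auto intro!: sum.cong)
  also have "\<dots> = (\<Sum>i = 1..K. (-1) ^ (i + 1) * of_nat (reduced_kronecker (bar \<mu>) (bar \<nu>) (dagger lam i)))"
    using red dagger_partition(1)[OF P(1)] B(1) by (intro sum.cong refl) (simp flip: sum_distrib_left)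
  also have "\<dots> = (\<Sum>i = 1..plength \<mu> * plength \<nu>. (-1) ^ (i + 1) * of_nat (reduced_kronecker (bar \<mu>) (bar \<nu>) (dagger lam i)))"
    using reduced_kronecker_length[OF assms(1,3,4) P(1)]
    by (intro sum.mono_neutral_right) (auto simp: K_def)
  finally have "(of_int (int (kronecker \<mu> \<nu> lam)) :: complex) = of_int (\<Sum>i = 1..plength \<mu> * plength \<nu>.
       (-1) ^ (i + 1) * int (reduced_kronecker (bar \<mu>) (bar \<nu>) (dagger lam i)))"
    by simp
  then show ?thesis by (simp only: of_int_eq_iff)
qed

end
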